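(* Let $E$ and $F$ be $\sigma$-Dedekind complete Banach lattices. The following conditions are equivalent. (1) Each disjointly weakly compact operator $T:E\to F$ is weakly precompact. (2) At least one of the following assertions is valid: (a) The closed unit ball $B_E$ is weakly precompact. (b) The norm of $F$ is order continuous.
   Context: Banach lattices are real. A Banach lattice is $\sigma$-Dedekind complete if every countable nonempty subset that is bounded above has a supremum. A sequence $(x_n)$ in a Banach lattice is disjoint if $|x_n|\wedge|x_m|=0$ for $n\neq m$. $Sol(A)=\{x: |x|\le |a| \text{ for some } a\in A\}$ is the solid hull of $A$. A norm bounded set $A$ in a Banach lattice is disjointly weakly compact if every disjoint sequence in $Sol(A)$ converges weakly to zero. A bounded linear operator $T$ from a Banach space $X$ (with closed unit ball $B_X$) to a Banach lattice is disjointly weakly compact if $T(B_X)$ is a disjointly weakly compact set. A bounded set $A$ in a Banach space is weakly precompact if every sequence in $A$ has a weakly Cauchy subsequence; an operator between Banach spaces is weakly precompact if it maps norm bounded sets to weakly precompact sets. *)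

theory Defs
  imports "HOL-Analysis.Analysis" "HOL-Library.Lattice_Algebras" "HOL-Library.Lub_Glb"
begin

text \<open>
  Superclass content: \<open>banach\<close> is a complete real normed space, \<open>ordered_real_vector\<close> makes the
  order compatible with addition and nonnegative scaling, and \<open>lattice_ab_group_add_abs\<close> adds
  lattice operations with \<open>\<bar>x\<bar> = sup x (- x)\<close>.
\<close>

class banach_lattice = banach + ordered_real_vector + lattice_ab_group_add_abs +
  assumes norm_mono_abs: "\<bar>x\<bar> \<le> \<bar>y\<bar> \<Longrightarrow> norm x \<le> norm y"

instance real :: banach_lattice
  by standard (auto simp: sup_real_def abs_if)

text \<open>
  The predicates on a whole space take the class \<open>banach_lattice\<close> as a type argument,
  as in \<open>CARD('a)\<close>.
\<close>

definition sigma_dedekind_complete :: "'a::banach_lattice itself \<Rightarrow> bool" where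
  "sigma_dedekind_complete _ \<longleftrightarrow>
     (\<forall>A::'a set. countable A \<and> A \<noteq> {} \<and> bdd_above A \<longrightarrow> (\<exists>s. isLub UNIV A s))"

text \<open>
  Order continuity: every net decreasing to 0 converges to 0 in norm. A decreasing net is
  represented by its range, a downward directed set indexed by itself.
\<close>

definition order_continuous_norm :: "'a::banach_lattice itself \<Rightarrow> bool" where
  "order_continuous_norm _ \<longleftrightarrow>
     (\<forall>D::'a set. D \<noteq> {} \<and> (\<forall>x\<in>D. \<forall>y\<in>D. \<exists>z\<in>D. z \<le> x \<and> z \<le> y) \<and> isGlb UNIV D 0 \<longrightarrow>
        (\<forall>e>0. \<exists>d\<in>D. \<forall>x\<in>D. x \<le> d \<longrightarrow> norm x < e))"

definition disjoint_seq :: "(nat \<Rightarrow> 'a::banach_lattice) \<Rightarrow> bool" where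
  "disjoint_seq x \<longleftrightarrow> (\<forall>n m. n \<noteq> m \<longrightarrow> inf \<bar>x n\<bar> \<bar>x m\<bar> = 0)"

definition solid_hull :: "'a::banach_lattice set \<Rightarrow> 'a set" where
  "solid_hull A = {x. \<exists>a\<in>A. \<bar>x\<bar> \<le> \<bar>a\<bar>}"

definition weakly_converges :: "(nat \<Rightarrow> 'a::real_normed_vector) \<Rightarrow> 'a \<Rightarrow> bool" where
  "weakly_converges x l \<longleftrightarrow>
     (\<forall>f::'a \<Rightarrow> real. bounded_linear f \<longrightarrow> (\<lambda>n. f (x n)) \<longlonglongrightarrow> f l)"

definition weakly_Cauchy :: "(nat \<Rightarrow> 'a::real_normed_vector) \<Rightarrow> bool" where
  "weakly_Cauchy x \<longleftrightarrow> (\<forall>f::'a \<Rightarrow> real. bounded_linear f \<longrightarrow> Cauchy (\<lambda>n. f (x n)))"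

definition weakly_precompact :: "'a::real_normed_vector set \<Rightarrow> bool" where
  "weakly_precompact A \<longleftrightarrow> bounded A \<and>
     (\<forall>x::nat \<Rightarrow> 'a. (\<forall>n. x n \<in> A) \<longrightarrow> (\<exists>r. strict_mono r \<and> weakly_Cauchy (x \<circ> r)))"

definition disjointly_weakly_compact :: "'a::banach_lattice set \<Rightarrow> bool" where
  "disjointly_weakly_compact A \<longleftrightarrow> bounded A \<and>
     (\<forall>x. (\<forall>n. x n \<in> solid_hull A) \<and> disjoint_seq x \<longrightarrow> weakly_converges x 0)"

definition dwc_operator :: "('a::real_normed_vector \<Rightarrow> 'b::banach_lattice) \<Rightarrow> bool" where
  "dwc_operator T \<longleftrightarrow> bounded_linear T \<and> disjointly_weakly_compact (T ` cball 0 1)"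

definition weakly_precompact_operator ::
    "('a::real_normed_vector \<Rightarrow> 'b::real_normed_vector) \<Rightarrow> bool" where
  "weakly_precompact_operator T \<longleftrightarrow>
     bounded_linear T \<and> (\<forall>A. bounded A \<longrightarrow> weakly_precompact (T ` A))"

end

theory Submission
  imports Defs "HOL-Library.Function_Algebras" "HOL-Library.Diagonal_Subsequence"
    "HOL-Complex_Analysis.Great_Picard"
begin

text \<open>
  An operator that maps the unit ball into an order interval is disjointly weakly compact, because
  order bounded disjoint sequences are weakly null. If the norm of \<open>F\<close> is not order continuous, the
  bounded sequences embed into \<open>F\<close> as a sublattice with order bounded unit ball. Composing this
  embedding with an operator from \<open>E\<close> to the bounded sequences that is isometric on the span of a
  sequence without weakly Cauchy subsequences gives a disjointly weakly compact operator that is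
  not weakly precompact.

  Conversely, let the norm of \<open>F\<close> be order continuous. A sequence in a disjointly weakly compact set
  is, up to a uniformly small error for each positive functional, contained in multiples of a
  single order interval \<open>[- e, e]\<close>, so it suffices to extract weakly Cauchy subsequences from order
  intervals. There the norm is controlled by Hilbertian seminorms, for which a Banach-Saks argument
  works; this avoids both Rosenthal's theorem and the representation of the bidual.
\<close>

section \<open>Preliminaries on Banach lattices\<close>

text \<open>The obstacle in the converse is that a subsequence has to be chosen before the
  functional to be tested is known. Order continuity removes it: for each tolerance
  \<open>1 / real (Suc k)\<close> one positive functional detects all elements of an order interval
  with at least that norm. Countably many bilinear forms, one for each \<open>k\<close>, therefore
  decide about every functional, and a diagonal argument over their values suffices. The forms arise
  by multiplying elements of a principal ideal as functions on its lattice homomorphisms; a positive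
  linear extension to all bounded functions takes the place of a measure.

  In the other direction, failure of order continuity yields an order bounded disjoint sequence
  \<open>v\<close> with norms bounded below. Bounded sequences are mapped to order sums of
  \<open>a i *\<^sub>R v i\<close>, and here sigma-Dedekind completeness of the target enters.
  Disjointness lets the coordinates be read off again, so the composed operator is bounded below on
  the span of the bad sequence, and Hahn-Banach carries functionals on that span over to the
  target.\<close>

lemma scaleR_sup:
  fixes x y :: "'a::banach_lattice"
  assumes "0 \<le> c"
  shows "c *\<^sub>R sup x y = sup (c *\<^sub>R x) (c *\<^sub>R y)"
proof (cases "c = 0")
  case False
  with assms have c: "c > 0" by simp
  show ?thesis
  proof (rule antisym)
    have "x \<le> inverse c *\<^sub>R sup (c *\<^sub>R x) (c *\<^sub>R y)" "y \<le> inverse c *\<^sub>R sup (c *\<^sub>R x) (c *\<^sub>R y)"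
      using c by (auto simp: pos_le_divideR_eq)
    then have "sup x y \<le> inverse c *\<^sub>R sup (c *\<^sub>R x) (c *\<^sub>R y)" by simp
    from scaleR_left_mono[OF this, of c] show "c *\<^sub>R sup x y \<le> sup (c *\<^sub>R x) (c *\<^sub>R y)"
      using c by simp
    show "sup (c *\<^sub>R x) (c *\<^sub>R y) \<le> c *\<^sub>R sup x y"
      using assms by (intro sup_least scaleR_left_mono) auto
  qed
qed auto

lemma scaleR_inf:
  fixes x y :: "'a::banach_lattice"
  assumes "0 \<le> c"
  shows "c *\<^sub>R inf x y = inf (c *\<^sub>R x) (c *\<^sub>R y)"
proof -
  have "c *\<^sub>R inf x y = - (c *\<^sub>R sup (- x) (- y))"
    by (simp only: inf_eq_neg_sup scaleR_minus_right)
  also have "\<dots> = - sup (- (c *\<^sub>R x)) (- (c *\<^sub>R y))"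
    by (simp only: scaleR_sup[OF assms] scaleR_minus_right)
  also have "\<dots> = inf (c *\<^sub>R x) (c *\<^sub>R y)"
    by (rule inf_eq_neg_sup[symmetric])
  finally show ?thesis .
qed

lemma scaleR_pprt:
  fixes x :: "'a::banach_lattice"
  shows "0 \<le> c \<Longrightarrow> pprt (c *\<^sub>R x) = c *\<^sub>R pprt x"
  unfolding pprt_def by (simp only: scaleR_sup scaleR_zero_right)

lemma lattice_abs_scaleR:
  fixes x :: "'a::banach_lattice"
  shows "\<bar>c *\<^sub>R x\<bar> = \<bar>c\<bar> *\<^sub>R \<bar>x\<bar>"
proof (cases "0 \<le> c")
  case True
  then show ?thesis using scaleR_sup[of c x "- x"] by (simp add: abs_lattice[where 'a='a])
next
  case False
  then have "\<bar>c *\<^sub>R x\<bar> = \<bar>(- c) *\<^sub>R x\<bar>" by simp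
  also have "\<dots> = (- c) *\<^sub>R \<bar>x\<bar>"
    using False scaleR_sup[of "- c" x "- x"] by (simp add: abs_lattice[where 'a='a])
  finally show ?thesis using False by simp
qed

lemma lattice_abs_le_iff:
  fixes x :: "'a::banach_lattice"
  shows "\<bar>x\<bar> \<le> y \<longleftrightarrow> x \<le> y \<and> - x \<le> y"
  by (simp add: abs_lattice)

lemma norm_lattice_abs [simp]:
  fixes x :: "'a::banach_lattice"
  shows "norm \<bar>x\<bar> = norm x"
  by (intro antisym norm_mono_abs) auto

lemma norm_mono_nonneg:
  fixes x y :: "'a::banach_lattice"
  shows "0 \<le> x \<Longrightarrow> x \<le> y \<Longrightarrow> norm x \<le> norm y"
  by (rule norm_mono_abs) (metis abs_of_nonneg order_trans)

lemma norm_le_of_abs_le: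
  fixes x y :: "'a::banach_lattice"
  shows "\<bar>x\<bar> \<le> y \<Longrightarrow> norm x \<le> norm y"
  by (metis norm_lattice_abs norm_mono_nonneg abs_ge_zero)

section \<open>Norm limits and the order\<close>

lemma tendsto_lattice_abs:
  fixes x :: "nat \<Rightarrow> 'a::banach_lattice"
  assumes "x \<longlonglongrightarrow> l"
  shows "(\<lambda>n. \<bar>x n\<bar>) \<longlonglongrightarrow> \<bar>l\<bar>"
proof -
  have "norm (\<bar>x n\<bar> - \<bar>l\<bar>) \<le> norm (x n - l)" for n
    by (rule norm_mono_abs) (rule abs_triangle_ineq3)
  moreover have "(\<lambda>n. norm (x n - l)) \<longlonglongrightarrow> 0"
    using assms by (simp add: LIM_zero_iff tendsto_norm_zero)
  ultimately have "(\<lambda>n. \<bar>x n\<bar> - \<bar>l\<bar>) \<longlonglongrightarrow> 0"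
    by (intro Lim_null_comparison[of "\<lambda>n. \<bar>x n\<bar> - \<bar>l\<bar>" "\<lambda>n. norm (x n - l)"] always_eventually allI)
  then show ?thesis by (rule LIM_zero_cancel)
qed

lemma limit_nonneg:
  fixes x :: "nat \<Rightarrow> 'a::banach_lattice"
  assumes "x \<longlonglongrightarrow> l" "\<forall>\<^sub>F n in sequentially. 0 \<le> x n"
  shows "0 \<le> l"
proof -
  have "(\<lambda>n. \<bar>x n\<bar>) \<longlonglongrightarrow> l"
    using assms(1) by (rule Lim_transform_eventually) (use assms(2) in \<open>auto elim: eventually_mono\<close>)
  then have "\<bar>l\<bar> = l" using tendsto_lattice_abs[OF assms(1)] LIMSEQ_unique by blast
  then show ?thesis by (metis abs_ge_zero)
qed

lemma limit_le:
  fixes x y :: "nat \<Rightarrow> 'a::banach_lattice"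
  assumes "x \<longlonglongrightarrow> a" "y \<longlonglongrightarrow> b" "\<forall>\<^sub>F n in sequentially. x n \<le> y n"
  shows "a \<le> b"
  using limit_nonneg[OF tendsto_diff[OF assms(2,1)]] assms(3) by simp

text \<open>Divide by \<open>n\<close> and let \<open>n\<close> tend to infinity: the positive cone
  is norm closed.\<close>

lemma archimedean_le_zero:
  fixes x y :: "'a::banach_lattice"
  assumes "\<And>n::nat. real n *\<^sub>R x \<le> y"
  shows "x \<le> 0"
proof -
  have "x \<le> inverse (real (Suc n)) *\<^sub>R y" for n
    using assms[of "Suc n"] by (simp add: pos_le_divideR_eq del: of_nat_Suc)
  moreover have "(\<lambda>n. inverse (real (Suc n)) *\<^sub>R y) \<longlonglongrightarrow> 0 *\<^sub>R y"
    by (intro tendsto_scaleR LIMSEQ_inverse_real_of_nat tendsto_const)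
  ultimately show ?thesis
    using limit_le[OF tendsto_const[of x]] by fastforce
qed

lemma le_of_le_add_scaleR:
  fixes x y u :: "'a::banach_lattice"
  assumes "\<And>e. e > 0 \<Longrightarrow> x \<le> y + e *\<^sub>R u"
  shows "x \<le> y"
proof -
  \<comment> \<open>The bound \<open>pprt u\<close> instead of \<open>u\<close> also covers
    \<open>n = 0\<close>, where the bound itself has to be nonnegative.\<close>
  have "real n *\<^sub>R (x - y) \<le> pprt u" for n
  proof (cases "n = 0")
    case False
    have "x - y \<le> inverse (real n) *\<^sub>R u" using assms[of "inverse (real n)"] False
      by (simp add: algebra_simps)
    then have "real n *\<^sub>R (x - y) \<le> u" using False by (simp add: pos_le_divideR_eq)
    then show ?thesis by (metis pprt_def le_supI1)
  qed simp
  from archimedean_le_zero[OF this] show ?thesis by simp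
qed

lemma sum_le_suminf_lattice:
  fixes f :: "nat \<Rightarrow> 'a::banach_lattice"
  assumes "summable f" "\<And>i. 0 \<le> f i"
  shows "sum f {..<n} \<le> suminf f"
proof (rule limit_le[OF tendsto_const summable_LIMSEQ[OF assms(1)]])
  show "\<forall>\<^sub>F m in sequentially. sum f {..<n} \<le> sum f {..<m}"
    unfolding eventually_sequentially
    by (intro exI[of _ n] allI impI sum_mono2) (use assms(2) in auto)
qed

lemma term_le_suminf_lattice:
  fixes f :: "nat \<Rightarrow> 'a::banach_lattice"
  assumes "summable f" "\<And>i. 0 \<le> f i"
  shows "f i \<le> suminf f"
proof -
  have "f i \<le> sum f {..<Suc i}" using assms(2) by (simp add: sum_nonneg)
  also have "\<dots> \<le> suminf f" by (rule sum_le_suminf_lattice[OF assms])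
  finally show ?thesis .
qed

lemma suminf_nonneg_lattice:
  fixes f :: "nat \<Rightarrow> 'a::banach_lattice"
  assumes "summable f" "\<And>i. 0 \<le> f i"
  shows "0 \<le> suminf f"
  using term_le_suminf_lattice[OF assms, of 0] assms(2)[of 0] by order

section \<open>Disjointness and positive parts\<close>

lemma disjoint_mono:
  fixes x y :: "'a::banach_lattice"
  assumes "inf x y = 0" "0 \<le> x'" "x' \<le> x" "0 \<le> y'" "y' \<le> y"
  shows "inf x' y' = 0"
  using assms inf_mono[of x' x y' y] by (simp add: order.antisym)

text \<open>These are the positive and the negative part of \<open>x - y\<close>, that is,
  \<open>sup x y\<close> minus \<open>y\<close> and minus \<open>x\<close>.\<close>

lemma disjoint_pprt_diff:
  fixes x y :: "'a::banach_lattice"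
  shows "inf (pprt (x - y)) (pprt (y - x)) = 0"
proof -
  have 1: "pprt (x - y) = sup x y + - y"
    unfolding pprt_def add_sup_distrib_right by simp
  have 2: "pprt (y - x) = sup x y + - x"
    unfolding pprt_def add_sup_distrib_right by (simp add: sup_commute)
  have "inf (sup x y + - y) (sup x y + - x) = sup x y + inf (- y) (- x)"
    by (rule add_inf_distrib_left[symmetric])
  also have "inf (- y) (- x) = - sup x y"
    unfolding neg_sup_eq_inf by (rule inf_commute)
  also have "sup x y + - sup x y = 0" by (rule right_minus)
  finally show ?thesis unfolding 1 2 .
qed

lemma inf_add_le:
  fixes x y z :: "'a::banach_lattice"
  assumes "0 \<le> x" "0 \<le> y" "0 \<le> z"
  shows "inf x (y + z) \<le> inf x y + inf x z"
proof -
  have *: "inf x y + inf x z = inf (inf (x + x) (x + z)) (inf (y + x) (y + z))"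
    by (simp add: add_inf_distrib_left add_inf_distrib_right inf.assoc inf.left_commute)
  have a: "inf x (y + z) \<le> x" by simp
  have "inf x (y + z) \<le> x + x" "inf x (y + z) \<le> x + z" "inf x (y + z) \<le> y + x"
    using order_trans[OF a] assms by (simp_all add: le_add_same_cancel1 le_add_same_cancel2 add_increasing add_increasing2)
  then show ?thesis unfolding * by simp
qed

lemma disjoint_add:
  fixes x y z :: "'a::banach_lattice"
  assumes "inf x y = 0" "inf x z = 0" "0 \<le> x" "0 \<le> y" "0 \<le> z"
  shows "inf x (y + z) = 0"
  using inf_add_le[of x y z] assms by (simp add: order.antisym)

lemma disjoint_sum:
  fixes x :: "'a::banach_lattice"
  assumes "finite I" "0 \<le> x" "\<And>i. i \<in> I \<Longrightarrow> 0 \<le> y i \<and> inf x (y i) = 0"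
  shows "inf x (\<Sum>i\<in>I. y i) = 0"
  using assms by (induction I) (auto simp: inf_absorb2 intro!: disjoint_add sum_nonneg)

lemma disjoint_scaleR:
  fixes x y :: "'a::banach_lattice"
  assumes "inf x y = 0" "0 \<le> x" "0 \<le> y" "0 \<le> c"
  shows "inf x (c *\<^sub>R y) = 0"
proof -
  \<comment> \<open>The factor \<open>c + 1\<close> dominates both \<open>1\<close> and
    \<open>c\<close>, so a common scaling followed by monotonicity is enough.\<close>
  have "inf ((c + 1) *\<^sub>R x) ((c + 1) *\<^sub>R y) = 0"
    using scaleR_inf[of "c + 1" x y] assms by simp
  moreover have "x \<le> (c + 1) *\<^sub>R x" "c *\<^sub>R y \<le> (c + 1) *\<^sub>R y"
    using assms by (simp_all add: algebra_simps scaleR_nonneg_nonneg)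
  ultimately show ?thesis
    using disjoint_mono[of "(c + 1) *\<^sub>R x" "(c + 1) *\<^sub>R y" x "c *\<^sub>R y"] assms
    by (simp add: scaleR_nonneg_nonneg)
qed

lemma disjoint_add_eq_sup:
  fixes x y :: "'a::banach_lattice"
  shows "inf x y = 0 \<Longrightarrow> x + y = sup x y"
  using add_eq_inf_sup[of x y] by simp

lemma pprt_add_le:
  fixes x y :: "'a::banach_lattice"
  shows "pprt (x + y) \<le> pprt x + pprt y"
proof -
  have "x \<le> pprt x" "y \<le> pprt y" by (simp_all add: pprt_def)
  then have "x + y \<le> pprt x + pprt y" by (rule add_mono)
  moreover have "0 \<le> pprt x + pprt y" by (intro add_nonneg_nonneg zero_le_pprt)
  ultimately show ?thesis unfolding pprt_def[of "x + y"] by (rule sup_least)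
qed

lemma pprt_le_abs:
  fixes x :: "'a::banach_lattice"
  shows "pprt x \<le> \<bar>x\<bar>"
  by (simp add: pprt_def abs_ge_self)

lemma abs_le_abs_add_disjoint:
  fixes x r :: "'a::banach_lattice"
  assumes "inf \<bar>x\<bar> \<bar>r\<bar> = 0"
  shows "\<bar>x\<bar> \<le> \<bar>x + r\<bar>"
proof -
  have "\<bar>x\<bar> \<le> \<bar>x + r\<bar> + \<bar>r\<bar>"
    by (metis abs_triangle_ineq4 add_diff_cancel_right')
  then have "\<bar>x\<bar> = inf \<bar>x\<bar> (\<bar>x + r\<bar> + \<bar>r\<bar>)" by (simp add: inf_absorb1)
  also have "\<dots> \<le> inf \<bar>x\<bar> \<bar>x + r\<bar> + inf \<bar>x\<bar> \<bar>r\<bar>" by (intro inf_add_le) auto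
  also have "\<dots> \<le> \<bar>x + r\<bar>" using assms by simp
  finally show ?thesis .
qed

section \<open>Sublinear functionals\<close>

text \<open>Linearity relative to a set, because the order ideals and function spaces below are
  subspaces and not types.\<close>

definition linear_on_set :: "'a::real_vector set \<Rightarrow> ('a \<Rightarrow> real) \<Rightarrow> bool" where
  "linear_on_set S g \<longleftrightarrow> (\<forall>x\<in>S. \<forall>y\<in>S. g (x + y) = g x + g y) \<and> (\<forall>c. \<forall>x\<in>S. g (c *\<^sub>R x) = c * g x)"

definition sublinear_on :: "'a::real_vector set \<Rightarrow> ('a \<Rightarrow> real) \<Rightarrow> bool" where
  "sublinear_on S q \<longleftrightarrow> (\<forall>x\<in>S. \<forall>y\<in>S. q (x + y) \<le> q x + q y) \<and>
     (\<forall>c\<ge>0. \<forall>x\<in>S. q (c *\<^sub>R x) = c * q x)"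

lemma sublinear_on_zero: "sublinear_on S q \<Longrightarrow> x \<in> S \<Longrightarrow> q 0 = 0"
  unfolding sublinear_on_def by (metis mult_zero_left order_refl scale_zero_left)

lemma sublinear_on_minus:
  assumes "subspace S" "sublinear_on S q" "x \<in> S"
  shows "- q (- x) \<le> q x"
proof -
  have "q (x + - x) \<le> q x + q (- x)"
    using assms subspace_neg unfolding sublinear_on_def by blast
  then show ?thesis using sublinear_on_zero[OF assms(2,3)] by simp
qed

text \<open>The expression decreases in \<open>t\<close>, so this is its limit as \<open>t\<close>
  tends to infinity. It lowers \<open>q\<close> to a sublinear functional that is linear along
  \<open>z\<close>: \<open>t = 1\<close> bounds the value at \<open>- z\<close> by
  \<open>- q z\<close>. Being a limit, it also inherits the preservation of maxima from
  \<open>q\<close>.\<close>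

definition slope_inf :: "('a::real_vector \<Rightarrow> real) \<Rightarrow> 'a \<Rightarrow> 'a \<Rightarrow> real" where
  "slope_inf q z x = (INF t\<in>{0..}. q (x + t *\<^sub>R z) - t * q z)"

context
  fixes S :: "'a::real_vector set" and q z
  assumes S: "subspace S" and q: "sublinear_on S q" and z: "z \<in> S"
begin

lemma sublinear_add: "x \<in> S \<Longrightarrow> y \<in> S \<Longrightarrow> q (x + y) \<le> q x + q y"
  and sublinear_scale: "0 \<le> c \<Longrightarrow> x \<in> S \<Longrightarrow> q (c *\<^sub>R x) = c * q x"
  using q by (auto simp: sublinear_on_def)

lemma slope_closed: "x \<in> S \<Longrightarrow> x + t *\<^sub>R z \<in> S"
  using S z by (simp add: subspace_add subspace_scale)

lemma slope_bdd:
  assumes "x \<in> S"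
  shows "bdd_below ((\<lambda>t. q (x + t *\<^sub>R z) - t * q z) ` {0..})"
proof (rule bdd_belowI2)
  fix t :: real assume t: "t \<in> {0..}"
  have "q (t *\<^sub>R z) \<le> q (x + t *\<^sub>R z) + q (- x)"
    using sublinear_add[OF slope_closed[OF assms, of t], of "- x"] assms S by (simp add: subspace_neg)
  then show "- q (- x) \<le> q (x + t *\<^sub>R z) - t * q z"
    using t sublinear_scale[of t z] z by simp
qed

lemma slope_inf_le: "x \<in> S \<Longrightarrow> 0 \<le> t \<Longrightarrow> slope_inf q z x \<le> q (x + t *\<^sub>R z) - t * q z"
  unfolding slope_inf_def by (rule cINF_lower[OF slope_bdd]) auto

lemma slope_inf_greatest:
  "(\<And>t. 0 \<le> t \<Longrightarrow> b \<le> q (x + t *\<^sub>R z) - t * q z) \<Longrightarrow> b \<le> slope_inf q z x"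
  unfolding slope_inf_def by (rule cINF_greatest) auto

lemma slope_antimono:
  assumes "x \<in> S" "0 \<le> s" "s \<le> t"
  shows "q (x + t *\<^sub>R z) - t * q z \<le> q (x + s *\<^sub>R z) - s * q z"
proof -
  have "x + t *\<^sub>R z = (x + s *\<^sub>R z) + (t - s) *\<^sub>R z" by (simp add: algebra_simps)
  then have "q (x + t *\<^sub>R z) \<le> q (x + s *\<^sub>R z) + q ((t - s) *\<^sub>R z)"
    using sublinear_add[OF slope_closed[OF assms(1)] subspace_scale[OF S z], of s "t - s"] by (simp only:)
  then show ?thesis using sublinear_scale[of "t - s" z] z assms by (simp add: algebra_simps)
qed

text \<open>Since the slopes decrease, one good \<open>t\<close> makes all larger ones good, so two
  such conditions can be met by one parameter.\<close>

lemma slope_inf_less: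
  assumes "x \<in> S" "slope_inf q z x < b"
  obtains t where "0 \<le> t" "\<And>s. t \<le> s \<Longrightarrow> q (x + s *\<^sub>R z) - s * q z < b"
proof -
  have "(INF t\<in>{0..}. q (x + t *\<^sub>R z) - t * q z) < b"
    using assms(2) by (simp add: slope_inf_def)
  then obtain t where t: "t \<in> {0..}" "q (x + t *\<^sub>R z) - t * q z < b"
    unfolding cINF_less_iff[OF not_Ici_eq_empty slope_bdd[OF assms(1)]] by blast
  show ?thesis
  proof (rule that)
    show "0 \<le> t" using t by simp
    fix s assume "t \<le> s"
    with t have "q (x + s *\<^sub>R z) - s * q z \<le> q (x + t *\<^sub>R z) - t * q z"
      by (intro slope_antimono[OF assms(1)]) auto
    with t(2) show "q (x + s *\<^sub>R z) - s * q z < b" by (rule order.strict_trans1[rotated])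
  qed
qed

lemma slope_inf_sublinear: "sublinear_on S (slope_inf q z)"
  unfolding sublinear_on_def
proof (intro conjI ballI allI impI)
  fix x y assume x: "x \<in> S" and y: "y \<in> S"
  show "slope_inf q z (x + y) \<le> slope_inf q z x + slope_inf q z y"
  proof (rule field_le_epsilon)
    fix e :: real assume e: "e > 0"
    have "slope_inf q z x < slope_inf q z x + e / 2" using e by simp
    from slope_inf_less[OF x this] obtain s where s: "0 \<le> s"
      "q (x + s *\<^sub>R z) - s * q z < slope_inf q z x + e / 2"
      by (metis order_refl)
    have "slope_inf q z y < slope_inf q z y + e / 2" using e by simp
    from slope_inf_less[OF y this] obtain t where t: "0 \<le> t"
      "q (y + t *\<^sub>R z) - t * q z < slope_inf q z y + e / 2"
      by (metis order_refl)
    have "slope_inf q z (x + y) \<le> q ((x + y) + (s + t) *\<^sub>R z) - (s + t) * q z"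
      using slope_inf_le[of "x + y" "s + t"] s t x y S by (simp add: subspace_add)
    also have "(x + y) + (s + t) *\<^sub>R z = (x + s *\<^sub>R z) + (y + t *\<^sub>R z)" by (simp add: algebra_simps)
    also have "q \<dots> \<le> q (x + s *\<^sub>R z) + q (y + t *\<^sub>R z)"
      using sublinear_add slope_closed x y by blast
    finally show "slope_inf q z (x + y) \<le> slope_inf q z x + slope_inf q z y + e"
      using s t by (simp add: algebra_simps)
  qed
next
  have le: "slope_inf q z (c *\<^sub>R x) \<le> c * slope_inf q z x" if "c > 0" "x \<in> S" for c x
  proof -
    have "slope_inf q z (c *\<^sub>R x) / c \<le> slope_inf q z x"
    proof (rule slope_inf_greatest)
      fix t :: real assume t: "0 \<le> t"
      have "slope_inf q z (c *\<^sub>R x) \<le> q (c *\<^sub>R x + (c * t) *\<^sub>R z) - (c * t) * q z"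
        using slope_inf_le[of "c *\<^sub>R x" "c * t"] that t S by (simp add: subspace_scale)
      also have "c *\<^sub>R x + (c * t) *\<^sub>R z = c *\<^sub>R (x + t *\<^sub>R z)" by (simp add: algebra_simps)
      also have "q \<dots> = c * q (x + t *\<^sub>R z)" using sublinear_scale slope_closed that by simp
      finally show "slope_inf q z (c *\<^sub>R x) / c \<le> q (x + t *\<^sub>R z) - t * q z"
        using that by (simp add: field_simps)
    qed
    then show ?thesis using that by (simp add: field_simps)
  qed
  fix c :: real and x assume c: "0 \<le> c" and x: "x \<in> S"
  show "slope_inf q z (c *\<^sub>R x) = c * slope_inf q z x"
  proof (cases "c = 0")
    case True
    have "q (0 + t *\<^sub>R z) - t * q z = 0" if "t \<ge> 0" for t using sublinear_scale[OF that z] by simp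
    then have "slope_inf q z 0 = (INF t\<in>{0::real..}. 0)" unfolding slope_inf_def by (intro INF_cong) auto
    then show ?thesis using True by simp
  next
    case False
    with c have c: "c > 0" by simp
    have "slope_inf q z (inverse c *\<^sub>R (c *\<^sub>R x)) \<le> inverse c * slope_inf q z (c *\<^sub>R x)"
      using le[of "inverse c" "c *\<^sub>R x"] c x S by (simp add: subspace_scale)
    then show ?thesis using le[OF c x] c by (simp add: field_simps)
  qed
qed

end

text \<open>
  Minimal sublinear functionals are linear. The constraint set \<open>R\<close> records suprema that the
  functional has to preserve: it is empty for the Hahn-Banach theorem, and consists of all
  triples \<open>(x, y, sup x y)\<close> for the existence of lattice homomorphisms.
\<close>

lemma linear_below_sublinear:
  fixes p :: "'a::real_vector \<Rightarrow> real"
  assumes S: "subspace S" and p: "sublinear_on S p" and v: "v \<in> S"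
    and R: "\<And>x y w. (x, y, w) \<in> R \<Longrightarrow> x \<in> S \<and> y \<in> S \<and> w \<in> S"
    and Rp: "\<And>x y w. (x, y, w) \<in> R \<Longrightarrow> p w = max (p x) (p y)"
    and Rt: "\<And>x y w s. (x, y, w) \<in> R \<Longrightarrow> s \<in> S \<Longrightarrow> (x + s, y + s, w + s) \<in> R"
  obtains g where "linear_on_set S g" "\<And>x. x \<in> S \<Longrightarrow> g x \<le> p x" "g v = p v"
    "\<And>x y w. (x, y, w) \<in> R \<Longrightarrow> g w = max (g x) (g y)"
proof -
  \<comment> \<open>Vanishing outside \<open>S\<close> makes the pointwise order on total functions
    agree with the order on \<open>S\<close>, so that minimality gives equality of
    functions.\<close>
  define adm where "adm q \<longleftrightarrow> sublinear_on S q \<and> (\<forall>x\<in>S. q x \<le> p x) \<and> (\<forall>x. x \<notin> S \<longrightarrow> q x = 0) \<and>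
    (\<forall>x y w. (x, y, w) \<in> R \<longrightarrow> q w = max (q x) (q y))" for q
  define ext where "ext q = (\<lambda>x. if x \<in> S then q x else (0::real))" for q
  have Sc: "x \<in> S \<Longrightarrow> y \<in> S \<Longrightarrow> x + y \<in> S" "x \<in> S \<Longrightarrow> c *\<^sub>R x \<in> S" "x \<in> S \<Longrightarrow> - x \<in> S" for x y c
    using S by (auto simp: subspace_add subspace_scale subspace_neg)
  have ext_slope: "adm (ext (slope_inf q z))" "\<And>x. x \<in> S \<Longrightarrow> slope_inf q z x \<le> q x"
    if q: "sublinear_on S q" "\<forall>x\<in>S. q x \<le> p x" "\<forall>x y w. (x, y, w) \<in> R \<longrightarrow> q w = max (q x) (q y)"
      and z: "z \<in> S" for q z
  proof -
    show le: "slope_inf q z x \<le> q x" if "x \<in> S" for x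
      using slope_inf_le[OF S q(1) z that, of 0] by simp
    have "slope_inf q z w = max (slope_inf q z x) (slope_inf q z y)" if r: "(x, y, w) \<in> R" for x y w
    proof -
      have mem: "x \<in> S" "y \<in> S" "w \<in> S" using R[OF r] by auto
      have mx: "q (w + t *\<^sub>R z) - t * q z = max (q (x + t *\<^sub>R z) - t * q z) (q (y + t *\<^sub>R z) - t * q z)" for t
        using q(3) Rt[OF r, of "t *\<^sub>R z"] Sc z by (simp add: max_def)
      show ?thesis
      proof (rule antisym)
        show "slope_inf q z w \<le> max (slope_inf q z x) (slope_inf q z y)"
        proof (rule ccontr)
          assume "\<not> ?thesis"
          then have "slope_inf q z x < slope_inf q z w" "slope_inf q z y < slope_inf q z w" by auto
          then obtain s t where st: "0 \<le> s" "0 \<le> t"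
            "\<And>r. s \<le> r \<Longrightarrow> q (x + r *\<^sub>R z) - r * q z < slope_inf q z w"
            "\<And>r. t \<le> r \<Longrightarrow> q (y + r *\<^sub>R z) - r * q z < slope_inf q z w"
            using slope_inf_less[OF S q(1) z] mem by metis
          have "q (w + max s t *\<^sub>R z) - max s t * q z < slope_inf q z w"
            unfolding mx using st(3,4)[of "max s t"] by simp
          then show False using slope_inf_le[OF S q(1) z mem(3), of "max s t"] st(1) by (simp add: le_max_iff_disj)
        qed
        have "slope_inf q z x \<le> slope_inf q z w"
          by (rule slope_inf_greatest[OF S q(1) z]) (use mx slope_inf_le[OF S q(1) z mem(1)] in \<open>fastforce simp: max_def\<close>)
        moreover have "slope_inf q z y \<le> slope_inf q z w"
          by (rule slope_inf_greatest[OF S q(1) z]) (use mx slope_inf_le[OF S q(1) z mem(2)] in \<open>fastforce simp: max_def\<close>)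
        ultimately show "max (slope_inf q z x) (slope_inf q z y) \<le> slope_inf q z w" by simp
      qed
    qed
    moreover have "sublinear_on S (ext (slope_inf q z))"
      using slope_inf_sublinear[OF S q(1) z] Sc unfolding sublinear_on_def ext_def by simp
    moreover have "\<forall>x\<in>S. slope_inf q z x \<le> p x" using le q(2) order_trans by blast
    ultimately show "adm (ext (slope_inf q z))"
      unfolding adm_def using R by (auto simp: ext_def)
  qed
  \<comment> \<open>Staying below \<open>slope_inf p v\<close> forces the value at
    \<open>- v\<close> to be at most \<open>- p v\<close>; for a linear functional this makes the
    value at \<open>v\<close> equal to \<open>p v\<close>.\<close>
  define A where "A = {q. adm q \<and> (\<forall>x\<in>S. q x \<le> slope_inf p v x)}"
  have p': "\<forall>x y w. (x, y, w) \<in> R \<longrightarrow> p w = max (p x) (p y)" using Rp by blast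
  have pA: "ext (slope_inf p v) \<in> A"
    unfolding A_def using ext_slope(1)[OF p _ p' v] by (simp add: ext_def)
  have "\<exists>m\<in>A. \<forall>a\<in>A. m \<ge> a \<longrightarrow> a = m"
  proof (rule predicate_Zorn)
    show "partial_order_on A (relation_of (\<ge>) A)"
      by (rule partial_order_on_relation_ofI) auto
    fix C assume C: "C \<in> Chains (relation_of (\<ge>) A)"
    have CA: "C \<subseteq> A" and Cc: "\<And>a b. a \<in> C \<Longrightarrow> b \<in> C \<Longrightarrow> a \<le> b \<or> b \<le> a"
      using C unfolding Chains_def relation_of_def by auto
    show "\<exists>u\<in>A. \<forall>a\<in>C. u \<le> a"
    proof (cases "C = {}")
      case True then show ?thesis using pA by auto
    next
      case False
      have Cadm: "adm c" "\<And>x. x \<in> S \<Longrightarrow> c x \<le> slope_inf p v x" if "c \<in> C" for c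
        using that CA by (auto simp: A_def)
      define u where "u x = (INF c\<in>C. c x)" for x
      have bdd: "bdd_below ((\<lambda>c. c x) ` C)" for x
      proof (cases "x \<in> S")
        case True
        show ?thesis
        proof (rule bdd_belowI2)
          fix c assume c: "c \<in> C"
          have "- c (- x) \<le> c x" "c (- x) \<le> p (- x)"
            using sublinear_on_minus[OF S _ True, of c] Cadm(1)[OF c] Sc(3)[OF True] by (simp_all add: adm_def)
          then show "- p (- x) \<le> c x" by linarith
        qed
      next
        case False
        show ?thesis
        proof (rule bdd_belowI2)
          fix c assume "c \<in> C"
          then show "0 \<le> c x" using Cadm(1)[of c] False by (simp add: adm_def)
        qed
      qed
      have ule: "u x \<le> c x" if "c \<in> C" for c x
        unfolding u_def by (rule cINF_lower[OF bdd that])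
      have uless: "\<exists>c\<in>C. c x < b" if "u x < b" for x b
        using that unfolding u_def using cINF_less_iff[OF False bdd] by blast
      \<comment> \<open>Strict bounds witnessed by two members of the chain hold together for the
        smaller member. Subadditivity and the preservation of maxima by the infimum \<open>u\<close>
        both rest on this.\<close>
      have both: "\<exists>c\<in>C. c x < b \<and> c y < b'" if ub: "u x < b" "u y < b'" for x y b b'
      proof -
        obtain c where c: "c \<in> C" "c x < b" using uless[OF ub(1)] by blast
        obtain d where d: "d \<in> C" "d y < b'" using uless[OF ub(2)] by blast
        from Cc[OF c(1) d(1)] c d show ?thesis unfolding le_fun_def by (meson le_less_trans)
      qed
      have "sublinear_on S u"
        unfolding sublinear_on_def
      proof (intro conjI ballI allI impI)
        fix x y assume xy: "x \<in> S" "y \<in> S"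
        show "u (x + y) \<le> u x + u y"
        proof (rule field_le_epsilon)
          fix e :: real assume "e > 0"
          then obtain c where c: "c \<in> C" "c x < u x + e / 2" "c y < u y + e / 2"
            using both[of x "u x + e / 2" y "u y + e / 2"] by auto
          have "u (x + y) \<le> c (x + y)" using ule c by blast
          also have "\<dots> \<le> c x + c y" using Cadm(1)[OF c(1)] xy by (auto simp: adm_def sublinear_on_def)
          finally show "u (x + y) \<le> u x + u y + e" using c by simp
        qed
      next
        fix c :: real and x assume c: "0 \<le> c" "x \<in> S"
        have eq: "d (c *\<^sub>R x) = c * d x" if "d \<in> C" for d
          using Cadm(1)[OF that] c by (auto simp: adm_def sublinear_on_def)
        show "u (c *\<^sub>R x) = c * u x"
        proof (cases "c = 0")
          case True
          have "u (c *\<^sub>R x) = (INF d\<in>C. 0)" unfolding u_def by (rule INF_cong) (use eq True in auto)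
          then show ?thesis using True False by simp
        next
          case c0: False
          show ?thesis
          proof (rule antisym)
            have "u (c *\<^sub>R x) / c \<le> u x"
              unfolding u_def[of x]
              by (rule cINF_greatest[OF False]) (use ule[of _ "c *\<^sub>R x"] eq c c0 in \<open>auto simp: field_simps\<close>)
            then show "u (c *\<^sub>R x) \<le> c * u x" using c c0 by (simp add: field_simps)
            show "c * u x \<le> u (c *\<^sub>R x)"
              unfolding u_def[of "c *\<^sub>R x"]
              by (rule cINF_greatest[OF False]) (simp add: eq mult_left_mono[OF ule c(1)])
          qed
        qed
      qed
      moreover have "u w = max (u x) (u y)" if r: "(x, y, w) \<in> R" for x y w
      proof -
        have mx: "c w = max (c x) (c y)" if "c \<in> C" for c using Cadm(1)[OF that] r by (auto simp: adm_def)
        show ?thesis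
        proof (rule antisym)
          show "u w \<le> max (u x) (u y)"
          proof (rule ccontr)
            assume "\<not> ?thesis"
            then have "u x < u w" "u y < u w" by auto
            from both[OF this] obtain c where "c \<in> C" "c x < u w" "c y < u w" by blast
            then show False using mx[of c] ule[of c w] by (auto simp: max_def split: if_splits)
          qed
          show "max (u x) (u y) \<le> u w"
            unfolding u_def[of w]
            by (rule cINF_greatest[OF False]) (simp only: mx, intro max.mono ule)
        qed
      qed
      moreover obtain c0 where c0: "c0 \<in> C" using False by blast
      moreover have "\<forall>x\<in>S. u x \<le> p x" "\<forall>x\<in>S. u x \<le> slope_inf p v x"
        using ule[OF c0] Cadm[OF c0] unfolding adm_def by (meson order_trans)+
      moreover have "u x = 0" if "x \<notin> S" for x
      proof -
        have "u x = (INF c\<in>C. 0)" unfolding u_def by (rule INF_cong) (use Cadm(1) that in \<open>auto simp: adm_def\<close>)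
        then show ?thesis using False by simp
      qed
      ultimately have "u \<in> A" unfolding A_def adm_def by blast
      then show ?thesis using ule by (auto simp: le_fun_def)
    qed
  qed
  then obtain m where mA: "m \<in> A" and mmin: "\<And>a. a \<in> A \<Longrightarrow> a \<le> m \<Longrightarrow> a = m" by blast
  have m: "sublinear_on S m" "\<forall>x\<in>S. m x \<le> p x" "\<forall>x y w. (x, y, w) \<in> R \<longrightarrow> m w = max (m x) (m y)"
    "\<And>x. x \<notin> S \<Longrightarrow> m x = 0" "\<And>x. x \<in> S \<Longrightarrow> m x \<le> slope_inf p v x"
    using mA by (auto simp: A_def adm_def)
  \<comment> \<open>By minimality, lowering \<open>m\<close> along any \<open>z\<close> changes
    nothing. With \<open>t = 1\<close> this is the missing superadditivity.\<close>
  have slope_eq: "slope_inf m z x = m x" if "z \<in> S" "x \<in> S" for z x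
  proof -
    have "ext (slope_inf m z) \<le> m"
      using ext_slope(2)[OF m(1-3) that(1)] m(4) by (auto simp: le_fun_def ext_def)
    moreover have "ext (slope_inf m z) \<in> A"
      unfolding A_def using ext_slope[OF m(1-3) that(1)] m(5) by (force simp: ext_def)
    ultimately show ?thesis using mmin that by (metis ext_def)
  qed
  have add: "m (x + y) = m x + m y" if "x \<in> S" "y \<in> S" for x y
    using slope_inf_le[OF S m(1) that(2,1), of 1] slope_eq[OF that(2,1)] m(1) that
    by (force simp: sublinear_on_def)
  have m0: "m 0 = 0" using sublinear_on_zero[OF m(1) v] .
  have neg: "m (- x) = - m x" if "x \<in> S" for x using add[of x "- x"] Sc that m0 by simp
  have "m (c *\<^sub>R x) = c * m x" if "x \<in> S" for c x
  proof (cases "0 \<le> c")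
    case True then show ?thesis using m(1) that by (auto simp: sublinear_on_def)
  next
    case False
    then have "0 \<le> - c" by simp
    then have "m ((- c) *\<^sub>R x) = (- c) * m x" using m(1) that unfolding sublinear_on_def by blast
    then show ?thesis using neg[of "c *\<^sub>R x"] Sc that by simp
  qed
  then have lin: "linear_on_set S m" using add by (simp add: linear_on_set_def)
  have "m (- v) \<le> - p v"
    using m(5)[of "- v"] slope_inf_le[OF S p v, of "- v" 1] Sc v sublinear_on_zero[OF p v] by simp
  then have "m v = p v" using neg[OF v] m(2) v by force
  then show ?thesis using that[OF lin] m by blast
qed

lemma linear_on_set_UNIV: "linear_on_set UNIV g \<longleftrightarrow> linear g"
  by (auto simp: linear_on_set_def linear_iff)

lemma sublinear_onI:
  assumes "\<And>x y. x \<in> S \<Longrightarrow> y \<in> S \<Longrightarrow> q (x + y) \<le> q x + q y"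
    and "\<And>c x. 0 \<le> c \<Longrightarrow> x \<in> S \<Longrightarrow> q (c *\<^sub>R x) = c * q x"
  shows "sublinear_on S q"
  using assms by (auto simp: sublinear_on_def)

lemma linear_below_sublinear_on:
  assumes "subspace S" "sublinear_on S p"
  obtains g where "linear_on_set S g" "\<And>x. x \<in> S \<Longrightarrow> g x \<le> p x"
  using linear_below_sublinear[OF assms subspace_0[OF assms(1)], of "{}"] by auto

lemma linear_below_sublinear_attained:
  fixes p :: "'a::real_vector \<Rightarrow> real"
  assumes "sublinear_on UNIV p"
  obtains g where "linear g" "\<And>x. g x \<le> p x" "g v = p v"
  using linear_below_sublinear[OF subspace_UNIV assms UNIV_I[of v], of "{}"]
  by (auto simp: linear_on_set_UNIV)

text \<open>Any linear functional below the inf-convolution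
  \<open>r z = (INF x\<in>U. f x + p (z - T x))\<close> works: \<open>x = 0\<close> gives the bound
  by \<open>p\<close>, and the points \<open>T x\<close> and \<open>T (- x)\<close> give agreement
  with \<open>f\<close>. The form with \<open>T\<close> avoids transferring \<open>f\<close> to the
  image of \<open>U\<close> first.\<close>

lemma hahn_banach_pullback:
  fixes p :: "'a::real_vector \<Rightarrow> real" and T :: "'b::real_vector \<Rightarrow> 'a"
  assumes p: "sublinear_on UNIV p" and T: "linear T" and U: "subspace U"
    and f: "linear_on_set U f" and fp: "\<And>x. x \<in> U \<Longrightarrow> f x \<le> p (T x)"
  obtains g where "linear g" "\<And>z. g z \<le> p z" "\<And>x. x \<in> U \<Longrightarrow> g (T x) = f x"
proof -
  have p_add: "p (x + y) \<le> p x + p y" and p_scale: "0 \<le> c \<Longrightarrow> p (c *\<^sub>R x) = c * p x" for x y c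
    using p by (auto simp: sublinear_on_def)
  have f_add: "x \<in> U \<Longrightarrow> y \<in> U \<Longrightarrow> f (x + y) = f x + f y"
    and f_scale: "x \<in> U \<Longrightarrow> f (c *\<^sub>R x) = c * f x" for x y c
    using f by (auto simp: linear_on_set_def)
  have U0: "0 \<in> U" using U by (rule subspace_0)
  have f0: "f 0 = 0" using f_scale[OF U0, of 0] by simp
  have p0: "p 0 = 0" using p_scale[of 0 0] by simp
  have fm: "x \<in> U \<Longrightarrow> f (- x) = - f x" for x using f_scale[of x "-1"] by simp
  define r where "r z = (INF x\<in>U. f x + p (z - T x))" for z
  have bdd: "bdd_below ((\<lambda>x. f x + p (z - T x)) ` U)" for z
  proof (rule bdd_belowI2)
    fix x assume x: "x \<in> U"
    have "f (- x) \<le> p (- T x)"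
      using fp[of "- x"] x subspace_neg[OF U] by (simp add: linear_neg[OF T])
    also have "- T x = (z - T x) + (- z)" by simp
    also have "p \<dots> \<le> p (z - T x) + p (- z)" by (rule p_add)
    finally show "- p (- z) \<le> f x + p (z - T x)" using fm[OF x] by simp
  qed
  have Une: "U \<noteq> {}" using U0 by blast
  have r_le: "r z \<le> f x + p (z - T x)" if "x \<in> U" for x z
    unfolding r_def by (rule cINF_lower[OF bdd that])
  have r_less: "\<exists>x\<in>U. f x + p (z - T x) < b" if "r z < b" for z b
    using that unfolding r_def cINF_less_iff[OF Une bdd] .
  have r_scale_le: "r (c *\<^sub>R z) \<le> c * r z" if "c > 0" for c z
  proof -
    have "r (c *\<^sub>R z) / c \<le> r z"
      unfolding r_def[of z]
    proof (rule cINF_greatest[OF Une])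
      fix x assume x: "x \<in> U"
      have "r (c *\<^sub>R z) \<le> f (c *\<^sub>R x) + p (c *\<^sub>R z - T (c *\<^sub>R x))"
        using r_le subspace_scale[OF U x] by blast
      also have "c *\<^sub>R z - T (c *\<^sub>R x) = c *\<^sub>R (z - T x)"
        by (simp add: linear_scale[OF T] scaleR_diff_right)
      also have "f (c *\<^sub>R x) + p \<dots> = c * (f x + p (z - T x))"
        using f_scale[OF x] p_scale that by (simp add: distrib_left)
      finally show "r (c *\<^sub>R z) / c \<le> f x + p (z - T x)" using that by (simp add: field_simps)
    qed
    then show ?thesis using that by (simp add: field_simps)
  qed
  have r0: "r 0 = 0"
  proof (rule antisym)
    show "r 0 \<le> 0" using r_le[OF U0, of 0] f0 p0 linear_0[OF T] by simp
    show "0 \<le> r 0" unfolding r_def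
    proof (rule cINF_greatest[OF Une])
      fix x assume x: "x \<in> U"
      show "0 \<le> f x + p (0 - T x)"
        using fp[OF subspace_neg[OF U x]] fm[OF x] by (simp add: linear_neg[OF T])
    qed
  qed
  have "sublinear_on UNIV r"
  proof (rule sublinear_onI)
    fix y z
    show "r (y + z) \<le> r y + r z"
    proof (rule field_le_epsilon)
      fix e :: real assume "e > 0"
      then obtain a b where ab: "a \<in> U" "b \<in> U" "f a + p (y - T a) < r y + e / 2" "f b + p (z - T b) < r z + e / 2"
        using r_less[of y "r y + e / 2"] r_less[of z "r z + e / 2"] by auto
      have "r (y + z) \<le> f (a + b) + p (y + z - T (a + b))"
        using r_le subspace_add[OF U] ab by blast
      also have "y + z - T (a + b) = (y - T a) + (z - T b)" by (simp add: linear_add[OF T])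
      also have "f (a + b) + p \<dots> \<le> f a + f b + (p (y - T a) + p (z - T b))"
        using f_add ab p_add[of "y - T a" "z - T b"] by simp
      finally show "r (y + z) \<le> r y + r z + e" using ab by simp
    qed
  next
    fix c :: real and z assume c: "0 \<le> c"
    show "r (c *\<^sub>R z) = c * r z"
    proof (cases "c = 0")
      case True then show ?thesis using r0 by simp
    next
      case False
      with c have c: "c > 0" by simp
      have "r z \<le> inverse c * r (c *\<^sub>R z)" using r_scale_le[of "inverse c" "c *\<^sub>R z"] c by simp
      then show ?thesis using r_scale_le[OF c, of z] c by (simp add: field_simps)
    qed
  qed
  then obtain g where g: "linear g" "\<And>z. g z \<le> r z"
    using linear_below_sublinear_attained by metis
  have "g z \<le> p z" for z
    using g(2)[of z] r_le[OF U0, of z] f0 linear_0[OF T] by simp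
  moreover have "g (T x) = f x" if x: "x \<in> U" for x
  proof -
    have le: "g (T y) \<le> f y" if "y \<in> U" for y
      using g(2)[of "T y"] r_le[OF that, of "T y"] p0 by simp
    have "g (T (- x)) \<le> f (- x)" using le subspace_neg[OF U x] by blast
    then show ?thesis using le[OF x] fm[OF x] by (simp add: linear_neg[OF T] linear_neg[OF g(1)])
  qed
  ultimately show ?thesis using that g(1) by blast
qed

section \<open>Norming, positive and dominating functionals\<close>

lemma sublinear_norm:
  fixes K :: real
  assumes "0 \<le> K"
  shows "sublinear_on UNIV (\<lambda>x::'a::real_normed_vector. K * norm x)"
proof (rule sublinear_onI)
  show "K * norm (x + y) \<le> K * norm x + K * norm y" for x y :: 'a
    using mult_left_mono[OF norm_triangle_ineq assms] by (simp add: distrib_left)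
qed simp

lemma bounded_linear_of_le_norm:
  fixes g :: "'a::real_normed_vector \<Rightarrow> real"
  assumes "linear g" "\<And>x. g x \<le> K * norm x"
  shows "bounded_linear g" "\<bar>g x\<bar> \<le> K * norm x"
proof -
  show abs: "\<bar>g x\<bar> \<le> K * norm x" for x
    using assms(2)[of x] assms(2)[of "- x"] by (simp add: linear_neg[OF assms(1)] abs_le_iff)
  show "bounded_linear g"
    by (rule bounded_linear_intro[where K = K])
      (use abs in \<open>auto simp: linear_add[OF assms(1)] linear_scale[OF assms(1)] mult.commute\<close>)
qed

lemma norming_functional:
  fixes v :: "'a::real_normed_vector"
  obtains g :: "'a \<Rightarrow> real" where "bounded_linear g" "\<And>x. \<bar>g x\<bar> \<le> norm x" "g v = norm v"
proof -
  obtain g :: "'a \<Rightarrow> real" where g: "linear g" "\<And>x. g x \<le> 1 * norm x" "g v = 1 * norm v"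
    by (rule linear_below_sublinear_attained[OF sublinear_norm, of 1 v]) auto
  show ?thesis using that bounded_linear_of_le_norm[OF g(1,2)] g(3) by simp
qed

definition positive_functional :: "('a::banach_lattice \<Rightarrow> real) \<Rightarrow> bool" where
  "positive_functional g \<longleftrightarrow> bounded_linear g \<and> (\<forall>x\<ge>0. 0 \<le> g x)"

lemma positive_functional_linear: "positive_functional g \<Longrightarrow> linear g"
  by (simp add: positive_functional_def bounded_linear.linear)

lemma positive_functional_mono:
  assumes "positive_functional g" "x \<le> y"
  shows "g x \<le> g y"
proof -
  have "0 \<le> g (y - x)" using assms by (simp add: positive_functional_def)
  then show ?thesis by (simp add: linear_diff[OF positive_functional_linear[OF assms(1)]])
qed

lemma norm_pprt_le: "norm (pprt x) \<le> norm (x::'a::banach_lattice)"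
proof -
  have "norm (pprt x) \<le> norm \<bar>x\<bar>"
    by (rule norm_mono_nonneg[OF zero_le_pprt pprt_le_abs])
  then show ?thesis by simp
qed

text \<open>Hahn-Banach with \<open>norm (pprt x)\<close> in place of the norm: this sublinear
  functional vanishes on the negative cone, which forces positivity.\<close>

lemma positive_norming_functional:
  fixes v :: "'a::banach_lattice"
  assumes "0 \<le> v"
  obtains g where "positive_functional g" "\<And>x. \<bar>g x\<bar> \<le> norm x" "g v = norm v"
proof -
  have "sublinear_on UNIV (\<lambda>x::'a. norm (pprt x))"
  proof (rule sublinear_onI)
    fix x y :: 'a
    have "norm (pprt (x + y)) \<le> norm (pprt x + pprt y)"
      by (rule norm_mono_nonneg[OF zero_le_pprt pprt_add_le])
    also have "\<dots> \<le> norm (pprt x) + norm (pprt y)" by (rule norm_triangle_ineq)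
    finally show "norm (pprt (x + y)) \<le> norm (pprt x) + norm (pprt y)" .
  next
    fix c :: real and x :: 'a assume "0 \<le> c"
    then show "norm (pprt (c *\<^sub>R x)) = c * norm (pprt x)" by (simp only: scaleR_pprt norm_scaleR abs_of_nonneg)
  qed
  then obtain g :: "'a \<Rightarrow> real" where g: "linear g" "\<And>x. g x \<le> norm (pprt x)" "g v = norm (pprt v)"
    by (rule linear_below_sublinear_attained[where v = v]) blast
  have "g x \<le> 1 * norm x" for x using g(2)[of x] norm_pprt_le[of x] by simp
  note b = bounded_linear_of_le_norm[OF g(1) this]
  have "0 \<le> g x" if "0 \<le> x" for x
    using g(2)[of "- x"] that by (simp add: linear_neg[OF g(1)])
  then have "positive_functional g" using b(1) by (simp add: positive_functional_def)
  then show ?thesis using that b(2) g(3) assms by simp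
qed

text \<open>
  Extending \<open>(x, 0) \<mapsto> g x\<close> below \<open>(x, y) \<mapsto> K * norm (pprt (\<bar>x\<bar> + y))\<close> gives a functional
  \<open>(x, y) \<mapsto> g x + G y\<close>; evaluating it at \<open>(x, - \<bar>x\<bar>)\<close> shows that \<open>G\<close> dominates \<open>g\<close>.
\<close>

lemma positive_functional_dominating:
  fixes g :: "'a::banach_lattice \<Rightarrow> real"
  assumes "bounded_linear g"
  obtains G where "positive_functional G" "\<And>x. \<bar>g x\<bar> \<le> G \<bar>x\<bar>"
proof -
  obtain K where K: "\<And>x. norm (g x) \<le> norm x * K" "K \<ge> 0"
    using bounded_linear.nonneg_bounded[OF assms] by blast
  define p where "p z = K * norm (pprt (\<bar>fst z\<bar> + snd z))" for z :: "'a \<times> 'a"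
  have "sublinear_on UNIV p"
  proof (rule sublinear_onI)
    fix z w :: "'a \<times> 'a"
    have "\<bar>fst z + fst w\<bar> + (snd z + snd w) \<le> (\<bar>fst z\<bar> + \<bar>fst w\<bar>) + (snd z + snd w)"
      by (intro add_right_mono abs_triangle_ineq)
    also have "\<dots> = (\<bar>fst z\<bar> + snd z) + (\<bar>fst w\<bar> + snd w)"
      by (simp only: ac_simps)
    finally have "pprt (\<bar>fst z + fst w\<bar> + (snd z + snd w)) \<le> pprt ((\<bar>fst z\<bar> + snd z) + (\<bar>fst w\<bar> + snd w))"
      by (rule pprt_mono)
    also have "\<dots> \<le> pprt (\<bar>fst z\<bar> + snd z) + pprt (\<bar>fst w\<bar> + snd w)" by (rule pprt_add_le)
    finally have "norm (pprt (\<bar>fst z + fst w\<bar> + (snd z + snd w))) \<le> norm (pprt (\<bar>fst z\<bar> + snd z) + pprt (\<bar>fst w\<bar> + snd w))"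
      by (rule norm_mono_nonneg[OF zero_le_pprt])
    also have "\<dots> \<le> norm (pprt (\<bar>fst z\<bar> + snd z)) + norm (pprt (\<bar>fst w\<bar> + snd w))"
      by (rule norm_triangle_ineq)
    finally have "norm (pprt (\<bar>fst z + fst w\<bar> + (snd z + snd w)))
      \<le> norm (pprt (\<bar>fst z\<bar> + snd z)) + norm (pprt (\<bar>fst w\<bar> + snd w))" .
    from mult_left_mono[OF this K(2)] show "p (z + w) \<le> p z + p w"
      unfolding p_def by (simp only: fst_add snd_add distrib_left)
  next
    fix c :: real and z :: "'a \<times> 'a" assume c: "0 \<le> c"
    have "\<bar>fst (c *\<^sub>R z)\<bar> + snd (c *\<^sub>R z) = c *\<^sub>R (\<bar>fst z\<bar> + snd z)"
      using c by (simp only: fst_scaleR snd_scaleR lattice_abs_scaleR abs_of_nonneg scaleR_add_right)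
    then show "p (c *\<^sub>R z) = c * p z" using c unfolding p_def by (simp only: scaleR_pprt norm_scaleR abs_of_nonneg mult.left_commute)
  qed
  moreover have "linear (\<lambda>x. (x, 0::'a))" by (simp add: linear_iff)
  moreover have "linear_on_set UNIV g" using assms by (simp add: linear_on_set_UNIV bounded_linear.linear)
  moreover have "g x \<le> p (x, 0)" for x
    using K(1)[of x] by (simp add: p_def mult.commute)
  ultimately obtain h where h: "linear h" "\<And>z. h z \<le> p z" "\<And>x. h (x, 0) = g x"
    using hahn_banach_pullback[of p "\<lambda>x. (x, 0)" UNIV g] by (metis UNIV_I subspace_UNIV)
  define G where "G y = h (0, y)" for y
  have linG: "linear G"
    unfolding linear_iff G_def
  proof (intro conjI allI)
    show "h (0, x + y) = h (0, x) + h (0, y)" for x y using linear_add[OF h(1), of "(0, x)" "(0, y)"] by simp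
    show "h (0, c *\<^sub>R x) = c *\<^sub>R h (0, x)" for c x using linear_scale[OF h(1), of c "(0, x)"] by simp
  qed
  have "G y \<le> K * norm y" for y
  proof -
    have "G y \<le> K * norm (pprt y)" using h(2)[of "(0, y)"] by (simp add: G_def p_def)
    also have "\<dots> \<le> K * norm y" by (rule mult_left_mono[OF norm_pprt_le K(2)])
    finally show ?thesis .
  qed
  note b = bounded_linear_of_le_norm[OF linG this]
  \<comment> \<open>\<open>p\<close> vanishes at \<open>(0, - y)\<close>, since \<open>- y\<close>
    has positive part zero; this is the reason for \<open>pprt\<close> in \<open>p\<close>.\<close>
  have "0 \<le> G y" if "0 \<le> y" for y
  proof -
    have "G (- y) \<le> 0" using h(2)[of "(0, - y)"] that by (simp add: G_def p_def)
    then show ?thesis by (simp add: linear_neg[OF linG])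
  qed
  then have G: "positive_functional G" using b(1) by (simp add: positive_functional_def)
  have le: "g x \<le> G \<bar>x\<bar>" for x
  proof -
    have "(x, - \<bar>x\<bar>) = (x, 0) - (0, \<bar>x\<bar>)" by simp
    then have "h (x, - \<bar>x\<bar>) = g x - G \<bar>x\<bar>" by (simp only: linear_diff[OF h(1)] h(3) G_def)
    moreover have "p (x, - \<bar>x\<bar>) = 0" by (simp add: p_def)
    ultimately show ?thesis using h(2)[of "(x, - \<bar>x\<bar>)"] by simp
  qed
  have "\<bar>g x\<bar> \<le> G \<bar>x\<bar>" for x
    using le[of x] le[of "- x"] linear_neg[OF bounded_linear.linear[OF assms]] by (simp add: abs_le_iff)
  then show ?thesis using that G by blast
qed

section \<open>Order continuous norms\<close>

lemma order_continuous_Cauchy: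
  fixes x :: "nat \<Rightarrow> 'a::banach_lattice"
  assumes oc: "order_continuous_norm TYPE('a)" and inc: "incseq x" and bd: "\<And>n. x n \<le> u"
  shows "Cauchy x"
proof -
  define D where "D = {v - x n |v n. \<forall>m. x m \<le> v}"
  have DI: "v - x n \<in> D" if "\<And>m. x m \<le> v" for v n using that by (auto simp: D_def)
  have ne: "D \<noteq> {}" using DI[of u 0] bd by blast
  have dir: "\<exists>c\<in>D. c \<le> a \<and> c \<le> b" if ab: "a \<in> D" "b \<in> D" for a b
  proof -
    obtain v n where v: "a = v - x n" "\<And>m. x m \<le> v" using ab(1) by (auto simp: D_def)
    obtain w k where w: "b = w - x k" "\<And>m. x m \<le> w" using ab(2) by (auto simp: D_def)
    show ?thesis
    proof (intro bexI conjI)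
      show "inf v w - x (max n k) \<le> a" unfolding v(1)
        by (intro diff_mono inf_le1 incseqD[OF inc]) simp
      show "inf v w - x (max n k) \<le> b" unfolding w(1)
        by (intro diff_mono inf_le2 incseqD[OF inc]) simp
      show "inf v w - x (max n k) \<in> D" by (rule DI) (rule inf_greatest[OF v(2) w(2)])
    qed
  qed
  have "y \<le> 0" if lb: "\<And>d. d \<in> D \<Longrightarrow> y \<le> d" for y
  proof -
    have ub: "x m \<le> u - real k *\<^sub>R y" for k m
    proof (induction k arbitrary: m)
      case (Suc k)
      have "y \<le> (u - real k *\<^sub>R y) - x m" by (rule lb[OF DI[OF Suc]])
      then have "x m \<le> (u - real k *\<^sub>R y) - y" by (simp only: le_diff_eq add.commute)
      also have "\<dots> = u - real (Suc k) *\<^sub>R y"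
        by (simp add: scaleR_left_distrib diff_diff_eq add.commute)
      finally show ?case .
    qed (simp add: bd)
    have "real k *\<^sub>R y \<le> u - x 0" for k
      using ub[of 0 k] by (simp only: le_diff_eq add.commute)
    then show ?thesis by (rule archimedean_le_zero)
  qed
  moreover have "0 \<le> d" if "d \<in> D" for d using that by (auto simp: D_def)
  ultimately have "isGlb UNIV D 0"
    by (intro isGlbI2 isLbI setgeI setleI ballI UNIV_I) (auto dest: isLbD)
  with oc ne dir have small: "\<exists>d\<in>D. \<forall>x\<in>D. x \<le> d \<longrightarrow> norm x < e" if "e > 0" for e
    using that unfolding order_continuous_norm_def by blast
  show ?thesis
  proof (rule CauchyI)
    fix e :: real assume "e > 0"
    then obtain d where d: "d \<in> D" "\<And>x. x \<in> D \<Longrightarrow> x \<le> d \<Longrightarrow> norm x < e / 2"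
      using small[of "e / 2"] by auto
    obtain v n where v: "d = v - x n" "\<And>m. x m \<le> v" using d(1) by (auto simp: D_def)
    have "norm (v - x m) < e / 2" if "m \<ge> n" for m
      by (rule d(2)[OF DI[OF v(2)]]) (unfold v(1), intro diff_mono order_refl incseqD[OF inc that])
    then have "norm (x m - x k) < e" if "m \<ge> n" "k \<ge> n" for m k
      using that norm_triangle_ineq4[of "v - x k" "v - x m"] by (smt (verit) diff_diff_eq2 diff_add_cancel add_diff_cancel_left' add_diff_eq field_sum_of_halves)
    then show "\<exists>M. \<forall>m\<ge>M. \<forall>n\<ge>M. norm (x m - x n) < e" by blast
  qed
qed

lemma order_continuous_sup:
  fixes x :: "nat \<Rightarrow> 'a::banach_lattice"
  assumes "order_continuous_norm TYPE('a)" "incseq x" "\<And>n. x n \<le> u"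
  obtains l where "x \<longlonglongrightarrow> l" "\<And>n. x n \<le> l" "\<And>b. (\<And>n. x n \<le> b) \<Longrightarrow> l \<le> b"
proof -
  obtain l where l: "x \<longlonglongrightarrow> l"
    using order_continuous_Cauchy[OF assms] Cauchy_convergent_iff convergent_def by blast
  have "x n \<le> l" for n
    by (rule limit_le[OF tendsto_const l]) (auto simp: eventually_sequentially intro!: incseqD[OF assms(2)])
  moreover have "l \<le> b" if "\<And>n. x n \<le> b" for b
    by (rule limit_le[OF l tendsto_const]) (simp add: that)
  ultimately show ?thesis using that l by blast
qed

lemma order_continuous_inf:
  fixes x :: "nat \<Rightarrow> 'a::banach_lattice"
  assumes oc: "order_continuous_norm TYPE('a)" and dec: "decseq x" and bd: "\<And>n. u \<le> x n"
  obtains l where "x \<longlonglongrightarrow> l" "\<And>n. l \<le> x n" "\<And>b. (\<And>n. b \<le> x n) \<Longrightarrow> b \<le> l"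
proof -
  have "incseq (\<lambda>n. - x n)" using dec by (simp add: decseq_def incseq_def)
  then obtain l where l: "(\<lambda>n. - x n) \<longlonglongrightarrow> l" "\<And>n. - x n \<le> l" "\<And>b. (\<And>n. - x n \<le> b) \<Longrightarrow> l \<le> b"
    using order_continuous_sup[OF oc, of "\<lambda>n. - x n" "- u"] bd by (metis neg_le_iff_le)
  show ?thesis
  proof (rule that[of "- l"])
    show "x \<longlonglongrightarrow> - l" using tendsto_minus[OF l(1)] by simp
    show "- l \<le> x n" for n using l(2)[of n] by (simp only: minus_le_iff)
    show "b \<le> - l" if "\<And>n. b \<le> x n" for b using l(3)[of "- b"] that by (simp add: le_minus_iff)
  qed
qed

text \<open>\<open>Z k\<close> is the supremum of the tail \<open>y k\<close>,
  \<open>y (k + 1)\<close> and so on, obtained as the norm limit of finite suprema. The last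
  property holds because finite suprema of nonnegative elements lie below their sums.\<close>

lemma order_continuous_tail_sup:
  fixes y :: "nat \<Rightarrow> 'a::banach_lattice"
  assumes oc: "order_continuous_norm TYPE('a)" and y: "\<And>n. 0 \<le> y n" "\<And>n. y n \<le> u"
  obtains Z where "decseq Z" "\<And>k. y k \<le> Z k" "\<And>k. Z k \<le> u"
    "\<And>h k b. positive_functional h \<Longrightarrow> (\<And>m. (\<Sum>j<m. h (y (k + j))) \<le> b) \<Longrightarrow> h (Z k) \<le> b"
proof -
  define S where "S k = rec_nat 0 (\<lambda>m s. sup s (y (k + m)))" for k
  have S0: "S k 0 = 0" and SS: "S k (Suc m) = sup (S k m) (y (k + m))" for k m by (simp_all add: S_def)
  have inc: "incseq (S k)" for k by (rule incseq_SucI) (simp only: SS sup_ge1)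
  have u0: "0 \<le> u" using y(1)[of 0] y(2)[of 0] by (rule order_trans)
  have Sub: "S k m \<le> b" if "0 \<le> b" "\<And>m. y (k + m) \<le> b" for k m b
    by (induction m) (simp_all add: S0 SS that)
  have "\<exists>l. S k \<longlonglongrightarrow> l \<and> (\<forall>m. S k m \<le> l) \<and> (\<forall>b. (\<forall>m. S k m \<le> b) \<longrightarrow> l \<le> b)" for k
    by (rule order_continuous_sup[OF oc inc[of k] Sub[OF u0 y(2)]]) blast
  then obtain Z where Z: "\<And>k. S k \<longlonglongrightarrow> Z k" "\<And>k m. S k m \<le> Z k" "\<And>k b. (\<And>m. S k m \<le> b) \<Longrightarrow> Z k \<le> b"
    by metis
  have yZ: "y (k + m) \<le> Z k" for k m
    using Z(2)[of k "Suc m"] by (simp add: SS)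
  show ?thesis
  proof (rule that)
    show "decseq Z"
    proof (rule decseq_SucI, rule Z(3), rule Sub)
      fix k m
      show "0 \<le> Z k" using y(1)[of "k + 0"] yZ[of k 0] by (rule order_trans)
      show "y (Suc k + m) \<le> Z k" using yZ[of k "Suc m"] by simp
    qed
    show "y k \<le> Z k" for k using yZ[of k 0] by simp
    show "Z k \<le> u" for k by (rule Z(3)) (rule Sub[OF u0 y(2)])
    fix h :: "'a \<Rightarrow> real" and k b
    assume h: "positive_functional h" and b: "\<And>m. (\<Sum>j<m. h (y (k + j))) \<le> b"
    have "S k m \<le> (\<Sum>j<m. y (k + j))" for m
    proof (induction m)
      case (Suc m)
      have "0 \<le> (\<Sum>j<m. y (k + j))" by (rule sum_nonneg) (rule y(1))
      then have "y (k + m) \<le> (\<Sum>j<m. y (k + j)) + y (k + m)" by (rule add_increasing) (rule order_refl)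
      moreover have "S k m \<le> (\<Sum>j<m. y (k + j)) + y (k + m)" by (rule add_increasing2[OF y(1) Suc])
      ultimately show ?case by (simp only: SS sum.lessThan_Suc sup_least)
    qed (simp add: S0)
    from positive_functional_mono[OF h this] have "h (S k m) \<le> b" for m
      using b[of m] by (simp add: linear_sum[OF positive_functional_linear[OF h]]) (meson order_trans)
    moreover have "(\<lambda>m. h (S k m)) \<longlonglongrightarrow> h (Z k)"
      by (rule bounded_linear.tendsto[OF conjunct1[OF h[unfolded positive_functional_def]] Z(1)])
    ultimately show "h (Z k) \<le> b" by (intro LIMSEQ_le_const2) auto
  qed
qed

text \<open>
  On an order interval the norm is controlled by a single positive functional. Otherwise one
  finds greedily \<open>y k\<close> of norm at least \<open>e\<close> and norming functionals \<open>g k\<close> with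
  \<open>g i (y k) < 2 ^ - k\<close> for \<open>i < k\<close>. The infimum \<open>z\<close> of the tail suprema of \<open>y\<close> is then
  annihilated by each \<open>g i\<close>, but these tail suprema converge in norm to \<open>z\<close>.
\<close>

lemma order_continuous_control:
  fixes u :: "'a::banach_lattice"
  assumes oc: "order_continuous_norm TYPE('a)" and e: "0 < e"
  obtains f d where "positive_functional f" "0 < d"
    "\<And>y. 0 \<le> y \<Longrightarrow> y \<le> u \<Longrightarrow> e \<le> norm y \<Longrightarrow> d \<le> f y"
proof (rule ccontr)
  note witness = that
  assume no: "\<not> thesis"
  have ex: "\<exists>y. 0 \<le> y \<and> y \<le> u \<and> e \<le> norm y \<and> f y < d" if "positive_functional f" "0 < d" for f d
    using no witness[OF that] by (meson not_le)
  define Y where "Y f k = (SOME y. 0 \<le> y \<and> y \<le> u \<and> e \<le> norm y \<and> f y < (1 / 2) ^ k)" for f :: "'a \<Rightarrow> real" and k :: nat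
  have Y: "0 \<le> Y f k \<and> Y f k \<le> u \<and> e \<le> norm (Y f k) \<and> f (Y f k) < (1 / 2) ^ k"
    if "positive_functional f" for f k
    unfolding Y_def by (rule someI_ex[OF ex[OF that]]) simp
  define G where "G v = (SOME g. positive_functional g \<and> (\<forall>x. \<bar>g x\<bar> \<le> norm x) \<and> g v = norm v)" for v :: 'a
  have G: "positive_functional (G v) \<and> (\<forall>x. \<bar>G v x\<bar> \<le> norm x) \<and> G v v = norm v" if "0 \<le> v" for v
  proof -
    have "\<exists>g. positive_functional g \<and> (\<forall>x. \<bar>g x\<bar> \<le> norm x) \<and> g v = norm v"
      by (rule positive_norming_functional[OF that]) blast
    then show ?thesis unfolding G_def by (rule someI_ex)
  qed
  \<comment> \<open>\<open>F k\<close> is the sum of the norming functionals found before stage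
    \<open>k\<close>. They are positive, so one small value of \<open>F k\<close> at
    \<open>y k\<close> makes all of them small there.\<close>
  define F where "F = rec_nat (\<lambda>_. 0) (\<lambda>k f x. f x + G (Y f k) x)"
  define y where "y k = Y (F k) k" for k
  define g where "g k = G (y k)" for k
  have F0: "F 0 = (\<lambda>_. 0)" and FS: "F (Suc k) = (\<lambda>x. F k x + g k x)" for k
    by (simp_all add: F_def y_def g_def)
  have Fpos: "positive_functional (F k)" for k
  proof (induction k)
    case 0 then show ?case by (simp add: F0 positive_functional_def bounded_linear_zero)
  next
    case (Suc k)
    then have "positive_functional (g k)" using G Y unfolding g_def y_def by blast
    with Suc show ?case by (simp add: FS positive_functional_def bounded_linear_add)
  qed
  have y: "0 \<le> y k" "y k \<le> u" "e \<le> norm (y k)" "F k (y k) < (1 / 2) ^ k" for k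
    using Y[OF Fpos] by (auto simp: y_def)
  have g: "positive_functional (g k)" "\<bar>g k x\<bar> \<le> norm x" "g k (y k) = norm (y k)" for k x
    using G[OF y(1)] by (auto simp: g_def)
  have gF: "g i x \<le> F k x" if "i < k" "0 \<le> x" for i k x
    using that(1)
  proof (induction k)
    case (Suc k)
    have nn: "0 \<le> F k x" "0 \<le> g k x" using Fpos g(1) that(2) by (auto simp: positive_functional_def)
    show ?case
    proof (cases "i = k")
      case True then show ?thesis using nn by (simp add: FS)
    next
      case False then show ?thesis using Suc nn by (simp add: FS)
    qed
  qed simp
  obtain Z where Z: "decseq Z" "\<And>k. y k \<le> Z k" "\<And>k. Z k \<le> u"
    "\<And>h k b. positive_functional h \<Longrightarrow> (\<And>m. (\<Sum>j<m. h (y (k + j))) \<le> b) \<Longrightarrow> h (Z k) \<le> b"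
    by (rule order_continuous_tail_sup[where y = y, OF oc y(1,2)]) blast
  have Z0: "0 \<le> Z k" for k using y(1) Z(2) by (rule order_trans)
  obtain z where z: "Z \<longlonglongrightarrow> z" "\<And>n. z \<le> Z n"
    by (rule order_continuous_inf[OF oc Z(1) Z0]) blast
  have gZ: "g i (Z k) \<le> 2 * (1 / 2) ^ k" if "i < k" for i k
  proof (rule Z(4)[OF g(1)])
    fix m
    have "(\<Sum>j<m. g i (y (k + j))) \<le> (\<Sum>j<m. (1 / 2) ^ k * (1 / 2) ^ j)"
    proof (rule sum_mono)
      fix j assume "j \<in> {..<m}"
      have "g i (y (k + j)) \<le> F (k + j) (y (k + j))" by (rule gF) (use that y(1) in auto)
      also have "\<dots> \<le> (1 / 2) ^ (k + j)" using y(4) by (rule less_imp_le)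
      finally show "g i (y (k + j)) \<le> (1 / 2) ^ k * (1 / 2) ^ j" by (simp only: power_add)
    qed
    also have "\<dots> = (1 / 2) ^ k * (\<Sum>j<m. (1 / 2) ^ j)" by (simp only: sum_distrib_left)
    also have "\<dots> \<le> (1 / 2) ^ k * 2"
      by (rule mult_left_mono) (simp_all add: sum_gp_strict)
    finally show "(\<Sum>j<m. g i (y (k + j))) \<le> 2 * (1 / 2) ^ k" by simp
  qed
  have gz: "g i z \<le> 0" for i
  proof (rule LIMSEQ_le_const)
    show "(\<lambda>k. 2 * (1 / 2) ^ k) \<longlonglongrightarrow> (0::real)"
      using tendsto_mult_right_zero[OF LIMSEQ_power_zero[of "1 / 2 :: real"], of 2] by simp
    show "\<exists>N. \<forall>k\<ge>N. g i z \<le> 2 * (1 / 2) ^ k"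
    proof (intro exI allI impI)
      fix k assume "Suc i \<le> k"
      then have "g i (Z k) \<le> 2 * (1 / 2) ^ k" by (intro gZ) simp
      then show "g i z \<le> 2 * (1 / 2) ^ k" using positive_functional_mono[OF g(1)[of i] z(2)[of k]] by linarith
    qed
  qed
  have "e \<le> norm (Z i - z)" for i
  proof -
    have "e \<le> g i (y i)" using y(3) g(3) by simp
    also have "\<dots> \<le> g i (Z i)" by (rule positive_functional_mono[OF g(1) Z(2)])
    also have "\<dots> = g i (Z i - z) + g i z" by (simp add: linear_diff[OF positive_functional_linear[OF g(1)]])
    also have "\<dots> \<le> norm (Z i - z)" using g(2)[of i "Z i - z"] gz[of i] by linarith
    finally show ?thesis .
  qed
  moreover have "(\<lambda>i. norm (Z i - z)) \<longlonglongrightarrow> 0"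
    using z(1) by (intro tendsto_norm_zero) (rule LIM_zero)
  ultimately have "e \<le> 0" by (intro LIMSEQ_le_const) auto
  with e show False by simp
qed

section \<open>Hilbertian seminorms on order ideals\<close>

text \<open>With this instance \<open>subspace\<close> and \<open>linear_on_set\<close> apply to
  spaces of functions on lattice homomorphisms.\<close>

instantiation "fun" :: (type, real_vector) real_vector
begin

definition "scaleR c f = (\<lambda>x. c *\<^sub>R f x)"

instance
  by standard (simp_all add: scaleR_fun_def fun_eq_iff scaleR_add_right scaleR_add_left)

end

lemma scaleR_fun_apply [simp]: "(c *\<^sub>R f) x = c *\<^sub>R f x"
  by (simp add: scaleR_fun_def)

section \<open>Principal order ideals and their lattice homomorphisms\<close>

definition order_ideal :: "'a::banach_lattice \<Rightarrow> 'a set" where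
  "order_ideal u = {x. \<exists>c. \<bar>x\<bar> \<le> c *\<^sub>R u}"

context
  fixes u :: "'a::banach_lattice"
  assumes u: "0 \<le> u"
begin

lemma order_ideal_obtain:
  assumes "x \<in> order_ideal u"
  obtains c where "0 \<le> c" "\<bar>x\<bar> \<le> c *\<^sub>R u"
proof -
  obtain c where c: "\<bar>x\<bar> \<le> c *\<^sub>R u" using assms by (auto simp: order_ideal_def)
  have "c *\<^sub>R u \<le> max c 0 *\<^sub>R u" using u by (intro scaleR_right_mono) auto
  with c have "\<bar>x\<bar> \<le> max c 0 *\<^sub>R u" by (rule order_trans)
  then show ?thesis by (intro that[of "max c 0"]) auto
qed

lemma order_idealI: "\<bar>x\<bar> \<le> c *\<^sub>R u \<Longrightarrow> x \<in> order_ideal u"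
  by (auto simp: order_ideal_def)

lemma unit_in_order_ideal: "u \<in> order_ideal u"
  by (rule order_idealI[of _ 1]) (simp add: u abs_of_nonneg)

lemma subspace_order_ideal: "subspace (order_ideal u)"
  unfolding subspace_def
proof (intro conjI ballI allI)
  show "0 \<in> order_ideal u" by (rule order_idealI[of _ 0]) simp
next
  fix x y assume "x \<in> order_ideal u" "y \<in> order_ideal u"
  then obtain c d where c: "\<bar>x\<bar> \<le> c *\<^sub>R u" and d: "\<bar>y\<bar> \<le> d *\<^sub>R u" by (auto simp: order_ideal_def)
  have "\<bar>x + y\<bar> \<le> (c + d) *\<^sub>R u"
    unfolding scaleR_left_distrib by (rule order_trans[OF abs_triangle_ineq add_mono[OF c d]])
  then show "x + y \<in> order_ideal u" by (rule order_idealI)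
next
  fix k :: real and x assume "x \<in> order_ideal u"
  then obtain c where c: "\<bar>x\<bar> \<le> c *\<^sub>R u" by (auto simp: order_ideal_def)
  have "\<bar>k *\<^sub>R x\<bar> \<le> (\<bar>k\<bar> * c) *\<^sub>R u"
    unfolding lattice_abs_scaleR scaleR_scaleR[symmetric] by (rule scaleR_left_mono[OF c]) simp
  then show "k *\<^sub>R x \<in> order_ideal u" by (rule order_idealI)
qed

lemma abs_in_order_ideal: "x \<in> order_ideal u \<Longrightarrow> \<bar>x\<bar> \<in> order_ideal u"
  by (simp add: order_ideal_def)

lemma sup_in_order_ideal:
  assumes "x \<in> order_ideal u" "y \<in> order_ideal u"
  shows "sup x y \<in> order_ideal u"
proof -
  obtain c d where c: "\<bar>x\<bar> \<le> c *\<^sub>R u" and d: "\<bar>y\<bar> \<le> d *\<^sub>R u"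
    using assms by (auto simp: order_ideal_def)
  have "x \<le> \<bar>x\<bar> + \<bar>y\<bar>" "y \<le> \<bar>x\<bar> + \<bar>y\<bar>" "- x \<le> \<bar>x\<bar> + \<bar>y\<bar>"
    by (rule add_increasing2 add_increasing, rule abs_ge_zero, simp add: abs_ge_self abs_ge_minus_self)+
  moreover have "- sup x y \<le> - x" by simp
  ultimately have "\<bar>sup x y\<bar> \<le> \<bar>x\<bar> + \<bar>y\<bar>" by (simp add: lattice_abs_le_iff le_infI1)
  also have "\<dots> \<le> (c + d) *\<^sub>R u" unfolding scaleR_left_distrib by (rule add_mono[OF c d])
  finally show ?thesis by (rule order_idealI)
qed

text \<open>On the ideal this is the order unit norm of the positive part of \<open>x\<close>. The
  one-sided form is monotone and turns suprema into maxima.\<close>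

definition gauge_unit :: "'a \<Rightarrow> real" where
  "gauge_unit x = Inf {c. 0 \<le> c \<and> x \<le> c *\<^sub>R u}"

lemma gauge_unit_set:
  assumes "x \<in> order_ideal u"
  shows "{c. 0 \<le> c \<and> x \<le> c *\<^sub>R u} \<noteq> {}"
proof -
  obtain c where "0 \<le> c" "\<bar>x\<bar> \<le> c *\<^sub>R u" by (rule order_ideal_obtain[OF assms])
  then show ?thesis using order_trans[OF abs_ge_self, of x] by blast
qed

lemma gauge_unit_bdd: "bdd_below {c. 0 \<le> c \<and> x \<le> c *\<^sub>R u}"
  by (rule bdd_belowI[of _ 0]) simp

lemma gauge_unit_le: "0 \<le> c \<Longrightarrow> x \<le> c *\<^sub>R u \<Longrightarrow> gauge_unit x \<le> c"
  unfolding gauge_unit_def by (rule cInf_lower[OF _ gauge_unit_bdd]) simp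

lemma gauge_unit_nonneg: "x \<in> order_ideal u \<Longrightarrow> 0 \<le> gauge_unit x"
  unfolding gauge_unit_def by (rule cInf_greatest[OF gauge_unit_set]) auto

lemma le_gauge_unit:
  assumes "x \<in> order_ideal u"
  shows "x \<le> gauge_unit x *\<^sub>R u"
proof (rule le_of_le_add_scaleR)
  fix e :: real assume "e > 0"
  then have "Inf {c. 0 \<le> c \<and> x \<le> c *\<^sub>R u} < gauge_unit x + e" by (simp add: gauge_unit_def)
  then obtain c where c: "x \<le> c *\<^sub>R u" "c < gauge_unit x + e"
    unfolding cInf_less_iff[OF gauge_unit_set[OF assms] gauge_unit_bdd] by blast
  have "c *\<^sub>R u \<le> (gauge_unit x + e) *\<^sub>R u" using c(2) u by (intro scaleR_right_mono) auto
  with c(1) show "x \<le> gauge_unit x *\<^sub>R u + e *\<^sub>R u" unfolding scaleR_left_distrib by (rule order_trans)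
qed

lemma gauge_unit_sublinear: "sublinear_on (order_ideal u) gauge_unit"
proof (rule sublinear_onI)
  fix x y assume x: "x \<in> order_ideal u" and y: "y \<in> order_ideal u"
  show "gauge_unit (x + y) \<le> gauge_unit x + gauge_unit y"
  proof (rule gauge_unit_le)
    show "0 \<le> gauge_unit x + gauge_unit y" using gauge_unit_nonneg x y by simp
    show "x + y \<le> (gauge_unit x + gauge_unit y) *\<^sub>R u"
      unfolding scaleR_left_distrib by (intro add_mono le_gauge_unit x y)
  qed
next
  have le: "gauge_unit (c *\<^sub>R x) \<le> c * gauge_unit x" if "0 \<le> c" "x \<in> order_ideal u" for c x
  proof (rule gauge_unit_le)
    show "0 \<le> c * gauge_unit x" using gauge_unit_nonneg that by simp
    show "c *\<^sub>R x \<le> (c * gauge_unit x) *\<^sub>R u"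
      unfolding scaleR_scaleR[symmetric] by (rule scaleR_left_mono[OF le_gauge_unit[OF that(2)] that(1)])
  qed
  fix c :: real and x assume c: "0 \<le> c" and x: "x \<in> order_ideal u"
  show "gauge_unit (c *\<^sub>R x) = c * gauge_unit x"
  proof (cases "c = 0")
    case True
    have "gauge_unit (c *\<^sub>R x) \<le> 0" using le[OF c x] True by simp
    moreover have "0 \<le> gauge_unit (c *\<^sub>R x)"
      by (rule gauge_unit_nonneg[OF subspace_scale[OF subspace_order_ideal x]])
    ultimately show ?thesis using True by simp
  next
    case False
    with c have c: "c > 0" by simp
    have "gauge_unit x \<le> inverse c * gauge_unit (c *\<^sub>R x)"
      using le[of "inverse c" "c *\<^sub>R x"] c subspace_scale[OF subspace_order_ideal x] by simp
    then show ?thesis using le[of c x] c x by (simp add: field_simps)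
  qed
qed

lemma gauge_unit_sup:
  assumes x: "x \<in> order_ideal u" and y: "y \<in> order_ideal u"
  shows "gauge_unit (sup x y) = max (gauge_unit x) (gauge_unit y)"
proof (rule antisym)
  have "x \<le> max (gauge_unit x) (gauge_unit y) *\<^sub>R u" "y \<le> max (gauge_unit x) (gauge_unit y) *\<^sub>R u"
    by (rule order_trans[OF le_gauge_unit], fact, rule scaleR_right_mono[OF _ u], simp)+
  then show "gauge_unit (sup x y) \<le> max (gauge_unit x) (gauge_unit y)"
    using gauge_unit_nonneg x by (intro gauge_unit_le sup_least) (auto simp: le_max_iff_disj)
  note s = sup_in_order_ideal[OF x y]
  have "gauge_unit x \<le> gauge_unit (sup x y)"
    by (rule gauge_unit_le[OF gauge_unit_nonneg[OF s] order_trans[OF sup_ge1 le_gauge_unit[OF s]]])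
  moreover have "gauge_unit y \<le> gauge_unit (sup x y)"
    by (rule gauge_unit_le[OF gauge_unit_nonneg[OF s] order_trans[OF sup_ge2 le_gauge_unit[OF s]]])
  ultimately show "max (gauge_unit x) (gauge_unit y) \<le> gauge_unit (sup x y)" by simp
qed

text \<open>On the ideal these are the points of the compact space in Kakutani's representation,
  here taken as a bare set. Values outside the ideal are unconstrained.\<close>

definition unital_homs :: "('a \<Rightarrow> real) set" where
  "unital_homs = {h. linear_on_set (order_ideal u) h \<and> h u = 1 \<and>
     (\<forall>x\<in>order_ideal u. \<forall>y\<in>order_ideal u. h (sup x y) = max (h x) (h y))}"

text \<open>Unless \<open>x \<le> 0\<close>, the gauge of \<open>x\<close> is positive. A linear
  functional below the gauge that attains it at \<open>x\<close> and preserves all suprema becomes,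
  after division by its value at \<open>u\<close>, a homomorphism that is positive at
  \<open>x\<close>.\<close>

lemma unital_homs_separate:
  assumes x: "x \<in> order_ideal u" and le: "\<And>h. h \<in> unital_homs \<Longrightarrow> h x \<le> 0"
  shows "x \<le> 0"
proof (rule ccontr)
  assume "\<not> x \<le> 0"
  then have "gauge_unit x \<noteq> 0" using le_gauge_unit[OF x] by auto
  with gauge_unit_nonneg[OF x] have pos: "0 < gauge_unit x" by simp
  define R where "R = {(y, z, sup y z) |y z. y \<in> order_ideal u \<and> z \<in> order_ideal u}"
  obtain g where lin: "linear_on_set (order_ideal u) g"
    and g: "\<And>y. y \<in> order_ideal u \<Longrightarrow> g y \<le> gauge_unit y" "g x = gauge_unit x"
      "\<And>y z w. (y, z, w) \<in> R \<Longrightarrow> g w = max (g y) (g z)"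
  proof (rule linear_below_sublinear[OF subspace_order_ideal gauge_unit_sublinear x, of R])
    show "y \<in> order_ideal u \<and> z \<in> order_ideal u \<and> w \<in> order_ideal u" if "(y, z, w) \<in> R" for y z w
      using that sup_in_order_ideal by (auto simp: R_def)
    show "gauge_unit w = max (gauge_unit y) (gauge_unit z)" if "(y, z, w) \<in> R" for y z w
      using that gauge_unit_sup by (auto simp: R_def)
    show "(y + s, z + s, w + s) \<in> R" if "(y, z, w) \<in> R" "s \<in> order_ideal u" for y z w s
      using that subspace_add[OF subspace_order_ideal] unfolding R_def by (auto simp: add_sup_distrib_right)
  qed blast
  have g_scale: "g (c *\<^sub>R y) = c * g y" and g_add: "z \<in> order_ideal u \<Longrightarrow> g (y + z) = g y + g z"
    if "y \<in> order_ideal u" for c y z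
    using lin that by (auto simp: linear_on_set_def)
  define c where "c = gauge_unit x"
  have cu: "(- c) *\<^sub>R u \<in> order_ideal u" by (rule subspace_scale[OF subspace_order_ideal unit_in_order_ideal])
  \<comment> \<open>Subtracting \<open>c *\<^sub>R u\<close> makes \<open>x\<close> negative. This
    yields \<open>c \<le> c * g u\<close>, so \<open>g u\<close> is positive and may be divided
    by.\<close>
  have "gauge_unit (x + (- c) *\<^sub>R u) \<le> 0"
    using le_gauge_unit[OF x] by (intro gauge_unit_le) (simp_all add: c_def)
  then have "g (x + (- c) *\<^sub>R u) \<le> 0" using g(1) subspace_add[OF subspace_order_ideal x cu] by fastforce
  then have "c \<le> c * g u" using g_add[OF x cu] g_scale[OF unit_in_order_ideal, of "- c"] g(2) by (simp add: c_def)
  then have gu: "0 < g u" using pos by (simp add: c_def)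
  define h where "h y = g y / g u" for y
  have "h \<in> unital_homs"
    unfolding unital_homs_def mem_Collect_eq
  proof (intro conjI ballI)
    show "linear_on_set (order_ideal u) h"
      using lin by (simp add: linear_on_set_def h_def add_divide_distrib)
    show "h u = 1" using gu by (simp add: h_def)
    fix y z assume "y \<in> order_ideal u" "z \<in> order_ideal u"
    then have "g (sup y z) = max (g y) (g z)" by (intro g(3)) (auto simp: R_def)
    then show "h (sup y z) = max (h y) (h z)" using gu by (simp add: h_def max_def divide_le_cancel)
  qed
  from le[OF this] show False using gu pos g(2) by (simp add: h_def divide_le_0_iff)
qed

context
  fixes h assumes h: "h \<in> unital_homs"
begin

lemma unital_hom_add: "x \<in> order_ideal u \<Longrightarrow> y \<in> order_ideal u \<Longrightarrow> h (x + y) = h x + h y"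
  and unital_hom_scale: "x \<in> order_ideal u \<Longrightarrow> h (c *\<^sub>R x) = c * h x"
  and unital_hom_unit: "h u = 1"
  and unital_hom_sup: "x \<in> order_ideal u \<Longrightarrow> y \<in> order_ideal u \<Longrightarrow> h (sup x y) = max (h x) (h y)"
  using h by (simp_all add: unital_homs_def linear_on_set_def)

lemma unital_hom_mono:
  assumes "x \<in> order_ideal u" "y \<in> order_ideal u" "x \<le> y"
  shows "h x \<le> h y"
proof -
  have "sup x y = y" using assms(3) by (rule sup_absorb2)
  then show ?thesis using unital_hom_sup[OF assms(1,2)] by simp
qed

lemma unital_hom_abs:
  assumes "x \<in> order_ideal u"
  shows "h \<bar>x\<bar> = \<bar>h x\<bar>"
proof -
  have "h (- x) = - h x" using unital_hom_scale[OF assms, of "- 1"] by simp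
  moreover have "h \<bar>x\<bar> = max (h x) (h (- x))"
    unfolding abs_lattice by (rule unital_hom_sup[OF assms subspace_neg[OF subspace_order_ideal assms]])
  ultimately show ?thesis by (simp add: abs_real_def max_def)
qed

lemma unital_hom_bound:
  assumes "\<bar>x\<bar> \<le> c *\<^sub>R u"
  shows "\<bar>h x\<bar> \<le> c"
proof -
  have x: "x \<in> order_ideal u" using assms by (rule order_idealI)
  have "h \<bar>x\<bar> \<le> h (c *\<^sub>R u)"
    by (rule unital_hom_mono[OF abs_in_order_ideal[OF x] subspace_scale[OF subspace_order_ideal unit_in_order_ideal] assms])
  then show ?thesis by (simp add: unital_hom_abs[OF x] unital_hom_scale[OF unit_in_order_ideal] unital_hom_unit)
qed

end

text \<open>Bounded rather than continuous functions: closure under products is then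
  immediate.\<close>

definition bounded_on_homs :: "(('a \<Rightarrow> real) \<Rightarrow> real) set" where
  "bounded_on_homs = {\<phi>. \<exists>c. \<forall>h\<in>unital_homs. \<bar>\<phi> h\<bar> \<le> c}"

lemma bounded_on_homsI: "(\<And>h. h \<in> unital_homs \<Longrightarrow> \<bar>\<phi> h\<bar> \<le> c) \<Longrightarrow> \<phi> \<in> bounded_on_homs"
  by (auto simp: bounded_on_homs_def)

lemma subspace_bounded_on_homs: "subspace bounded_on_homs"
  unfolding subspace_def
proof (intro conjI ballI allI)
  show "0 \<in> bounded_on_homs" by (rule bounded_on_homsI[of _ 0]) simp
next
  fix \<phi> \<psi> assume "\<phi> \<in> bounded_on_homs" "\<psi> \<in> bounded_on_homs"
  then obtain c d where c: "\<And>h. h \<in> unital_homs \<Longrightarrow> \<bar>\<phi> h\<bar> \<le> c" and d: "\<And>h. h \<in> unital_homs \<Longrightarrow> \<bar>\<psi> h\<bar> \<le> d"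
    by (auto simp: bounded_on_homs_def)
  show "\<phi> + \<psi> \<in> bounded_on_homs"
  proof (rule bounded_on_homsI[of _ "c + d"])
    show "\<bar>(\<phi> + \<psi>) h\<bar> \<le> c + d" if "h \<in> unital_homs" for h
      using c[OF that] d[OF that] by simp
  qed
next
  fix k :: real and \<phi> assume "\<phi> \<in> bounded_on_homs"
  then obtain c where c: "\<And>h. h \<in> unital_homs \<Longrightarrow> \<bar>\<phi> h\<bar> \<le> c" by (auto simp: bounded_on_homs_def)
  show "k *\<^sub>R \<phi> \<in> bounded_on_homs"
  proof (rule bounded_on_homsI[of _ "\<bar>k\<bar> * c"])
    show "\<bar>(k *\<^sub>R \<phi>) h\<bar> \<le> \<bar>k\<bar> * c" if "h \<in> unital_homs" for h
      using c[OF that] by (simp add: abs_mult mult_left_mono)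
  qed
qed

lemma eval_bounded_on_homs:
  assumes "x \<in> order_ideal u"
  shows "(\<lambda>h. h x) \<in> bounded_on_homs"
proof -
  obtain c where "\<bar>x\<bar> \<le> c *\<^sub>R u" using assms by (auto simp: order_ideal_def)
  then show ?thesis using unital_hom_bound by (intro bounded_on_homsI[of _ c])
qed

lemma mult_bounded_on_homs:
  assumes "\<phi> \<in> bounded_on_homs" "\<psi> \<in> bounded_on_homs"
  shows "(\<lambda>h. \<phi> h * \<psi> h) \<in> bounded_on_homs"
proof -
  obtain c d where c: "\<And>h. h \<in> unital_homs \<Longrightarrow> \<bar>\<phi> h\<bar> \<le> c" and d: "\<And>h. h \<in> unital_homs \<Longrightarrow> \<bar>\<psi> h\<bar> \<le> d"
    using assms by (auto simp: bounded_on_homs_def)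
  show ?thesis
  proof (rule bounded_on_homsI[of _ "c * d"])
    fix h assume hh: "h \<in> unital_homs"
    have "0 \<le> c" using c[OF hh] by linarith
    then show "\<bar>\<phi> h * \<psi> h\<bar> \<le> c * d" unfolding abs_mult using c[OF hh] d[OF hh] by (intro mult_mono) auto
  qed
qed

text \<open>\<open>P\<close> is an upper integral: the infimum of \<open>f\<close> over the elements
  of the ideal that majorize \<open>\<phi>\<close> on all homomorphisms. It is finite because the
  homomorphisms determine the order of the ideal, and a linear functional below it is positive and
  extends \<open>f\<close>.\<close>

lemma extend_to_bounded_on_homs:
  assumes f: "positive_functional f"
  obtains L where "linear_on_set bounded_on_homs L"
    "\<And>\<phi>. \<phi> \<in> bounded_on_homs \<Longrightarrow> (\<And>h. h \<in> unital_homs \<Longrightarrow> \<phi> h \<le> 0) \<Longrightarrow> L \<phi> \<le> 0"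
    "\<And>x. x \<in> order_ideal u \<Longrightarrow> L (\<lambda>h. h x) = f x"
proof -
  have lf: "linear f" using f by (rule positive_functional_linear)
  define maj where "maj \<phi> = {y \<in> order_ideal u. \<forall>h\<in>unital_homs. \<phi> h \<le> h y}" for \<phi> :: "('a \<Rightarrow> real) \<Rightarrow> real"
  define P where "P \<phi> = (INF y\<in>maj \<phi>. f y)" for \<phi>
  have majne: "maj \<phi> \<noteq> {}" if mem: "\<phi> \<in> bounded_on_homs" for \<phi>
  proof -
    obtain c where c: "\<And>h. h \<in> unital_homs \<Longrightarrow> \<bar>\<phi> h\<bar> \<le> c" using mem by (auto simp: bounded_on_homs_def)
    have "\<phi> h \<le> h (c *\<^sub>R u)" if "h \<in> unital_homs" for h
      using c[OF that] by (simp add: unital_hom_scale[OF that unit_in_order_ideal] unital_hom_unit[OF that])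
    then have "c *\<^sub>R u \<in> maj \<phi>"
      by (simp add: maj_def subspace_scale[OF subspace_order_ideal unit_in_order_ideal])
    then show ?thesis by blast
  qed
  have maj_le: "x \<le> y" if "x \<in> order_ideal u" "y \<in> order_ideal u" "\<And>h. h \<in> unital_homs \<Longrightarrow> h x \<le> h y" for x y
  proof -
    have mem: "x + (- 1) *\<^sub>R y \<in> order_ideal u" "(- 1) *\<^sub>R y \<in> order_ideal u"
      by (intro subspace_add[OF subspace_order_ideal] subspace_scale[OF subspace_order_ideal] that)+
    have "x + (- 1) *\<^sub>R y \<le> 0"
    proof (rule unital_homs_separate[OF mem(1)])
      fix h assume hh: "h \<in> unital_homs"
      show "h (x + (- 1) *\<^sub>R y) \<le> 0"
        unfolding unital_hom_add[OF hh that(1) mem(2)] unital_hom_scale[OF hh that(2)]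
        using that(3)[OF hh] by simp
    qed
    then show ?thesis by simp
  qed
  have bdd: "bdd_below (f ` maj \<phi>)" if mem: "\<phi> \<in> bounded_on_homs" for \<phi>
  proof -
    obtain c where c: "\<And>h. h \<in> unital_homs \<Longrightarrow> \<bar>\<phi> h\<bar> \<le> c" using mem by (auto simp: bounded_on_homs_def)
    show ?thesis
    proof (rule bdd_belowI2)
      fix y assume "y \<in> maj \<phi>"
      then have y: "y \<in> order_ideal u" "\<And>h. h \<in> unital_homs \<Longrightarrow> \<phi> h \<le> h y" by (auto simp: maj_def)
      have "(- c) *\<^sub>R u \<le> y"
      proof (rule maj_le[OF subspace_scale[OF subspace_order_ideal unit_in_order_ideal] y(1)])
        fix h assume hh: "h \<in> unital_homs"
        show "h ((- c) *\<^sub>R u) \<le> h y"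
          unfolding unital_hom_scale[OF hh unit_in_order_ideal] unital_hom_unit[OF hh]
          using c[OF hh] y(2)[OF hh] by linarith
      qed
      then show "f ((- c) *\<^sub>R u) \<le> f y" by (rule positive_functional_mono[OF f])
    qed
  qed
  have P_le: "P \<phi> \<le> f y" if "\<phi> \<in> bounded_on_homs" "y \<in> maj \<phi>" for \<phi> y
    unfolding P_def by (rule cINF_lower[OF bdd[OF that(1)] that(2)])
  have P_less: "\<exists>y\<in>maj \<phi>. f y < b" if "\<phi> \<in> bounded_on_homs" "P \<phi> < b" for \<phi> b
    using that(2) unfolding P_def cINF_less_iff[OF majne[OF that(1)] bdd[OF that(1)]] .
  have P_scale_le: "P (c *\<^sub>R \<phi>) \<le> c * P \<phi>" if "0 < c" "\<phi> \<in> bounded_on_homs" for c \<phi>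
  proof -
    have "P (c *\<^sub>R \<phi>) / c \<le> P \<phi>"
      unfolding P_def[of \<phi>]
    proof (rule cINF_greatest[OF majne[OF that(2)]])
      fix y assume "y \<in> maj \<phi>"
      then have y: "y \<in> order_ideal u" "\<And>h. h \<in> unital_homs \<Longrightarrow> \<phi> h \<le> h y" by (auto simp: maj_def)
      have "c *\<^sub>R y \<in> maj (c *\<^sub>R \<phi>)"
        using y that(1) subspace_scale[OF subspace_order_ideal y(1)]
        by (simp add: maj_def unital_hom_scale mult_left_mono)
      from P_le[OF subspace_scale[OF subspace_bounded_on_homs that(2)] this]
      show "P (c *\<^sub>R \<phi>) / c \<le> f y"
        using that(1) by (simp add: linear_scale[OF lf] field_simps)
    qed
    then show ?thesis using that(1) by (simp add: field_simps)
  qed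
  have zero: "0 \<in> bounded_on_homs" by (rule subspace_0[OF subspace_bounded_on_homs])
  have P_eval: "P (\<lambda>h. h x) \<le> f x" if "x \<in> order_ideal u" for x
    by (rule P_le[OF eval_bounded_on_homs[OF that]]) (simp add: maj_def that)
  have hom0: "h 0 = 0" if "h \<in> unital_homs" for h
    using unital_hom_scale[OF that unit_in_order_ideal, of 0] by simp
  have maj0: "0 \<in> maj \<phi>" if "\<And>h. h \<in> unital_homs \<Longrightarrow> \<phi> h \<le> 0" for \<phi>
    unfolding maj_def using that hom0 subspace_0[OF subspace_order_ideal] by fastforce
  have P0: "P 0 = 0"
  proof (rule antisym)
    have "0 \<in> maj 0" by (rule maj0) simp
    from P_le[OF zero this] show "P 0 \<le> 0" by (simp add: linear_0[OF lf])
    show "0 \<le> P 0"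
      unfolding P_def
    proof (rule cINF_greatest[OF majne[OF zero]])
      fix y assume "y \<in> maj 0"
      then have y: "y \<in> order_ideal u" "\<And>h. h \<in> unital_homs \<Longrightarrow> 0 \<le> h y" by (auto simp: maj_def)
      have "0 \<le> y"
        by (rule maj_le[OF subspace_0[OF subspace_order_ideal] y(1)])
          (simp only: hom0 y(2))
      from positive_functional_mono[OF f this] show "0 \<le> f y" by (simp add: linear_0[OF lf])
    qed
  qed
  have "sublinear_on bounded_on_homs P"
  proof (rule sublinear_onI)
    fix \<phi> \<psi> assume mem: "\<phi> \<in> bounded_on_homs" "\<psi> \<in> bounded_on_homs"
    show "P (\<phi> + \<psi>) \<le> P \<phi> + P \<psi>"
    proof (rule field_le_epsilon)
      fix e :: real assume "e > 0"
      then obtain y z where y: "y \<in> maj \<phi>" "f y < P \<phi> + e / 2" and z: "z \<in> maj \<psi>" "f z < P \<psi> + e / 2"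
        using P_less[OF mem(1), of "P \<phi> + e / 2"] P_less[OF mem(2), of "P \<psi> + e / 2"] by auto
      have "y + z \<in> maj (\<phi> + \<psi>)"
        using y(1) z(1) by (auto simp: maj_def unital_hom_add subspace_add[OF subspace_order_ideal] intro: add_mono)
      from P_le[OF subspace_add[OF subspace_bounded_on_homs mem] this]
      show "P (\<phi> + \<psi>) \<le> P \<phi> + P \<psi> + e" using y(2) z(2) by (simp add: linear_add[OF lf])
    qed
  next
    fix c :: real and \<phi> assume c: "0 \<le> c" and mem: "\<phi> \<in> bounded_on_homs"
    show "P (c *\<^sub>R \<phi>) = c * P \<phi>"
    proof (cases "c = 0")
      case True then show ?thesis using P0 by simp
    next
      case False
      with c have c: "c > 0" by simp
      have "P \<phi> \<le> inverse c * P (c *\<^sub>R \<phi>)"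
        using P_scale_le[of "inverse c" "c *\<^sub>R \<phi>"] c subspace_scale[OF subspace_bounded_on_homs mem] by simp
      then show ?thesis using P_scale_le[OF c mem] c by (simp add: field_simps)
    qed
  qed
  then obtain L where lin: "linear_on_set bounded_on_homs L"
    and L: "\<And>\<phi>. \<phi> \<in> bounded_on_homs \<Longrightarrow> L \<phi> \<le> P \<phi>"
    using linear_below_sublinear_on[OF subspace_bounded_on_homs] by blast
  have neg: "L \<phi> \<le> 0" if "\<phi> \<in> bounded_on_homs" "\<And>h. h \<in> unital_homs \<Longrightarrow> \<phi> h \<le> 0" for \<phi>
  proof -
    have "0 \<in> maj \<phi>" by (rule maj0[OF that(2)])
    from P_le[OF that(1) this] L[OF that(1)] show ?thesis by (simp add: linear_0[OF lf])
  qed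
  have eval: "L (\<lambda>h. h x) = f x" if x: "x \<in> order_ideal u" for x
  proof -
    note xe = eval_bounded_on_homs[OF x]
    have m: "(- 1) *\<^sub>R x \<in> order_ideal u" by (rule subspace_scale[OF subspace_order_ideal x])
    \<comment> \<open>The functions induced by \<open>x\<close> and \<open>- x\<close> cancel on
      \<open>unital_homs\<close> but not at arbitrary \<open>h\<close>, so their sum is not the zero
      function; \<open>neg\<close> shows that \<open>L\<close> is nonnegative on it all the
      same.\<close>
    have sum0: "(\<lambda>h. h ((- 1) *\<^sub>R x)) + (\<lambda>h. h x) \<in> bounded_on_homs"
      by (rule subspace_add[OF subspace_bounded_on_homs eval_bounded_on_homs[OF m] xe])
    have "L ((- 1) *\<^sub>R ((\<lambda>h. h ((- 1) *\<^sub>R x)) + (\<lambda>h. h x))) \<le> 0"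
      by (rule neg[OF subspace_scale[OF subspace_bounded_on_homs sum0]]) (simp add: unital_hom_scale[OF _ x, of _ "- 1", simplified])
    then have "0 \<le> L (\<lambda>h. h ((- 1) *\<^sub>R x)) + L (\<lambda>h. h x)"
      using lin[unfolded linear_on_set_def, THEN conjunct2, rule_format, OF sum0, of "- 1"]
        lin[unfolded linear_on_set_def, THEN conjunct1, rule_format, OF eval_bounded_on_homs[OF m] xe]
      by linarith
    moreover have "L (\<lambda>h. h ((- 1) *\<^sub>R x)) \<le> f ((- 1) *\<^sub>R x)"
      by (rule order_trans[OF L[OF eval_bounded_on_homs[OF m]] P_eval[OF m]])
    moreover have "L (\<lambda>h. h x) \<le> f x" by (rule order_trans[OF L[OF xe] P_eval[OF x]])
    moreover have "f ((- 1) *\<^sub>R x) = - f x" by (simp add: linear_neg[OF lf])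
    ultimately show ?thesis by linarith
  qed
  show ?thesis
    using that[of L] lin neg eval by blast
qed

text \<open>
  On the order ideal of \<open>u\<close> the seminorm \<open>x \<mapsto> f \<bar>x\<bar>\<close> is dominated by a Hilbertian one:
  \<open>B x y\<close> is the integral of the product of \<open>x\<close> and \<open>y\<close> viewed as functions on \<open>unital_homs\<close>.
  The last inequality encodes Cauchy-Schwarz \<open>(f \<bar>x\<bar>)^2 \<le> f u * B x x\<close>.
\<close>

lemma hilbertian_form:
  assumes f: "positive_functional f"
  obtains B where
    "\<And>x y z. x \<in> order_ideal u \<Longrightarrow> y \<in> order_ideal u \<Longrightarrow> z \<in> order_ideal u \<Longrightarrow> B (x + y) z = B x z + B y z"
    "\<And>c x y. x \<in> order_ideal u \<Longrightarrow> y \<in> order_ideal u \<Longrightarrow> B (c *\<^sub>R x) y = c * B x y"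
    "\<And>x y. B x y = B y x"
    "\<And>x y. \<bar>x\<bar> \<le> u \<Longrightarrow> \<bar>y\<bar> \<le> u \<Longrightarrow> \<bar>B x y\<bar> \<le> f u"
    "\<And>t x. 0 < t \<Longrightarrow> x \<in> order_ideal u \<Longrightarrow> 2 * f \<bar>x\<bar> \<le> t * f u + B x x / t"
proof -
  obtain L where lin: "linear_on_set bounded_on_homs L"
    and neg: "\<And>\<phi>. \<phi> \<in> bounded_on_homs \<Longrightarrow> (\<And>h. h \<in> unital_homs \<Longrightarrow> \<phi> h \<le> 0) \<Longrightarrow> L \<phi> \<le> 0"
    and Lf: "\<And>x. x \<in> order_ideal u \<Longrightarrow> L (\<lambda>h. h x) = f x"
    by (rule extend_to_bounded_on_homs[OF f]) blast
  have L_add: "L (\<phi> + \<psi>) = L \<phi> + L \<psi>" and L_scale: "L (c *\<^sub>R \<phi>) = c * L \<phi>"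
    if "\<phi> \<in> bounded_on_homs" "\<psi> \<in> bounded_on_homs" for \<phi> \<psi> c
    using lin that by (auto simp: linear_on_set_def)
  have add_mem: "\<phi> + \<psi> \<in> bounded_on_homs" and scale_mem: "c *\<^sub>R \<phi> \<in> bounded_on_homs"
    if "\<phi> \<in> bounded_on_homs" "\<psi> \<in> bounded_on_homs" for \<phi> \<psi> c
    using that subspace_add[OF subspace_bounded_on_homs] subspace_scale[OF subspace_bounded_on_homs] by blast+
  have mono: "L \<phi> \<le> L \<psi>"
    if "\<phi> \<in> bounded_on_homs" "\<psi> \<in> bounded_on_homs" "\<And>h. h \<in> unital_homs \<Longrightarrow> \<phi> h \<le> \<psi> h" for \<phi> \<psi>
  proof -
    note m = scale_mem[OF that(2,2), of "- 1"]
    have "L (\<phi> + (- 1) *\<^sub>R \<psi>) \<le> 0"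
      by (rule neg[OF add_mem[OF that(1) m]]) (use that(3) in simp)
    then show ?thesis unfolding L_add[OF that(1) m] L_scale[OF that(2,2)] by linarith
  qed
  have cong: "L \<phi> = L \<psi>"
    if "\<phi> \<in> bounded_on_homs" "\<psi> \<in> bounded_on_homs" "\<And>h. h \<in> unital_homs \<Longrightarrow> \<phi> h = \<psi> h" for \<phi> \<psi>
    using mono[OF that(1,2)] mono[OF that(2,1)] that(3) by (simp add: order.antisym)
  define m where "m x y = (\<lambda>h::'a \<Rightarrow> real. h x * h y)" for x y
  have m_mem: "m x y \<in> bounded_on_homs" if "x \<in> order_ideal u" "y \<in> order_ideal u" for x y
    unfolding m_def by (rule mult_bounded_on_homs[OF eval_bounded_on_homs[OF that(1)] eval_bounded_on_homs[OF that(2)]])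
  note ideal_add = subspace_add[OF subspace_order_ideal]
  note ideal_scale = subspace_scale[OF subspace_order_ideal]
  note u_mem = eval_bounded_on_homs[OF unit_in_order_ideal]
  show ?thesis
  proof (rule that[of "\<lambda>x y. L (m x y)"])
    fix x y z assume x: "x \<in> order_ideal u" and y: "y \<in> order_ideal u" and z: "z \<in> order_ideal u"
    have "L (m (x + y) z) = L (m x z + m y z)"
      by (rule cong[OF m_mem[OF ideal_add[OF x y] z] add_mem[OF m_mem[OF x z] m_mem[OF y z]]])
        (simp add: m_def unital_hom_add[OF _ x y] distrib_right)
    then show "L (m (x + y) z) = L (m x z) + L (m y z)"
      by (simp only: L_add[OF m_mem[OF x z] m_mem[OF y z]])
  next
    fix c x y assume x: "x \<in> order_ideal u" and y: "y \<in> order_ideal u"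
    have "L (m (c *\<^sub>R x) y) = L (c *\<^sub>R m x y)"
      by (rule cong[OF m_mem[OF ideal_scale[OF x] y] scale_mem[OF m_mem[OF x y] m_mem[OF x y]]])
        (simp add: m_def unital_hom_scale[OF _ x])
    then show "L (m (c *\<^sub>R x) y) = c * L (m x y)"
      by (simp only: L_scale[OF m_mem[OF x y] m_mem[OF x y]])
  next
    fix x y show "L (m x y) = L (m y x)" by (simp add: m_def mult.commute)
  next
    fix x y assume "\<bar>x\<bar> \<le> u" "\<bar>y\<bar> \<le> u"
    then have xy: "\<bar>x\<bar> \<le> 1 *\<^sub>R u" "\<bar>y\<bar> \<le> 1 *\<^sub>R u" by simp_all
    note mem = m_mem[OF order_idealI[OF xy(1)] order_idealI[OF xy(2)]]
    have b: "\<bar>m x y h\<bar> \<le> h u" if "h \<in> unital_homs" for h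
      using unital_hom_bound[OF that xy(1)] unital_hom_bound[OF that xy(2)]
      by (simp add: m_def abs_mult unital_hom_unit[OF that] mult_le_one)
    have "L (m x y) \<le> L (\<lambda>h. h u)"
      by (rule mono[OF mem u_mem]) (rule order_trans[OF abs_ge_self b])
    moreover have "L ((- 1) *\<^sub>R m x y) \<le> L (\<lambda>h. h u)"
      by (rule mono[OF scale_mem[OF mem mem] u_mem]) (use order_trans[OF abs_ge_minus_self b] in simp)
    ultimately show "\<bar>L (m x y)\<bar> \<le> f u"
      unfolding L_scale[OF mem mem] Lf[OF unit_in_order_ideal] by (simp add: abs_le_iff)
  next
    fix t :: real and x assume t: "0 < t" and x: "x \<in> order_ideal u"
    note ax = eval_bounded_on_homs[OF abs_in_order_ideal[OF x]]
    note xx = m_mem[OF x x]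
    have "L (2 *\<^sub>R (\<lambda>h. h \<bar>x\<bar>)) \<le> L (t *\<^sub>R (\<lambda>h. h u) + (1 / t) *\<^sub>R m x x)"
    proof (rule mono[OF scale_mem[OF ax ax] add_mem[OF scale_mem[OF u_mem u_mem] scale_mem[OF xx xx]]])
      fix h assume hh: "h \<in> unital_homs"
      \<comment> \<open>Expanding the square pointwise gives an inequality between functions to
        which the positive functional \<open>L\<close> applies directly.\<close>
      have "0 \<le> (t - \<bar>h x\<bar>)\<^sup>2 / t" using t by simp
      also have "\<dots> = t - 2 * \<bar>h x\<bar> + h x * h x / t"
        using t by (simp add: power2_eq_square field_simps)
      finally show "(2 *\<^sub>R (\<lambda>h. h \<bar>x\<bar>)) h \<le> (t *\<^sub>R (\<lambda>h. h u) + (1 / t) *\<^sub>R m x x) h"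
        by (simp add: m_def unital_hom_abs[OF hh x] unital_hom_unit[OF hh])
    qed
    then show "2 * f \<bar>x\<bar> \<le> t * f u + L (m x x) / t"
      unfolding L_add[OF scale_mem[OF u_mem u_mem] scale_mem[OF xx xx]] L_scale[OF ax ax] L_scale[OF u_mem u_mem]
        L_scale[OF xx xx] Lf[OF unit_in_order_ideal] Lf[OF abs_in_order_ideal[OF x]] by simp
  qed
qed

end

section \<open>Order intervals\<close>

text \<open>The control functional \<open>f\<close> is at least \<open>d\<close> on
  \<open>\<bar>x\<bar>\<close> when the norm of \<open>x\<close> is at least \<open>e\<close>.
  Inserted into the linearized Cauchy-Schwarz inequality with \<open>M = f u\<close>, this keeps
  \<open>B x x\<close> away from zero.\<close>

lemma hilbertian_control:
  fixes u :: "'a::banach_lattice"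
  assumes oc: "order_continuous_norm TYPE('a)" and u: "0 \<le> u" and e: "0 < e"
  obtains B M d where "0 \<le> M" "0 < d"
    "\<And>x y z. x \<in> order_ideal u \<Longrightarrow> y \<in> order_ideal u \<Longrightarrow> z \<in> order_ideal u \<Longrightarrow> B (x + y) z = B x z + B y z"
    "\<And>c x y. x \<in> order_ideal u \<Longrightarrow> y \<in> order_ideal u \<Longrightarrow> B (c *\<^sub>R x) y = c * B x y"
    "\<And>x y. B x y = B y x"
    "\<And>x y. \<bar>x\<bar> \<le> u \<Longrightarrow> \<bar>y\<bar> \<le> u \<Longrightarrow> \<bar>B x y\<bar> \<le> M"
    "\<And>t x. 0 < t \<Longrightarrow> \<bar>x\<bar> \<le> u \<Longrightarrow> e \<le> norm x \<Longrightarrow> 2 * d \<le> t * M + B x x / t"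
proof -
  obtain f d where f: "positive_functional f" and d: "0 < d"
    "\<And>y. 0 \<le> y \<Longrightarrow> y \<le> u \<Longrightarrow> e \<le> norm y \<Longrightarrow> d \<le> f y"
    by (rule order_continuous_control[where u = u, OF oc e]) blast
  obtain B where B:
    "\<And>x y z. x \<in> order_ideal u \<Longrightarrow> y \<in> order_ideal u \<Longrightarrow> z \<in> order_ideal u \<Longrightarrow> B (x + y) z = B x z + B y z"
    "\<And>c x y. x \<in> order_ideal u \<Longrightarrow> y \<in> order_ideal u \<Longrightarrow> B (c *\<^sub>R x) y = c * B x y"
    "\<And>x y. B x y = B y x"
    "\<And>x y. \<bar>x\<bar> \<le> u \<Longrightarrow> \<bar>y\<bar> \<le> u \<Longrightarrow> \<bar>B x y\<bar> \<le> f u"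
    "\<And>t x. 0 < t \<Longrightarrow> x \<in> order_ideal u \<Longrightarrow> 2 * f \<bar>x\<bar> \<le> t * f u + B x x / t"
    by (rule hilbertian_form[OF u f]) blast
  show ?thesis
  proof (rule that[OF _ d(1) B(1-4)])
    show "0 \<le> f u" using f u by (simp add: positive_functional_def)
    fix t :: real and x assume t: "0 < t" and x: "\<bar>x\<bar> \<le> u" and n: "e \<le> norm x"
    have "d \<le> f \<bar>x\<bar>" using x n by (intro d(2)) simp_all
    moreover have "x \<in> order_ideal u" using x by (intro order_idealI[OF u, of _ 1]) simp
    ultimately show "2 * d \<le> t * f u + B x x / t" using B(5)[OF t, of x] by simp
  qed
qed

lemma not_Cauchy_real:
  fixes s :: "nat \<Rightarrow> real"
  assumes "\<not> Cauchy s"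
  obtains \<eta> a b where "0 < \<eta>" "\<And>n. n \<le> a n" "\<And>n. n \<le> b n" "\<And>n. \<eta> \<le> s (a n) - s (b n)"
proof -
  obtain \<eta> where \<eta>: "0 < \<eta>" "\<And>N. \<exists>m\<ge>N. \<exists>n\<ge>N. \<eta> \<le> \<bar>s m - s n\<bar>"
    using assms unfolding Cauchy_def dist_real_def by (meson not_less)
  have "\<exists>m n. N \<le> m \<and> N \<le> n \<and> \<eta> \<le> s m - s n" for N
    using \<eta>(2)[of N] by (metis abs_if minus_diff_eq)
  then obtain a b where "\<And>N. N \<le> a N \<and> N \<le> b N \<and> \<eta> \<le> s (a N) - s (b N)" by metis
  then show ?thesis using that \<eta>(1) by blast
qed

text \<open>
  If \<open>g\<close> separates two subsequences, their differences \<open>w\<close> tend weakly to zero for the Hilbertian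
  form, so averages of suitable \<open>w n\<close> are small for the form, hence small in norm (Banach-Saks);
  but \<open>g\<close> stays bounded away from zero on them.
\<close>

theorem order_interval_weakly_precompact:
  fixes x :: "nat \<Rightarrow> 'a::banach_lattice"
  assumes oc: "order_continuous_norm TYPE('a)" and xu: "\<And>n. \<bar>x n\<bar> \<le> u"
  obtains r where "strict_mono r" "weakly_Cauchy (x \<circ> r)"
proof -
  have u: "0 \<le> u" using abs_ge_zero xu by (rule order_trans)
  define P where "P k B M d \<longleftrightarrow> 0 \<le> M \<and> 0 < d \<and>
    (\<forall>x\<in>order_ideal u. \<forall>y\<in>order_ideal u. \<forall>z\<in>order_ideal u. B (x + y) z = B x z + B y z) \<and>
    (\<forall>c. \<forall>x\<in>order_ideal u. \<forall>y\<in>order_ideal u. B (c *\<^sub>R x) y = c * B x y) \<and>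
    (\<forall>x y. B x y = B y x) \<and>
    (\<forall>x y. \<bar>x\<bar> \<le> u \<longrightarrow> \<bar>y\<bar> \<le> u \<longrightarrow> \<bar>B x y\<bar> \<le> M) \<and>
    (\<forall>t x. 0 < t \<longrightarrow> \<bar>x\<bar> \<le> u \<longrightarrow> 1 / real (Suc k) \<le> norm x \<longrightarrow> 2 * d \<le> t * M + B x x / t)"
    for k :: nat and B :: "'a \<Rightarrow> 'a \<Rightarrow> real" and M d :: real
  have "\<exists>B M d. P k B M d" for k
  proof -
    have "0 < 1 / real (Suc k)" by simp
    then show ?thesis unfolding P_def by (rule hilbertian_control[OF oc u]) blast
  qed
  then obtain B M d where P: "\<And>k. P k (B k) (M k) (d k)" by metis
  note P' = P[unfolded P_def]
  have M: "\<And>k. 0 \<le> M k" and d: "\<And>k. 0 < d k"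
    and Badd: "\<And>k x y z. x \<in> order_ideal u \<Longrightarrow> y \<in> order_ideal u \<Longrightarrow> z \<in> order_ideal u \<Longrightarrow> B k (x + y) z = B k x z + B k y z"
    and Bscale: "\<And>k c x y. x \<in> order_ideal u \<Longrightarrow> y \<in> order_ideal u \<Longrightarrow> B k (c *\<^sub>R x) y = c * B k x y"
    and Bsym: "\<And>k x y. B k x y = B k y x"
    and Bbd: "\<And>k x y. \<bar>x\<bar> \<le> u \<Longrightarrow> \<bar>y\<bar> \<le> u \<Longrightarrow> \<bar>B k x y\<bar> \<le> M k"
    and Bd: "\<And>k t x. 0 < t \<Longrightarrow> \<bar>x\<bar> \<le> u \<Longrightarrow> 1 / real (Suc k) \<le> norm x \<Longrightarrow> 2 * d k \<le> t * M k + B k x x / t"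
    using P' by blast+
  \<comment> \<open>Dividing by \<open>M + 1\<close> bounds all values by 1, also when
    \<open>M = 0\<close>. One diagonal extraction then makes every form \<open>B k\<close> converge
    against every \<open>x m\<close>, before any functional is chosen.\<close>
  define F where "F n i = B (fst i) (x n) (x (snd i)) / (M (fst i) + 1)" for n and i :: "nat \<times> nat"
  have "norm (F n i) \<le> 1" for n i
    using Bbd[OF xu xu, of "fst i" n "snd i"] M[of "fst i"] by (simp add: F_def)
  then obtain r where r: "strict_mono r" "\<And>i. \<exists>l. (\<lambda>n. F (r n) i) \<longlonglongrightarrow> l"
    using function_convergent_subsequence[of "UNIV :: (nat \<times> nat) set" F 1]
    by (metis UNIV_I uncountable_def countableI_type)
  have Bconv: "\<exists>l. (\<lambda>n. B k (x (r n)) (x m)) \<longlonglongrightarrow> l" for k m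
  proof -
    obtain l where "(\<lambda>n. F (r n) (k, m)) \<longlonglongrightarrow> l" using r(2) by blast
    from tendsto_mult_right[OF this, of "M k + 1"] show ?thesis
      using M[of k] by (auto simp: F_def add_nonneg_eq_0_iff)
  qed
  have ideal: "z \<in> order_ideal u" if "\<bar>z\<bar> \<le> u" for z
    using that by (intro order_idealI[OF u, of _ 1]) simp
  note ideal_scale = subspace_scale[OF subspace_order_ideal[OF u]]
  note xI = ideal[OF xu]
  have "weakly_Cauchy (x \<circ> r)"
    unfolding weakly_Cauchy_def
  proof (intro allI impI, rule ccontr)
    fix g :: "'a \<Rightarrow> real" assume g: "bounded_linear g" and nC: "\<not> Cauchy (\<lambda>n. g ((x \<circ> r) n))"
    obtain \<eta> a b where \<eta>: "0 < \<eta>" and ab: "\<And>n. n \<le> a n" "\<And>n. n \<le> b n"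
      and sep: "\<And>n. \<eta> \<le> g (x (r (a n))) - g (x (r (b n)))"
      using not_Cauchy_real[OF nC] by (metis comp_apply)
    have lg: "linear g" using g by (rule bounded_linear.linear)
    \<comment> \<open>The factor \<open>1 / 2\<close> keeps the differences in the interval
      \<open>[- u, u]\<close>.\<close>
    define w where "w n = (1 / 2) *\<^sub>R (x (r (a n)) + (- 1) *\<^sub>R x (r (b n)))" for n
    have mI: "(- 1) *\<^sub>R x n \<in> order_ideal u" for n by (rule ideal_scale[OF xI])
    have sI: "x m + (- 1) *\<^sub>R x n \<in> order_ideal u" for m n
      by (rule subspace_add[OF subspace_order_ideal[OF u] xI mI])
    have Bw: "B k (w n) z = (1 / 2) * (B k (x (r (a n))) z - B k (x (r (b n))) z)"
      if "z \<in> order_ideal u" for k n z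
      unfolding w_def Bscale[OF sI that] Badd[OF xI mI that] Bscale[OF xI that] by simp
    have wu: "\<bar>w n\<bar> \<le> u" for n
    proof -
      have "\<bar>x (r (a n)) + (- 1) *\<^sub>R x (r (b n))\<bar> \<le> \<bar>x (r (a n))\<bar> + \<bar>(- 1) *\<^sub>R x (r (b n))\<bar>"
        by (rule abs_triangle_ineq)
      also have "\<dots> \<le> u + u" unfolding lattice_abs_scaleR by (rule add_mono[OF xu]) (simp add: xu)
      also have "\<dots> = 2 *\<^sub>R u" by (simp add: scaleR_2)
      finally have "(1 / 2) *\<^sub>R \<bar>x (r (a n)) + (- 1) *\<^sub>R x (r (b n))\<bar> \<le> (1 / 2) *\<^sub>R 2 *\<^sub>R u"
        by (rule scaleR_left_mono) simp
      then show ?thesis unfolding w_def lattice_abs_scaleR by simp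
    qed
    note wI = ideal[OF wu]
    have gw: "\<eta> / 2 \<le> g (w n)" for n
      using sep[of n] by (simp add: w_def linear_scale[OF lg] linear_diff[OF lg])
    have Bwx: "(\<lambda>n. B k (w n) (x m)) \<longlonglongrightarrow> 0" for k m
    proof -
      obtain l where l: "(\<lambda>n. B k (x (r n)) (x m)) \<longlonglongrightarrow> l" using Bconv by blast
      have "filterlim a at_top sequentially" "filterlim b at_top sequentially"
        by (rule filterlim_at_top_mono[OF filterlim_ident], simp add: ab)+
      from filterlim_compose[OF l this(1)] filterlim_compose[OF l this(2)]
      have "(\<lambda>n. (1 / 2) * (B k (x (r (a n))) (x m) - B k (x (r (b n))) (x m))) \<longlonglongrightarrow> (1 / 2) * (l - l)"
        by (intro tendsto_intros)
      then show ?thesis by (simp add: Bw[OF xI])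
    qed
    have Bww: "(\<lambda>n. B k (w n) (w m)) \<longlonglongrightarrow> 0" for k m
    proof -
      have eq: "B k (w n) (w m) = (1 / 2) * (B k (w n) (x (r (a m))) - B k (w n) (x (r (b m))))" for n
        using Bw[OF wI, of k m n] by (simp only: Bsym)
      have "(\<lambda>n. (1 / 2) * (B k (w n) (x (r (a m))) - B k (w n) (x (r (b m))))) \<longlonglongrightarrow> (1 / 2) * (0 - 0)"
        by (intro tendsto_intros Bwx)
      then show ?thesis unfolding eq by (simp only: diff_self mult_zero_right)
    qed
    obtain K where K: "0 < K" "\<And>z. norm (g z) \<le> norm z * K" using bounded_linear.pos_bounded[OF g] by blast
    \<comment> \<open>An element on which \<open>g\<close> is at least \<open>\<eta> / 2\<close> has
      norm at least \<open>\<eta> / (2 * K)\<close>; \<open>k\<close> is such that the form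
      \<open>B k\<close> detects this norm.\<close>
    obtain k where "inverse (real (Suc k)) < \<eta> / (2 * K)"
      using reals_Archimedean[of "\<eta> / (2 * K)"] \<eta> K by auto
    then have k: "1 / real (Suc k) \<le> \<eta> / (2 * K)" by (simp add: inverse_eq_divide)
    \<comment> \<open>A sum of \<open>n\<close> terms of \<open>w\<close>, chosen greedily. The last
      clause lets the next term be nearly orthogonal to \<open>z\<close>: the cross term contributes
      less than 1, so \<open>B k z z\<close> grows linearly in \<open>n\<close> and the form of the
      average decays like \<open>1 / n\<close>.\<close>
    have sums: "\<exists>z. \<bar>z\<bar> \<le> real n *\<^sub>R u \<and> real n * (\<eta> / 2) \<le> g z \<and> B k z z \<le> real n * (1 + M k) \<and>
      (\<lambda>i. B k (w i) z) \<longlonglongrightarrow> 0" for n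
    proof (induction n)
      case 0
      have "B k (w i) 0 = 0" for i
        using Bscale[OF xI wI, of k 0 0 i] Bsym[of k "w i" 0] by simp
      moreover have "B k 0 0 = 0" using Bscale[OF xI ideal_scale[OF xI], of k 0 0 0] by simp
      ultimately show ?case by (intro exI[of _ 0]) (simp add: linear_0[OF lg])
    next
      case (Suc n)
      then obtain z where z: "\<bar>z\<bar> \<le> real n *\<^sub>R u" "real n * (\<eta> / 2) \<le> g z" "B k z z \<le> real n * (1 + M k)"
        "(\<lambda>i. B k (w i) z) \<longlonglongrightarrow> 0" by blast
      note zI = order_idealI[OF u z(1)]
      have "\<forall>\<^sub>F i in sequentially. B k (w i) z < 1 / 2" by (rule order_tendstoD(2)[OF z(4)]) simp
      then obtain i where i: "B k (w i) z < 1 / 2" by (auto simp: eventually_sequentially)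
      have zwI: "z + w i \<in> order_ideal u" by (rule subspace_add[OF subspace_order_ideal[OF u] zI wI])
      have Bz: "B k y (z + w i) = B k y z + B k y (w i)" if "y \<in> order_ideal u" for y
        using Badd[OF zI wI that, of k] by (simp only: Bsym)
      show ?case
      proof (intro exI[of _ "z + w i"] conjI)
        have "\<bar>z + w i\<bar> \<le> real n *\<^sub>R u + u"
          by (rule order_trans[OF abs_triangle_ineq add_mono[OF z(1) wu]])
        then show "\<bar>z + w i\<bar> \<le> real (Suc n) *\<^sub>R u" by (simp add: scaleR_left_distrib add.commute)
        show "real (Suc n) * (\<eta> / 2) \<le> g (z + w i)"
          using z(2) gw[of i] by (simp add: linear_add[OF lg] algebra_simps)
        have "B k (z + w i) (z + w i) = B k z z + 2 * B k (w i) z + B k (w i) (w i)"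
          unfolding Bz[OF zwI] Badd[OF zI wI zI] Badd[OF zI wI wI] using Bsym[of k z "w i"] by simp
        also have "\<dots> \<le> real n * (1 + M k) + 1 + M k"
          using z(3) i Bbd[OF wu wu, of k i i] by linarith
        finally show "B k (z + w i) (z + w i) \<le> real (Suc n) * (1 + M k)" by (simp add: algebra_simps)
        have "(\<lambda>j. B k (w j) z + B k (w j) (w i)) \<longlonglongrightarrow> 0 + 0" by (intro tendsto_add z(4) Bww)
        then show "(\<lambda>j. B k (w j) (z + w i)) \<longlonglongrightarrow> 0" by (simp add: Bz[OF wI])
      qed
    qed
    have key: "2 * d k \<le> t * M k + (1 + M k) / (real n * t)" if t: "0 < t" and n: "0 < n" for t n
    proof -
      obtain z where z: "\<bar>z\<bar> \<le> real n *\<^sub>R u" "real n * (\<eta> / 2) \<le> g z" "B k z z \<le> real n * (1 + M k)"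
        using sums by blast
      note zI = order_idealI[OF u z(1)]
      define v where "v = (1 / real n) *\<^sub>R z"
      have "\<bar>v\<bar> \<le> (1 / real n) *\<^sub>R real n *\<^sub>R u"
        unfolding v_def lattice_abs_scaleR using scaleR_left_mono[OF z(1), of "1 / real n"] by simp
      then have vu: "\<bar>v\<bar> \<le> u" using n by simp
      have "\<eta> / 2 \<le> g v" using z(2) n by (simp add: v_def linear_scale[OF lg] field_simps)
      also have "\<dots> \<le> norm v * K" using K(2)[of v] by simp
      finally have "\<eta> / (2 * K) \<le> norm v" using K(1) by (simp add: field_simps)
      with k have nv: "1 / real (Suc k) \<le> norm v" by (rule order_trans)
      have "B k v v = (1 / real n) * ((1 / real n) * B k z z)"
        using Bscale[OF zI ideal_scale[OF zI], of k "1 / real n" "1 / real n"] Bscale[OF zI zI, of k "1 / real n"]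
          Bsym[of k z "(1 / real n) *\<^sub>R z"] by (simp add: v_def)
      also have "\<dots> \<le> (1 / real n) * ((1 / real n) * (real n * (1 + M k)))"
        by (intro mult_left_mono z(3)) simp_all
      also have "\<dots> = (1 + M k) / real n" using n by simp
      finally have "B k v v / t \<le> (1 + M k) / real n / t" using t by (intro divide_right_mono) simp_all
      with Bd[OF t vu nv] show ?thesis by (simp add: divide_divide_eq_left)
    qed
    \<comment> \<open>With this \<open>t\<close> the summand \<open>t * M k\<close> uses up at most
      one of the two copies of \<open>d k\<close>; the other one stays below a bound that tends to
      zero as \<open>n\<close> grows.\<close>
    define t where "t = d k / (M k + 1)"
    have t: "0 < t" using d[of k] M[of k] by (simp add: t_def)
    have "t * M k \<le> d k" using d[of k] M[of k] by (simp add: t_def field_simps)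
    then have "d k \<le> (1 + M k) / (real n * t)" if "0 < n" for n using key[OF t that] by linarith
    then have "real n \<le> (1 + M k) / (d k * t)" if "0 < n" for n
      using that t d[of k] by (simp add: field_simps)
    then show False using reals_Archimedean2[of "(1 + M k) / (d k * t)"] t d[of k] M[of k]
      by (metis not_less of_nat_0_less_iff order.strict_trans1 divide_nonneg_pos add_nonneg_nonneg zero_le_one mult_pos_pos)
  qed
  with r(1) show ?thesis by (rule that)
qed

section \<open>Disjointly weakly compact sets\<close>

text \<open>For \<open>j < k\<close> the term with index \<open>k\<close> lies below a multiple of
  the positive part of \<open>a k / 4 ^ k - a j\<close>, thanks to the subtracted sum. The term with
  index \<open>j\<close> lies below the positive part of \<open>a j - a k / 4 ^ k\<close>, because
  \<open>a k / 4 ^ k\<close> is at most \<open>b / 2 ^ k\<close> and hence at most the subtracted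
  \<open>b / 2 ^ j\<close>. These two parts are disjoint.\<close>

lemma disjointification:
  fixes a :: "nat \<Rightarrow> 'a::banach_lattice"
  assumes a: "\<And>k. 0 \<le> a k" and b: "\<And>k. (1 / 2) ^ k *\<^sub>R a k \<le> b"
  shows "disjoint_seq (\<lambda>k. pprt (a k - (4 ^ k *\<^sub>R (\<Sum>i<k. a i) + (1 / 2) ^ k *\<^sub>R b)))"
proof -
  define w where "w k = pprt (a k - (4 ^ k *\<^sub>R (\<Sum>i<k. a i) + (1 / 2) ^ k *\<^sub>R b))" for k
  have b0: "0 \<le> b" using scaleR_nonneg_nonneg[OF _ a, of "(1 / 2) ^ 0" 0] b[of 0] by (meson order_trans zero_le_power zero_le_divide_1_iff zero_le_numeral)
  have S0: "0 \<le> (\<Sum>i<k. a i)" for k by (rule sum_nonneg) (rule a)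
  have less: "inf (w j) (w k) = 0" if jk: "j < k" for j k
  proof -
    define c where "c = (4::real) ^ k"
    have c: "0 < c" by (simp add: c_def)
    have "c *\<^sub>R a j \<le> c *\<^sub>R (\<Sum>i<k. a i)"
    proof (rule scaleR_left_mono)
      show "a j \<le> (\<Sum>i<k. a i)" using sum_mono2[of "{..<k}" "{j}" a] jk a by simp
    qed (use c in simp)
    also have "\<dots> \<le> c *\<^sub>R (\<Sum>i<k. a i) + (1 / 2) ^ k *\<^sub>R b"
      using scaleR_nonneg_nonneg[OF _ b0, of "(1 / 2) ^ k"] by simp
    finally have "a k - (c *\<^sub>R (\<Sum>i<k. a i) + (1 / 2) ^ k *\<^sub>R b) \<le> a k - c *\<^sub>R a j"
      by (rule diff_left_mono)
    also have "a k - c *\<^sub>R a j = c *\<^sub>R ((1 / c) *\<^sub>R a k - a j)"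
      using c by (simp add: scaleR_diff_right)
    finally have "w k \<le> pprt (c *\<^sub>R ((1 / c) *\<^sub>R a k - a j))" unfolding w_def c_def[symmetric] by (rule pprt_mono)
    also have "\<dots> = c *\<^sub>R pprt ((1 / c) *\<^sub>R a k - a j)" using c by (intro scaleR_pprt) simp
    finally have wk: "w k \<le> c *\<^sub>R pprt ((1 / c) *\<^sub>R a k - a j)" .
    have "(1 / c) *\<^sub>R a k = (1 / 2) ^ k *\<^sub>R (1 / 2) ^ k *\<^sub>R a k"
      by (simp add: c_def power_mult_distrib[symmetric] power_one_over)
    also have "\<dots> \<le> (1 / 2) ^ k *\<^sub>R b" by (rule scaleR_left_mono[OF b]) simp
    also have "\<dots> \<le> (1 / 2) ^ j *\<^sub>R b"
      using jk by (intro scaleR_right_mono power_decreasing b0) auto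
    also have "\<dots> \<le> 4 ^ j *\<^sub>R (\<Sum>i<j. a i) + (1 / 2) ^ j *\<^sub>R b"
      using scaleR_nonneg_nonneg[OF _ S0, of "4 ^ j" j] by simp
    finally have "a j - (4 ^ j *\<^sub>R (\<Sum>i<j. a i) + (1 / 2) ^ j *\<^sub>R b) \<le> a j - (1 / c) *\<^sub>R a k"
      by (rule diff_left_mono)
    then have wj: "w j \<le> pprt (a j - (1 / c) *\<^sub>R a k)" unfolding w_def by (rule pprt_mono)
    have "inf (pprt (a j - (1 / c) *\<^sub>R a k)) (c *\<^sub>R pprt ((1 / c) *\<^sub>R a k - a j)) = 0"
      using c by (intro disjoint_scaleR disjoint_pprt_diff zero_le_pprt) simp
    then show ?thesis by (rule disjoint_mono) (use wj wk in \<open>simp_all add: w_def\<close>)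
  qed
  have "inf \<bar>w n\<bar> \<bar>w m\<bar> = 0" if "n \<noteq> m" for n m
  proof -
    have "\<bar>w i\<bar> = w i" for i by (simp add: w_def abs_of_nonneg)
    then show ?thesis using less[of n m] less[of m n] that by (metis inf_commute nat_neq_iff)
  qed
  then show ?thesis unfolding disjoint_seq_def w_def[symmetric] by blast
qed

lemma summable_geometric_weights:
  fixes x :: "nat \<Rightarrow> 'a::banach"
  assumes "\<And>n. norm (x n) \<le> C"
  shows "summable (\<lambda>n. (1 / 2) ^ n *\<^sub>R x n)"
proof (rule summable_comparison_test')
  show "summable (\<lambda>n. C * (1 / 2) ^ n)" by (intro summable_mult summable_geometric) simp
  show "norm ((1 / 2) ^ n *\<^sub>R x n) \<le> C * (1 / 2) ^ n" if "0 \<le> n" for n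
    using mult_right_mono[OF assms[of n], of "(1 / 2) ^ n"] by (simp add: mult.commute)
qed

text \<open>Otherwise every multiple of \<open>e\<close> is exceeded by some
  \<open>\<bar>x n\<bar>\<close> with \<open>G\<close> larger than \<open>\<epsilon>\<close> on the
  excess. Disjointifying suitable such terms gives a disjoint sequence in the solid hull on which
  \<open>G\<close> stays above \<open>\<epsilon>\<close> up to an error
  \<open>(1 / 2) ^ k * G b\<close>, although it must be weakly null.\<close>

lemma disjointly_weakly_compact_tail:
  fixes x :: "nat \<Rightarrow> 'a::banach_lattice"
  assumes A: "disjointly_weakly_compact A" and x: "\<And>n. x n \<in> A" and G: "positive_functional G"
    and \<epsilon>: "0 < \<epsilon>"
  defines "e \<equiv> (\<Sum>n. (1 / 2) ^ n *\<^sub>R \<bar>x n\<bar>)"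
  shows "\<exists>k::nat. \<forall>n. G (pprt (\<bar>x n\<bar> - real k *\<^sub>R e)) \<le> \<epsilon>"
proof (rule ccontr)
  assume "\<not> ?thesis"
  then have no: "\<exists>n. \<epsilon> < G (pprt (\<bar>x n\<bar> - real k *\<^sub>R e))" for k :: nat by (meson not_less)
  obtain C where C: "\<And>n. norm (x n) \<le> C"
    using A x unfolding disjointly_weakly_compact_def bounded_iff by blast
  have sum: "summable (\<lambda>n. (1 / 2) ^ n *\<^sub>R \<bar>x n\<bar>)" by (rule summable_geometric_weights[of _ C]) (simp add: C)
  have nn: "0 \<le> (1 / 2) ^ n *\<^sub>R \<bar>x n\<bar>" for n by (rule scaleR_nonneg_nonneg) simp_all
  have e0: "0 \<le> e" unfolding e_def by (rule suminf_nonneg_lattice[OF sum nn])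
  have xe: "\<bar>x n\<bar> \<le> 2 ^ n *\<^sub>R e" for n
  proof -
    have "(1 / 2) ^ n *\<^sub>R \<bar>x n\<bar> \<le> e" unfolding e_def by (rule term_le_suminf_lattice[OF sum nn])
    then have "2 ^ n *\<^sub>R (1 / 2) ^ n *\<^sub>R \<bar>x n\<bar> \<le> 2 ^ n *\<^sub>R e" by (rule scaleR_left_mono) simp
    then show ?thesis by (simp add: power_one_over)
  qed
  have "\<exists>n. \<epsilon> < G (pprt (\<bar>x n\<bar> - c *\<^sub>R e))" for c :: real
  proof -
    obtain k :: nat where "c \<le> real k" using real_arch_simple by blast
    then have "pprt (\<bar>x n\<bar> - real k *\<^sub>R e) \<le> pprt (\<bar>x n\<bar> - c *\<^sub>R e)" for n
      by (intro pprt_mono diff_left_mono scaleR_right_mono e0)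
    from positive_functional_mono[OF G this] no[of k] show ?thesis by (meson less_le_trans)
  qed
  then obtain N where N: "\<And>c. \<epsilon> < G (pprt (\<bar>x (N c)\<bar> - c *\<^sub>R e))" by metis
  \<comment> \<open>\<open>s k *\<^sub>R e\<close> dominates the sum of the terms chosen before
    stage \<open>k\<close>, since \<open>\<bar>x n\<bar>\<close> is at most
    \<open>2 ^ n *\<^sub>R e\<close>. Choosing the next term against the threshold
    \<open>4 ^ k * s k\<close> anticipates the factor \<open>4 ^ k\<close> of the
    disjointification.\<close>
  define s where "s = rec_nat (0::real) (\<lambda>k s. s + 2 ^ N (4 ^ k * s))"
  have s: "s 0 = 0" "\<And>k. s (Suc k) = s k + 2 ^ N (4 ^ k * s k)" by (simp_all add: s_def)
  define a where "a k = \<bar>x (N (4 ^ k * s k))\<bar>" for k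
  define b where "b = (\<Sum>k. (1 / 2) ^ k *\<^sub>R a k)"
  have a0: "0 \<le> a k" for k by (simp add: a_def)
  have sumb: "summable (\<lambda>k. (1 / 2) ^ k *\<^sub>R a k)" by (rule summable_geometric_weights[of _ C]) (simp add: a_def C)
  have b0: "0 \<le> b" unfolding b_def
    by (rule suminf_nonneg_lattice[OF sumb]) (intro scaleR_nonneg_nonneg a0 zero_le_power, simp)
  have ab: "(1 / 2) ^ k *\<^sub>R a k \<le> b" for k
    unfolding b_def by (rule term_le_suminf_lattice[OF sumb]) (intro scaleR_nonneg_nonneg a0 zero_le_power, simp)
  have suma: "(\<Sum>i<k. a i) \<le> s k *\<^sub>R e" for k
  proof (induction k)
    case (Suc k)
    have "(\<Sum>i<k. a i) + a k \<le> s k *\<^sub>R e + 2 ^ N (4 ^ k * s k) *\<^sub>R e"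
      unfolding a_def[of k] by (rule add_mono[OF Suc xe])
    then show ?case by (simp add: s scaleR_left_distrib)
  qed (simp add: s)
  define w where "w k = pprt (a k - (4 ^ k *\<^sub>R (\<Sum>i<k. a i) + (1 / 2) ^ k *\<^sub>R b))" for k
  have "disjoint_seq w" unfolding w_def by (rule disjointification[OF a0 ab])
  moreover have "w k \<in> solid_hull A" for k
  proof -
    have "0 \<le> 4 ^ k *\<^sub>R (\<Sum>i<k. a i) + (1 / 2) ^ k *\<^sub>R b"
      by (intro add_nonneg_nonneg scaleR_nonneg_nonneg sum_nonneg a0 b0) simp_all
    then have "a k - (4 ^ k *\<^sub>R (\<Sum>i<k. a i) + (1 / 2) ^ k *\<^sub>R b) \<le> a k" by (simp add: diff_le_eq)
    from pprt_mono[OF this] have "w k \<le> a k" by (simp add: w_def a0)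
    moreover have "0 \<le> w k" by (simp add: w_def)
    ultimately show ?thesis unfolding solid_hull_def a_def using x by (auto simp: abs_of_nonneg)
  qed
  ultimately have "weakly_converges w 0" using A by (auto simp: disjointly_weakly_compact_def)
  then have "(\<lambda>k. G (w k)) \<longlonglongrightarrow> G 0" using G by (simp add: weakly_converges_def positive_functional_def)
  moreover have "(\<lambda>k. (1 / 2) ^ k * G b) \<longlonglongrightarrow> 0 * G b"
    by (intro tendsto_mult_right LIMSEQ_power_zero) simp
  ultimately have "(\<lambda>k. G (w k) + (1 / 2) ^ k * G b) \<longlonglongrightarrow> 0"
    using tendsto_add[of "\<lambda>k. G (w k)" "G 0" sequentially "\<lambda>k. (1 / 2) ^ k * G b" 0]
    by (simp add: linear_0[OF positive_functional_linear[OF G]])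
  moreover have "\<epsilon> \<le> G (w k) + (1 / 2) ^ k * G b" for k
  proof -
    define c where "c = 4 ^ k * s k"
    have q0: "0 \<le> (1 / 2) ^ k *\<^sub>R b" by (intro scaleR_nonneg_nonneg b0) simp_all
    have "4 ^ k *\<^sub>R (\<Sum>i<k. a i) \<le> c *\<^sub>R e"
      using scaleR_left_mono[OF suma[of k], of "4 ^ k"] by (simp add: c_def)
    then have "a k - c *\<^sub>R e \<le> a k - 4 ^ k *\<^sub>R (\<Sum>i<k. a i)" by (rule diff_left_mono)
    also have "\<dots> = (a k - (4 ^ k *\<^sub>R (\<Sum>i<k. a i) + (1 / 2) ^ k *\<^sub>R b)) + (1 / 2) ^ k *\<^sub>R b" by simp
    finally have "pprt (a k - c *\<^sub>R e) \<le> pprt ((a k - (4 ^ k *\<^sub>R (\<Sum>i<k. a i) + (1 / 2) ^ k *\<^sub>R b)) + (1 / 2) ^ k *\<^sub>R b)"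
      by (rule pprt_mono)
    also have "\<dots> \<le> w k + pprt ((1 / 2) ^ k *\<^sub>R b)" unfolding w_def by (rule pprt_add_le)
    also have "pprt ((1 / 2) ^ k *\<^sub>R b) = (1 / 2) ^ k *\<^sub>R b" using q0 by (rule pprt_eq_id)
    finally have "G (pprt (a k - c *\<^sub>R e)) \<le> G (w k + (1 / 2) ^ k *\<^sub>R b)" by (rule positive_functional_mono[OF G])
    moreover have "\<epsilon> < G (pprt (a k - c *\<^sub>R e))" using N[of c] by (simp add: a_def c_def)
    ultimately show ?thesis
      by (simp add: linear_add[OF positive_functional_linear[OF G]] linear_scale[OF positive_functional_linear[OF G]])
  qed
  ultimately have "\<epsilon> \<le> 0" by (intro LIMSEQ_le_const) auto
  with \<epsilon> show False by simp
qed

section \<open>Truncation to order intervals and diagonal extraction\<close>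

definition truncate_at :: "'a::banach_lattice \<Rightarrow> 'a \<Rightarrow> 'a" where
  "truncate_at u x = inf (sup x (- u)) u"

lemma abs_truncate_at:
  fixes u :: "'a::banach_lattice"
  assumes "0 \<le> u"
  shows "\<bar>truncate_at u x\<bar> \<le> u"
proof -
  have "- u \<le> u" using assms by (simp add: minus_le_self_iff)
  then have "- u \<le> truncate_at u x" unfolding truncate_at_def by (intro inf_greatest sup_ge2)
  then have "- truncate_at u x \<le> u" by (simp only: minus_le_iff)
  moreover have "truncate_at u x \<le> u" unfolding truncate_at_def by (rule inf_le2)
  ultimately show ?thesis by (simp only: lattice_abs_le_iff)
qed

lemma abs_diff_truncate_at:
  fixes u :: "'a::banach_lattice"
  assumes "0 \<le> u"
  shows "\<bar>x - truncate_at u x\<bar> \<le> 2 *\<^sub>R pprt (\<bar>x\<bar> - u)"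
proof -
  have p1: "x - u \<le> pprt (\<bar>x\<bar> - u)" "- x - u \<le> pprt (\<bar>x\<bar> - u)"
    unfolding pprt_def by (rule le_supI1, rule diff_right_mono, simp add: abs_ge_self abs_ge_minus_self)+
  have p0: "0 \<le> pprt (\<bar>x\<bar> - u)" by simp
  have m: "- u \<le> u" using assms by (simp add: minus_le_self_iff)
  have "x - pprt (\<bar>x\<bar> - u) \<le> truncate_at u x"
    unfolding truncate_at_def
  proof (rule inf_greatest)
    show "x - pprt (\<bar>x\<bar> - u) \<le> sup x (- u)" by (rule le_supI1) (simp add: diff_le_eq)
    show "x - pprt (\<bar>x\<bar> - u) \<le> u" using p1(1) by (simp only: diff_le_eq add.commute)
  qed
  then have "x - truncate_at u x \<le> pprt (\<bar>x\<bar> - u)" by (simp only: diff_le_eq add.commute)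
  moreover have "truncate_at u x \<le> x + pprt (\<bar>x\<bar> - u)"
  proof -
    have "sup x (- u) \<le> x + pprt (\<bar>x\<bar> - u)"
    proof (rule sup_least)
      show "x \<le> x + pprt (\<bar>x\<bar> - u)" by simp
      have "- u \<le> x + (- x - u)" by simp
      also have "\<dots> \<le> x + pprt (\<bar>x\<bar> - u)" by (rule add_left_mono[OF p1(2)])
      finally show "- u \<le> x + pprt (\<bar>x\<bar> - u)" .
    qed
    then show ?thesis unfolding truncate_at_def by (rule le_infI1)
  qed
  then have "- (x - truncate_at u x) \<le> pprt (\<bar>x\<bar> - u)" by (simp only: minus_diff_eq diff_le_eq add.commute)
  ultimately have "\<bar>x - truncate_at u x\<bar> \<le> pprt (\<bar>x\<bar> - u)" by (simp only: lattice_abs_le_iff)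
  also have "\<dots> \<le> 2 *\<^sub>R pprt (\<bar>x\<bar> - u)" using p0 by (simp add: scaleR_2)
  finally show ?thesis .
qed

lemma weakly_Cauchy_subseq: "weakly_Cauchy x \<Longrightarrow> strict_mono r \<Longrightarrow> weakly_Cauchy (x \<circ> r)"
  unfolding weakly_Cauchy_def using Cauchy_subseq_Cauchy by (fastforce simp: comp_def)

text \<open>A diagonal subsequence makes the truncations at all multiples
  \<open>real k *\<^sub>R e\<close> weakly Cauchy. For a given functional, a positive functional
  dominating it bounds the truncation error uniformly in \<open>n\<close> once \<open>k\<close> is
  large, so the sequence itself is Cauchy under it.\<close>

theorem disjointly_weakly_compact_imp_weakly_precompact:
  fixes A :: "'a::banach_lattice set"
  assumes oc: "order_continuous_norm TYPE('a)" and A: "disjointly_weakly_compact A"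
  shows "weakly_precompact A"
  unfolding weakly_precompact_def
proof (intro conjI allI impI)
  show "bounded A" using A by (simp add: disjointly_weakly_compact_def)
  fix x :: "nat \<Rightarrow> 'a" assume x: "\<forall>n. x n \<in> A"
  define e where "e = (\<Sum>n. (1 / 2) ^ n *\<^sub>R \<bar>x n\<bar>)"
  obtain C where C: "\<And>n. norm (x n) \<le> C"
    using A x unfolding disjointly_weakly_compact_def bounded_iff by blast
  have sum: "summable (\<lambda>n. (1 / 2) ^ n *\<^sub>R \<bar>x n\<bar>)" by (rule summable_geometric_weights[of _ C]) (simp add: C)
  have e0: "0 \<le> e" unfolding e_def
    by (rule suminf_nonneg_lattice[OF sum]) (rule scaleR_nonneg_nonneg, simp_all)
  have ke0: "0 \<le> real k *\<^sub>R e" for k by (rule scaleR_nonneg_nonneg) (simp_all add: e0)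
  define P where "P k s = weakly_Cauchy (\<lambda>n. truncate_at (real k *\<^sub>R e) (x (s n)))" for k s
  interpret subseqs P
  proof
    fix k and s :: "nat \<Rightarrow> nat" assume "strict_mono s"
    show "\<exists>r. strict_mono r \<and> P k (s \<circ> r)"
      unfolding P_def
      by (rule order_interval_weakly_precompact[OF oc abs_truncate_at[OF ke0], of k "\<lambda>n. x (s n)"])
        (auto simp: comp_def)
  qed
  \<comment> \<open>The diagonal sequence is a subsequence of the extraction for \<open>k\<close>
    only from index \<open>Suc k\<close> on, hence the shift.\<close>
  have diag: "weakly_Cauchy (\<lambda>n. truncate_at (real k *\<^sub>R e) (x (diagseq (Suc k + n))))" for k
    using diagseq_holds[of k] weakly_Cauchy_subseq unfolding P_def by (fastforce simp: comp_def)
  have "weakly_Cauchy (x \<circ> diagseq)"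
    unfolding weakly_Cauchy_def
  proof (intro allI impI)
    fix g :: "'a \<Rightarrow> real" assume g: "bounded_linear g"
    obtain G where G: "positive_functional G" "\<And>z. \<bar>g z\<bar> \<le> G \<bar>z\<bar>"
      by (rule positive_functional_dominating[OF g]) blast
    show "Cauchy (\<lambda>n. g ((x \<circ> diagseq) n))"
    proof (rule CauchyI)
      fix \<epsilon> :: real assume \<epsilon>: "0 < \<epsilon>"
      \<comment> \<open>Truncation costs twice this amount at each of two terms,
        \<open>\<epsilon> / 2\<close> in total; the other half is left for the truncated
        sequence.\<close>
      have "0 < \<epsilon> / 8" using \<epsilon> by simp
      from disjointly_weakly_compact_tail[of A x, OF A x[rule_format] G(1) this]
      obtain k :: nat where k: "\<And>n. G (pprt (\<bar>x n\<bar> - real k *\<^sub>R e)) \<le> \<epsilon> / 8"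
        unfolding e_def by blast
      define t where "t n = g (truncate_at (real k *\<^sub>R e) (x n))" for n
      have close: "\<bar>g (x n) - t n\<bar> \<le> \<epsilon> / 4" for n
      proof -
        have "\<bar>g (x n) - t n\<bar> = \<bar>g (x n - truncate_at (real k *\<^sub>R e) (x n))\<bar>"
          by (simp add: t_def linear_diff[OF bounded_linear.linear[OF g]])
        also have "\<dots> \<le> G \<bar>x n - truncate_at (real k *\<^sub>R e) (x n)\<bar>" by (rule G(2))
        also have "\<dots> \<le> G (2 *\<^sub>R pprt (\<bar>x n\<bar> - real k *\<^sub>R e))"
          by (rule positive_functional_mono[OF G(1) abs_diff_truncate_at[OF ke0]])
        also have "\<dots> = 2 * G (pprt (\<bar>x n\<bar> - real k *\<^sub>R e))"
          by (simp add: linear_scale[OF positive_functional_linear[OF G(1)]])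
        also have "\<dots> \<le> \<epsilon> / 4" using k[of n] by simp
        finally show ?thesis .
      qed
      have "Cauchy (\<lambda>n. t (diagseq (Suc k + n)))"
        using diag[of k] g unfolding weakly_Cauchy_def t_def by blast
      moreover have "0 < \<epsilon> / 2" using \<epsilon> by simp
      ultimately obtain N where N: "\<And>m n. m \<ge> N \<Longrightarrow> n \<ge> N \<Longrightarrow> \<bar>t (diagseq (Suc k + m)) - t (diagseq (Suc k + n))\<bar> < \<epsilon> / 2"
        unfolding Cauchy_def dist_real_def by meson
      have "norm (g ((x \<circ> diagseq) m) - g ((x \<circ> diagseq) n)) < \<epsilon>" if "m \<ge> Suc k + N" "n \<ge> Suc k + N" for m n
      proof -
        have "\<bar>t (diagseq m) - t (diagseq n)\<bar> < \<epsilon> / 2"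
          using N[of "m - Suc k" "n - Suc k"] that by simp
        then show ?thesis
          using close[of "diagseq m"] close[of "diagseq n"]
          unfolding comp_def real_norm_def abs_less_iff abs_le_iff by linarith
      qed
      then show "\<exists>M. \<forall>m\<ge>M. \<forall>n\<ge>M. norm (g ((x \<circ> diagseq) m) - g ((x \<circ> diagseq) n)) < \<epsilon>" by blast
    qed
  qed
  then show "\<exists>r. strict_mono r \<and> weakly_Cauchy (x \<circ> r)" using subseq_diagseq by blast
qed

section \<open>Weak precompactness under bounded operators\<close>

lemma weakly_precompact_operator_of_cball:
  fixes T :: "'a::real_normed_vector \<Rightarrow> 'b::real_normed_vector"
  assumes T: "bounded_linear T" and wp: "weakly_precompact (T ` cball 0 1)"
  shows "weakly_precompact_operator T"
  unfolding weakly_precompact_operator_def weakly_precompact_def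
proof (intro conjI allI impI T)
  fix A :: "'a set" assume A: "bounded A"
  show "bounded (T ` A)" by (rule bounded_linear_image[OF A T])
  fix y :: "nat \<Rightarrow> 'b" assume "\<forall>n. y n \<in> T ` A"
  then obtain a where a: "\<And>n. a n \<in> A" "\<And>n. y n = T (a n)" unfolding image_iff by metis
  obtain C where C: "0 < C" "\<And>z. z \<in> A \<Longrightarrow> norm z \<le> C" using A unfolding bounded_pos by blast
  have "T ((1 / C) *\<^sub>R a n) \<in> T ` cball 0 1" for n
    using C(1) C(2)[OF a(1), of n] by (intro imageI) (simp add: field_simps)
  then obtain r where r: "strict_mono r" "weakly_Cauchy ((\<lambda>n. T ((1 / C) *\<^sub>R a n)) \<circ> r)"
    using wp unfolding weakly_precompact_def by metis
  have "weakly_Cauchy (y \<circ> r)"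
    unfolding weakly_Cauchy_def
  proof (intro allI impI)
    fix g :: "'b \<Rightarrow> real" assume g: "bounded_linear g"
    then have "bounded_linear (\<lambda>z. C * g z)" by (rule bounded_linear_const_mult)
    then have "Cauchy (\<lambda>n. C * g (T ((1 / C) *\<^sub>R a (r n))))"
      using r(2) unfolding weakly_Cauchy_def comp_def by blast
    moreover have "C * g (T ((1 / C) *\<^sub>R a (r n))) = g (y (r n))" for n
      using C(1) by (simp add: a(2) linear_scale[OF bounded_linear.linear[OF T]] linear_scale[OF bounded_linear.linear[OF g]])
    ultimately show "Cauchy (\<lambda>n. g ((y \<circ> r) n))" by simp
  qed
  with r(1) show "\<exists>r. strict_mono r \<and> weakly_Cauchy (y \<circ> r)" by blast
qed

lemma weakly_precompact_image:
  fixes T :: "'a::real_normed_vector \<Rightarrow> 'b::real_normed_vector"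
  assumes T: "bounded_linear T" and wp: "weakly_precompact A"
  shows "weakly_precompact (T ` A)"
  unfolding weakly_precompact_def
proof (intro conjI allI impI)
  show "bounded (T ` A)" using wp by (intro bounded_linear_image[OF _ T]) (simp add: weakly_precompact_def)
  fix y :: "nat \<Rightarrow> 'b" assume "\<forall>n. y n \<in> T ` A"
  then obtain a where a: "\<And>n. a n \<in> A" "\<And>n. y n = T (a n)" unfolding image_iff by metis
  obtain r where r: "strict_mono r" "weakly_Cauchy (a \<circ> r)"
    using wp a(1) unfolding weakly_precompact_def by blast
  have "weakly_Cauchy (y \<circ> r)"
    using r(2) bounded_linear_compose[OF _ T] unfolding weakly_Cauchy_def comp_def a(2) by blast
  with r(1) show "\<exists>r. strict_mono r \<and> weakly_Cauchy (y \<circ> r)" by blast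
qed

section \<open>Disjoint sequences and order continuity\<close>

text \<open>An instance of distributivity, derived from the group structure: with
  \<open>t = inf a b\<close>, both \<open>pprt a\<close> and \<open>pprt b\<close> exceed
  \<open>pprt t\<close> by at most \<open>pprt (a - b)\<close> and \<open>pprt (b - a)\<close>,
  which are disjoint.\<close>

lemma pprt_inf_le:
  fixes a b :: "'a::banach_lattice"
  shows "inf (pprt a) (pprt b) \<le> pprt (inf a b)"
proof -
  define t where "t = inf a b"
  have eq: "c - inf c d = pprt (c - d)" for c d :: 'a
    unfolding pprt_def diff_inf_eq_sup by (simp add: add_sup_distrib_left sup_commute)
  have a: "pprt (a - b) + t = a" using diff_add_cancel[of a t] unfolding t_def eq .
  have b: "pprt (b - a) + t = b" using diff_add_cancel[of b t] unfolding t_def inf_commute[of a b] eq .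
  have "pprt a \<le> pprt t + pprt (a - b)"
    using pprt_add_le[of "pprt (a - b)" t, unfolded a] by (simp add: add.commute)
  moreover have "pprt b \<le> pprt t + pprt (b - a)"
    using pprt_add_le[of "pprt (b - a)" t, unfolded b] by (simp add: add.commute)
  ultimately have "inf (pprt a) (pprt b) \<le> inf (pprt t + pprt (a - b)) (pprt t + pprt (b - a))"
    by (rule inf_mono)
  also have "\<dots> = pprt t + inf (pprt (a - b)) (pprt (b - a))" by (rule add_inf_distrib_left[symmetric])
  also have "\<dots> = pprt t" by (simp only: disjoint_pprt_diff add_0_right)
  finally show ?thesis unfolding t_def .
qed

text \<open>Replaces a common lower bound of positive parts by one of the elements themselves, which
  can then be summed over \<open>I\<close>.\<close>

lemma lower_bound_of_pprts:
  fixes y :: "nat \<Rightarrow> 'a::banach_lattice"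
  assumes "finite I" "I \<noteq> {}" "\<And>i. i \<in> I \<Longrightarrow> z \<le> pprt (y i)"
  obtains t where "\<And>i. i \<in> I \<Longrightarrow> t \<le> y i" "z \<le> pprt t"
proof -
  have "\<exists>t. (\<forall>i\<in>I. t \<le> y i) \<and> z \<le> pprt t"
    using assms
  proof (induction I rule: finite_ne_induct)
    case (singleton i)
    then show ?case by (intro exI[of _ "y i"]) simp
  next
    case (insert i I)
    then obtain t where t: "\<forall>i\<in>I. t \<le> y i" "z \<le> pprt t" by auto
    have "z \<le> inf (pprt t) (pprt (y i))" using t(2) insert.prems by (intro inf_greatest) simp_all
    also have "\<dots> \<le> pprt (inf t (y i))" by (rule pprt_inf_le)
    finally show ?case using t(1) by (intro exI[of _ "inf t (y i)"]) (auto intro: le_infI1)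
  qed
  then show ?thesis using that by blast
qed

lemma not_null_subseq:
  fixes v :: "nat \<Rightarrow> 'a::real_normed_vector"
  assumes "\<not> v \<longlonglongrightarrow> 0"
  shows "\<exists>\<delta>>0. \<exists>s :: nat \<Rightarrow> nat. strict_mono s \<and> (\<forall>n. \<delta> \<le> norm (v (s n)))"
proof -
  obtain \<delta> where \<delta>: "0 < \<delta>" "\<And>N. \<exists>n\<ge>N. \<delta> \<le> norm (v n)"
    using assms unfolding LIMSEQ_def dist_norm by (metis diff_zero not_less)
  then have "infinite {n. \<delta> \<le> norm (v n)}" unfolding infinite_nat_iff_unbounded_le by blast
  from infinite_enumerate[OF this] obtain s :: "nat \<Rightarrow> nat"
    where "strict_mono s" "\<forall>n. s n \<in> {n. \<delta> \<le> norm (v n)}" by blast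
  with \<delta>(1) show ?thesis by (intro exI[of _ \<delta>] exI[of _ s] conjI) auto
qed

text \<open>
  A sequence in \<open>[0, u]\<close> in which any \<open>m\<close> terms have infimum zero is a norm null sequence, provided
  this is so for \<open>m = 2\<close>. In the induction step the infima with a fixed term form a sequence of
  overlap \<open>m - 1\<close>, so along a subsequence all pairwise infima are small and can be subtracted.
\<close>

lemma overlap_null:
  fixes u :: "'a::banach_lattice"
  assumes H: "\<And>w. disjoint_seq w \<Longrightarrow> (\<And>n. 0 \<le> w n) \<Longrightarrow> (\<And>n. w n \<le> u) \<Longrightarrow> w \<longlonglongrightarrow> 0"
    and v: "\<And>n. 0 \<le> v n" "\<And>n. v n \<le> u"
    and ov: "\<And>I z. finite I \<Longrightarrow> card I = m \<Longrightarrow> (\<And>i. i \<in> I \<Longrightarrow> z \<le> v i) \<Longrightarrow> z \<le> 0"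
  shows "v \<longlonglongrightarrow> 0"
  using v ov
proof (induction m arbitrary: v)
  case 0
  have "v n \<le> 0" for n by (rule "0.prems"(3)[of "{}"]) auto
  then have "v = (\<lambda>n. 0)" using "0.prems"(1) by (intro ext order.antisym)
  then show ?case by simp
next
  case (Suc m)
  show ?case
  proof (rule ccontr)
    assume "\<not> v \<longlonglongrightarrow> 0"
    from not_null_subseq[OF this] obtain \<delta> and s :: "nat \<Rightarrow> nat"
      where \<delta>: "0 < \<delta>" and s: "strict_mono s" "\<And>n. \<delta> \<le> norm (v (s n))"
      by blast
    have ov': "z \<le> 0" if "finite I" "card I = Suc m" "\<And>i. i \<in> I \<Longrightarrow> z \<le> v (s i)" for I z
    proof (rule Suc.prems(3))
      show "finite (s ` I)" using that(1) by simp
      show "card (s ` I) = Suc m"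
        using that(2) card_image[OF strict_mono_imp_inj_on[OF s(1), of I]] by simp
      show "z \<le> v i" if "i \<in> s ` I" for i using that \<open>\<And>i. i \<in> I \<Longrightarrow> z \<le> v (s i)\<close> by auto
    qed
    have pair: "(\<lambda>j. inf (v (s i)) (v (s j))) \<longlonglongrightarrow> 0" for i
    proof -
      \<comment> \<open>Only indices beyond \<open>i\<close> occur, so adding \<open>i\<close> to
        the shifted set raises its cardinality to \<open>Suc m\<close>.\<close>
      have "(\<lambda>j. inf (v (s i)) (v (s (j + Suc i)))) \<longlonglongrightarrow> 0"
      proof (rule Suc.IH)
        show "0 \<le> inf (v (s i)) (v (s (j + Suc i)))" for j by (intro inf_greatest Suc.prems(1))
        show "inf (v (s i)) (v (s (j + Suc i))) \<le> u" for j by (intro le_infI1 Suc.prems(2))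
        fix I z assume I: "finite I" "card I = m" and z: "\<And>j. j \<in> I \<Longrightarrow> z \<le> inf (v (s i)) (v (s (j + Suc i)))"
        show "z \<le> 0"
        proof (cases "m = 0")
          \<comment> \<open>For empty \<open>I\<close> nothing bounds \<open>z\<close>; but then the
            overlap condition for single terms makes them vanish, contrary to their norm being at
            least \<open>\<delta>\<close>.\<close>
          case True
          have "pprt z \<le> 0"
          proof -
            have "v (s i) \<le> 0" if "m = 0" for i
              by (rule ov'[of "{i}"]) (use that in auto)
            then have v0: "v (s i) = 0" for i using True Suc.prems(1) by (intro order.antisym) auto
            with s(2)[of 0] \<delta> show ?thesis by simp
          qed
          then show ?thesis unfolding pprt_def by (rule order_trans[OF sup_ge1])
        next
          case False
          show ?thesis
          proof (rule ov'[of "insert i ((\<lambda>j. j + Suc i) ` I)"])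
            show "finite (insert i ((\<lambda>j. j + Suc i) ` I))" using I(1) by simp
            have "card ((\<lambda>j. j + Suc i) ` I) = m" using I(2) by (subst card_image) (auto intro: inj_onI)
            moreover have "i \<notin> (\<lambda>j. j + Suc i) ` I" by auto
            ultimately show "card (insert i ((\<lambda>j. j + Suc i) ` I)) = Suc m" using I(1) by simp
            obtain j0 where "j0 \<in> I" using False I by fastforce
            then have "z \<le> v (s i)" using z le_infE by blast
            moreover have "z \<le> v (s (j + Suc i))" if "j \<in> I" for j using z[OF that] le_infE by blast
            ultimately show "z \<le> v (s k)" if "k \<in> insert i ((\<lambda>j. j + Suc i) ` I)" for k
              using that by auto
          qed
        qed
      qed
      then show ?thesis by (rule LIMSEQ_offset)
    qed
    have "\<exists>N. \<forall>i\<le>n. \<forall>j\<ge>N. norm (inf (v (s i)) (v (s j))) \<le> \<epsilon>" if "0 < \<epsilon>" for n :: nat and \<epsilon>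
    proof -
      have "\<forall>\<^sub>F j in sequentially. norm (inf (v (s i)) (v (s j))) < \<epsilon>" for i
        using pair[of i] that by (simp add: tendsto_iff dist_norm)
      then have "\<forall>\<^sub>F j in sequentially. \<forall>i\<in>{..n}. norm (inf (v (s i)) (v (s j))) < \<epsilon>"
        by (intro eventually_ball_finite) auto
      then show ?thesis unfolding eventually_sequentially by (meson atMost_iff less_imp_le)
    qed
    then have "\<forall>n \<epsilon>. \<exists>N. 0 < \<epsilon> \<longrightarrow> (\<forall>i\<le>n. \<forall>j\<ge>N. norm (inf (v (s i)) (v (s j))) \<le> \<epsilon>)" by blast
    then obtain N where N': "\<And>n \<epsilon>. 0 < \<epsilon> \<longrightarrow> (\<forall>i\<le>n. \<forall>j\<ge>N n \<epsilon>. norm (inf (v (s i)) (v (s j))) \<le> \<epsilon>)"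
      by metis
    have N: "norm (inf (v (s i)) (v (s j))) \<le> \<epsilon>" if "0 < \<epsilon>" "i \<le> n" "N n \<epsilon> \<le> j" for n \<epsilon> i j
      using N' that by blast
    \<comment> \<open>Indices so sparse that the infima of a new term with all earlier ones are
      geometrically small; for each term these infima then add up to norm at most
      \<open>\<delta> / 4\<close>.\<close>
    define r where "r = rec_nat 0 (\<lambda>k n. max (Suc n) (N n (\<delta> / 8 * (1 / 4) ^ Suc k)))"
    have r: "r (Suc k) = max (Suc (r k)) (N (r k) (\<delta> / 8 * (1 / 4) ^ Suc k))" for k by (simp add: r_def)
    have rmono: "strict_mono r" by (rule strict_monoI_Suc) (simp add: r)
    define x where "x k = v (s (r k))" for k
    have x: "0 \<le> x k" "x k \<le> u" "\<delta> \<le> norm (x k)" for k using Suc.prems s(2) by (auto simp: x_def)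
    have small: "norm (inf (x i) (x j)) \<le> \<delta> / 8 * (1 / 2) ^ j" if ij: "i < j" for i j
    proof -
      obtain k where k: "j = Suc k" using ij by (cases j) auto
      have "norm (inf (x i) (x j)) \<le> \<delta> / 8 * (1 / 4) ^ j"
        unfolding x_def
      proof (rule N[of _ _ "r k"])
        show "0 < \<delta> / 8 * (1 / 4) ^ j" using \<delta> by simp
        show "r i \<le> r k" using ij k strict_mono_less_eq[OF rmono] by simp
        show "N (r k) (\<delta> / 8 * (1 / 4) ^ j) \<le> r j" by (simp add: k r)
      qed
      also have "\<dots> \<le> \<delta> / 8 * (1 / 2) ^ j" using \<delta> by (intro mult_left_mono power_mono) auto
      finally show ?thesis .
    qed
    define q where "q i j = (if j = i then 0 else inf (x i) (x j))" for i j
    have q0: "0 \<le> q i j" for i j using x(1) by (simp add: q_def)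
    have qn: "norm (q i j) \<le> \<delta> / 8 * (1 / 2) ^ j" for i j
    proof (cases i j rule: linorder_cases)
      case less then show ?thesis using small by (simp add: q_def)
    next
      case equal then show ?thesis using \<delta> by (simp add: q_def)
    next
      case greater
      have "norm (q i j) \<le> \<delta> / 8 * (1 / 2) ^ i" using small[OF greater] greater by (simp add: q_def inf_commute)
      also have "\<dots> \<le> \<delta> / 8 * (1 / 2) ^ j"
        using greater \<delta> by (intro mult_left_mono power_decreasing) auto
      finally show ?thesis .
    qed
    have geo: "summable (\<lambda>j. \<delta> / 8 * (1 / 2 :: real) ^ j)" by (intro summable_mult summable_geometric) simp
    have sumq: "summable (q i)" for i by (rule summable_comparison_test'[OF geo, of 0]) (rule qn)
    have "norm (suminf (q i)) \<le> (\<Sum>j. \<delta> / 8 * (1 / 2) ^ j)" for i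
      by (rule norm_suminf_le[OF qn geo])
    also have "(\<Sum>j. \<delta> / 8 * (1 / 2 :: real) ^ j) = \<delta> / 4"
      using suminf_mult[OF summable_geometric[of "1 / 2 :: real"], of "\<delta> / 8"] suminf_geometric[of "1 / 2 :: real"] by simp
    finally have Rn: "norm (suminf (q i)) \<le> \<delta> / 4" for i .
    \<comment> \<open>Subtracting all infima at once puts \<open>w i\<close> below
      \<open>pprt (x i - x j)\<close> for every other \<open>j\<close>. This makes the
      \<open>w i\<close> pairwise disjoint and costs at most \<open>\<delta> / 4\<close> in
      norm.\<close>
    define w where "w i = pprt (x i - suminf (q i))" for i
    have w_le: "w i \<le> pprt (x i - x j)" if "i \<noteq> j" for i j
    proof -
      have "inf (x i) (x j) \<le> suminf (q i)"
        using term_le_suminf_lattice[OF sumq q0, of i j] that[symmetric] by (simp only: q_def[of i j] if_False)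
      then have "x i - suminf (q i) \<le> x i - inf (x i) (x j)" by (rule diff_left_mono)
      also have "\<dots> = pprt (x i - x j)"
        unfolding pprt_def diff_inf_eq_sup by (simp add: add_sup_distrib_left sup_commute)
      finally have "w i \<le> pprt (pprt (x i - x j))" unfolding w_def by (rule pprt_mono)
      then show ?thesis by simp
    qed
    have w0: "0 \<le> w i" for i by (simp add: w_def)
    have "w \<longlonglongrightarrow> 0"
    proof (rule H[OF _ w0])
      have "inf (w i) (w j) = 0" if "i \<noteq> j" for i j
        by (rule disjoint_mono[OF disjoint_pprt_diff w0 w_le[OF that] w0 w_le[OF that[symmetric]]])
      then show "disjoint_seq w" by (simp add: disjoint_seq_def abs_of_nonneg w0)
      have "0 \<le> suminf (q i)" for i by (rule suminf_nonneg_lattice[OF sumq q0])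
      then have "x i - suminf (q i) \<le> x i" for i by (simp add: diff_le_eq)
      from pprt_mono[OF this] have "w i \<le> x i" for i using x(1) by (simp add: w_def)
      then show "w i \<le> u" for i using x(2) by (rule order_trans)
    qed
    moreover have "\<delta> / 2 \<le> norm (w i)" for i
    proof -
      have "x i - suminf (q i) \<le> w i" by (simp add: w_def pprt_def)
      then have "x i \<le> w i + suminf (q i)" by (simp only: diff_le_eq)
      then have "norm (x i) \<le> norm (w i + suminf (q i))" by (rule norm_mono_nonneg[OF x(1)])
      also have "\<dots> \<le> norm (w i) + norm (suminf (q i))" by (rule norm_triangle_ineq)
      finally show ?thesis using x(3)[of i] Rn[of i] \<delta> by linarith
    qed
    ultimately have "\<delta> / 2 \<le> norm (0::'a)"
      by (intro LIMSEQ_le_const[OF tendsto_norm]) auto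
    with \<delta> show False by simp
  qed
qed

text \<open>The excesses of the \<open>d n\<close> over \<open>\<eta> *\<^sub>R u\<close> have
  bounded overlap: a common lower bound \<open>t\<close> of \<open>m\<close> differences
  \<open>d i - \<eta> *\<^sub>R u\<close> satisfies \<open>real m *\<^sub>R t \<le> u - u\<close> as
  soon as \<open>m * \<eta>\<close> is at least 1. So the excesses tend to zero, and the rest has
  norm at most \<open>\<eta> * norm u\<close>.\<close>

lemma increments_null:
  fixes u :: "'a::banach_lattice"
  assumes H: "\<And>w. disjoint_seq w \<Longrightarrow> (\<And>n. 0 \<le> w n) \<Longrightarrow> (\<And>n. w n \<le> u) \<Longrightarrow> w \<longlonglongrightarrow> 0"
    and d: "\<And>n. 0 \<le> d n" and du: "\<And>n. (\<Sum>i<n. d i) \<le> u"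
  shows "d \<longlonglongrightarrow> 0"
proof (rule LIMSEQ_I)
  fix \<epsilon> :: real assume \<epsilon>: "0 < \<epsilon>"
  have u0: "0 \<le> u" using du[of 0] by simp
  define \<eta> where "\<eta> = \<epsilon> / (2 * (norm u + 1))"
  have \<eta>: "0 < \<eta>" using \<epsilon> norm_ge_zero[of u] by (simp add: \<eta>_def add_nonneg_pos)
  have \<eta>u0: "0 \<le> \<eta> *\<^sub>R u" using \<eta> u0 by (intro scaleR_nonneg_nonneg) auto
  define v where "v n = pprt (d n - \<eta> *\<^sub>R u)" for n
  obtain m :: nat where "1 / \<eta> < real m" using reals_Archimedean2 by blast
  then have m: "1 \<le> real m * \<eta>" and m0: "0 < m" using \<eta>
    by (simp_all add: divide_less_eq less_imp_le) (metis gr0I less_asym mult_zero_left of_nat_0 zero_less_one)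
  have "v \<longlonglongrightarrow> 0"
  proof (rule overlap_null[where u = u and m = m, OF H])
    show "0 \<le> v n" for n by (simp add: v_def)
    fix n
    have "d n - \<eta> *\<^sub>R u \<le> d n" using \<eta>u0 by (simp add: diff_le_eq)
    from pprt_mono[OF this] have "v n \<le> d n" by (simp add: v_def d)
    also have "\<dots> \<le> (\<Sum>i<Suc n. d i)" by (simp add: sum_nonneg d)
    also have "\<dots> \<le> u" by (rule du)
    finally show "v n \<le> u" .
  next
    fix I z assume I: "finite I" "card I = m" and z: "\<And>i. i \<in> I \<Longrightarrow> z \<le> v i"
    have "I \<noteq> {}" using I m0 by auto
    then obtain t where t: "\<And>i. i \<in> I \<Longrightarrow> t \<le> d i - \<eta> *\<^sub>R u" "z \<le> pprt t"
      using lower_bound_of_pprts[OF I(1), of z "\<lambda>i. d i - \<eta> *\<^sub>R u"] z unfolding v_def by blast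
    obtain K where K: "I \<subseteq> {..<K}" using finite_nat_iff_bounded I(1) by blast
    have "real m *\<^sub>R t = (\<Sum>i\<in>I. t)" by (simp add: I(2) sum_constant_scaleR)
    also have "\<dots> \<le> (\<Sum>i\<in>I. d i - \<eta> *\<^sub>R u)" by (rule sum_mono) (rule t(1))
    also have "\<dots> = (\<Sum>i\<in>I. d i) - real m *\<^sub>R \<eta> *\<^sub>R u"
      by (simp add: sum_subtractf I(2) sum_constant_scaleR)
    also have "\<dots> \<le> u - 1 *\<^sub>R u"
    proof (rule diff_mono)
      have "(\<Sum>i\<in>I. d i) \<le> (\<Sum>i<K. d i)" by (rule sum_mono2) (use K d in auto)
      then show "(\<Sum>i\<in>I. d i) \<le> u" using du by (rule order_trans)
      show "1 *\<^sub>R u \<le> real m *\<^sub>R \<eta> *\<^sub>R u"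
        unfolding scaleR_scaleR by (rule scaleR_right_mono[OF m u0])
    qed
    finally have "real m *\<^sub>R t \<le> 0" by simp
    then have "inverse (real m) *\<^sub>R (real m *\<^sub>R t) \<le> inverse (real m) *\<^sub>R 0" by (rule scaleR_left_mono) simp
    then have "t \<le> 0" using m0 by simp
    then have "pprt t = 0" by (rule pprt_eq_0)
    with t(2) show "z \<le> 0" by simp
  qed
  then obtain K where K: "\<And>n. n \<ge> K \<Longrightarrow> norm (v n) < \<epsilon> / 2"
    using LIMSEQ_D[of v 0 "\<epsilon> / 2"] \<epsilon> by auto
  have "norm (d n - 0) < \<epsilon>" if "n \<ge> K" for n
  proof -
    have "d n - \<eta> *\<^sub>R u \<le> v n" by (simp add: v_def pprt_def)
    then have "d n \<le> v n + \<eta> *\<^sub>R u" by (simp only: diff_le_eq)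
    then have "norm (d n) \<le> norm (v n + \<eta> *\<^sub>R u)" by (rule norm_mono_nonneg[OF d])
    also have "\<dots> \<le> norm (v n) + \<eta> * norm u" using norm_triangle_ineq[of "v n" "\<eta> *\<^sub>R u"] \<eta> by simp
    also have "\<eta> * norm u \<le> \<eta> * (norm u + 1)" using \<eta> by (intro mult_left_mono) simp_all
    also have "\<eta> * (norm u + 1) = \<epsilon> / 2"
      using norm_ge_zero[of u] by (simp add: \<eta>_def field_simps add_nonneg_eq_0_iff)
    finally show ?thesis using K[OF that] by simp
  qed
  then show "\<exists>no. \<forall>n\<ge>no. norm (d n - 0) < \<epsilon>" by blast
qed

text \<open>A directed set \<open>D\<close> that is not Cauchy contains a decreasing sequence with
  increments of norm above some \<open>\<eta>\<close>, whose sums stay below its first member; this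
  contradicts \<open>increments_null\<close>. Hence \<open>D\<close> has a norm limit, which is a
  lower bound of \<open>D\<close> and so must be zero.\<close>

theorem order_continuous_of_disjoint_null:
  assumes H: "\<And>u w. disjoint_seq w \<Longrightarrow> (\<And>n. 0 \<le> w n) \<Longrightarrow> (\<And>n. w n \<le> (u::'a::banach_lattice)) \<Longrightarrow> w \<longlonglongrightarrow> 0"
  shows "order_continuous_norm TYPE('a)"
  unfolding order_continuous_norm_def
proof (intro allI impI)
  fix D :: "'a set" and e :: real
  assume D: "D \<noteq> {} \<and> (\<forall>x\<in>D. \<forall>y\<in>D. \<exists>z\<in>D. z \<le> x \<and> z \<le> y) \<and> isGlb UNIV D 0" and e: "0 < e"
  have dir: "\<exists>z\<in>D. z \<le> x \<and> z \<le> y" if "x \<in> D" "y \<in> D" for x y using D that by blast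
  have D0: "0 \<le> x" if "x \<in> D" for x using D that isGlbD2 by blast
  have glb: "y \<le> 0" if "\<And>x. x \<in> D \<Longrightarrow> y \<le> x" for y
    using D that isGlb_le_isLb[of UNIV D 0 y] by (simp add: isLb_def setge_def)
  have tail: "\<exists>d\<in>D. \<forall>x\<in>D. x \<le> d \<longrightarrow> norm (d - x) \<le> \<eta>" if \<eta>: "0 < \<eta>" for \<eta>
  proof (rule ccontr)
    assume "\<not> ?thesis"
    then have "\<forall>d\<in>D. \<exists>x\<in>D. x \<le> d \<and> \<eta> < norm (d - x)" by (meson not_le)
    then obtain p where p: "\<And>d. d \<in> D \<Longrightarrow> p d \<in> D \<and> p d \<le> d \<and> \<eta> < norm (d - p d)" by metis
    obtain d0 where d0: "d0 \<in> D" using D by blast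
    define x where "x n = (p ^^ n) d0" for n
    have x: "x n \<in> D" for n by (induction n) (simp_all add: x_def d0 p)
    have xS: "x (Suc n) = p (x n)" for n by (simp add: x_def)
    have tel: "(\<Sum>i<n. x i - x (Suc i)) = x 0 - x n" for n by (induction n) simp_all
    have "(\<lambda>n. x n - x (Suc n)) \<longlonglongrightarrow> 0"
    proof (rule increments_null[where u = "x 0", OF H])
      show "0 \<le> x n - x (Suc n)" for n using p[OF x, of n] by (simp add: xS)
      show "(\<Sum>i<n. x i - x (Suc i)) \<le> x 0" for n unfolding tel using D0[OF x, of n] by (simp add: diff_le_eq)
    qed
    then have "\<eta> \<le> norm (0::'a)"
      by (intro LIMSEQ_le_const[OF tendsto_norm]) (use p[OF x] xS in \<open>auto intro!: less_imp_le\<close>)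
    with \<eta> show False by simp
  qed
  have "\<forall>n. \<exists>d\<in>D. \<forall>x\<in>D. x \<le> d \<longrightarrow> norm (d - x) \<le> (1 / 2) ^ n" by (intro allI tail) simp
  then obtain c where c: "\<And>n. c n \<in> D" "\<And>n x. x \<in> D \<Longrightarrow> x \<le> c n \<Longrightarrow> norm (c n - x) \<le> (1 / 2) ^ n" by metis
  obtain b where b: "\<And>x y. x \<in> D \<Longrightarrow> y \<in> D \<Longrightarrow> b x y \<in> D \<and> b x y \<le> x \<and> b x y \<le> y"
    using dir by metis
  define d where "d = rec_nat (c 0) (\<lambda>n x. b x (c (Suc n)))"
  have d: "d 0 = c 0" "\<And>n. d (Suc n) = b (d n) (c (Suc n))" by (simp_all add: d_def)
  have dD: "d n \<in> D" for n by (induction n) (simp_all add: d c b)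
  have dc: "d n \<le> c n" for n by (cases n) (simp_all add: d b c dD)
  have ddec: "decseq d" by (rule decseq_SucI) (simp add: d b c dD)
  have dtail: "norm (d n - x) \<le> (1 / 2) ^ n" if "x \<in> D" "x \<le> d n" for n x
  proof -
    have "norm (d n - x) \<le> norm (c n - x)"
      by (rule norm_mono_nonneg) (simp add: that, rule diff_right_mono[OF dc])
    also have "\<dots> \<le> (1 / 2) ^ n" using that dc[of n] by (intro c(2)) (auto intro: order_trans)
    finally show ?thesis .
  qed
  have half: "(\<lambda>n. (1 / 2 :: real) ^ n) \<longlonglongrightarrow> 0" by (rule LIMSEQ_power_zero) simp
  have "Cauchy d"
  proof (rule CauchyI)
    fix \<epsilon> :: real assume "0 < \<epsilon>"
    then obtain N where N: "(1 / 2 :: real) ^ N < \<epsilon> / 2"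
      using real_arch_pow_inv[of "\<epsilon> / 2" "1 / 2"] by auto
    have "norm (d m - d n) < \<epsilon>" if "m \<ge> N" "n \<ge> N" for m n
    proof -
      have "norm (d N - d m) \<le> (1 / 2) ^ N" "norm (d N - d n) \<le> (1 / 2) ^ N"
        using that by (auto intro!: dtail dD decseqD[OF ddec])
      moreover have "d m - d n = (d N - d n) - (d N - d m)" by simp
      moreover have "norm ((d N - d n) - (d N - d m)) \<le> norm (d N - d n) + norm (d N - d m)"
        by (rule norm_triangle_ineq4)
      ultimately show ?thesis using N by (simp only:)
    qed
    then show "\<exists>M. \<forall>m\<ge>M. \<forall>n\<ge>M. norm (d m - d n) < \<epsilon>" by blast
  qed
  then obtain l where l: "d \<longlonglongrightarrow> l" using Cauchy_convergent_iff convergent_def by blast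
  have "l \<le> y" if y: "y \<in> D" for y
  proof -
    \<comment> \<open>A member of \<open>D\<close> below both \<open>y\<close> and
      \<open>d n\<close>: the tail estimate gives it the limit \<open>l\<close> of \<open>d\<close>,
      so \<open>l \<le> y\<close> also when \<open>y\<close> is not comparable to the
      sequence.\<close>
    define z where "z n = b y (d n)" for n
    have z: "z n \<in> D" "z n \<le> y" "z n \<le> d n" for n using b[OF y dD] by (auto simp: z_def)
    have "(\<lambda>n. d n - z n) \<longlonglongrightarrow> 0"
      by (rule Lim_null_comparison[OF _ half]) (simp add: dtail z)
    from tendsto_diff[OF l this] have "z \<longlonglongrightarrow> l" by simp
    then show ?thesis by (rule limit_le[OF _ tendsto_const]) (simp add: z)
  qed
  then have "l \<le> 0" by (rule glb)
  moreover have "0 \<le> l" by (rule limit_nonneg[OF l]) (simp add: D0 dD)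
  ultimately have "l = 0" by (rule order.antisym)
  then obtain n where n: "norm (d n) < e" using LIMSEQ_D[OF l e] by auto
  have "norm x < e" if "x \<in> D" "x \<le> d n" for x
    using norm_mono_nonneg[OF D0[OF that(1)] that(2)] n by simp
  then show "\<exists>d\<in>D. \<forall>x\<in>D. x \<le> d \<longrightarrow> norm x < e" using dD by blast
qed

lemma not_order_continuous_disjoint_seq:
  assumes "\<not> order_continuous_norm TYPE('a::banach_lattice)"
  obtains v and u :: "'a::banach_lattice" and \<delta> where "disjoint_seq v" "\<And>n. 0 \<le> v n" "\<And>n. v n \<le> u" "0 < \<delta>" "\<And>n. \<delta> \<le> norm (v n)"
proof -
  obtain u :: 'a and w where w: "disjoint_seq w" "\<And>n. 0 \<le> w n" "\<And>n. w n \<le> u" "\<not> w \<longlonglongrightarrow> 0"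
    using assms order_continuous_of_disjoint_null by metis
  from not_null_subseq[OF w(4)] obtain \<delta> and s :: "nat \<Rightarrow> nat"
    where \<delta>: "0 < \<delta>" and s: "strict_mono s" "\<And>n. \<delta> \<le> norm (w (s n))"
    by blast
  show ?thesis
  proof (rule that[of "w \<circ> s" u \<delta>])
    show "disjoint_seq (w \<circ> s)"
      using w(1) strict_mono_eq[OF s(1)] by (simp add: disjoint_seq_def)
  qed (use w s \<delta> in simp_all)
qed

section \<open>Order sums and the embedding of the bounded sequences\<close>

text \<open>By disjointness each further partial sum is the supremum of the previous one and the new
  term. The start index \<open>n\<close> serves \<open>rest_disjoint\<close>, where the bound for
  the first \<open>n\<close> terms is known for their sum.\<close>

lemma sum_disjoint_le:
  fixes v :: "nat \<Rightarrow> 'a::banach_lattice"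
  assumes dis: "disjoint_seq v" and v: "\<And>n. 0 \<le> v n"
    and n: "(\<Sum>i<n. v i) \<le> u" and u: "\<And>i. n \<le> i \<Longrightarrow> v i \<le> u" and "n \<le> m"
  shows "(\<Sum>i<m. v i) \<le> u"
  using \<open>n \<le> m\<close>
proof (induction m rule: dec_induct)
  case base show ?case by (rule n)
next
  case (step k)
  have "inf (v k) (v i) = 0" if "i < k" for i
    using dis that unfolding disjoint_seq_def by (metis abs_of_nonneg nat_less_le v)
  then have "inf (v k) (\<Sum>i<k. v i) = 0" by (intro disjoint_sum) (simp_all add: v)
  then have "(\<Sum>i<k. v i) + v k = sup (\<Sum>i<k. v i) (v k)"
    by (intro disjoint_add_eq_sup) (simp only: inf_commute)
  also have "\<dots> \<le> u" using step by (intro sup_least u) simp_all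
  finally show ?case by simp
qed

context
  fixes v :: "nat \<Rightarrow> 'a::banach_lattice" and V :: 'a
  assumes dis: "disjoint_seq v" and v: "\<And>n. 0 \<le> v n"
    and V: "isLub UNIV (range (\<lambda>n. \<Sum>i<n. v i)) V"
begin

lemma partial_sum_le: "(\<Sum>i<n. v i) \<le> V"
  using isLubD2[OF V] by blast

lemma total_least: "(\<And>n. (\<Sum>i<n. v i) \<le> b) \<Longrightarrow> V \<le> b"
  using isLub_le_isUb[OF V, of b] by (auto simp: isUb_def setle_def)

text \<open>
  Order convergence of the series is expressed by a regulator, a multiple of the remainder of \<open>V\<close>;
  this makes linearity and uniqueness of the order sum immediate.
\<close>

definition order_sum :: "(nat \<Rightarrow> real) \<Rightarrow> 'a \<Rightarrow> bool" where
  "order_sum a s \<longleftrightarrow> (\<exists>c. \<forall>n. \<bar>s - (\<Sum>i<n. a i *\<^sub>R v i)\<bar> \<le> c *\<^sub>R (V - (\<Sum>i<n. v i)))"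

lemma rest_nonneg: "0 \<le> V - (\<Sum>i<n. v i)"
  using partial_sum_le by simp

text \<open>A positive multiple of \<open>y\<close> below all remainders could be subtracted from
  the least upper bound \<open>V\<close>. Passing from \<open>c\<close> to \<open>max c 1\<close>
  makes the division possible.\<close>

lemma rest_inf_zero:
  assumes "\<And>n. y \<le> c *\<^sub>R (V - (\<Sum>i<n. v i))"
  shows "y \<le> 0"
proof -
  define k where "k = max c 1"
  have k: "0 < k" "c \<le> k" by (simp_all add: k_def)
  have "V \<le> V - inverse k *\<^sub>R y"
  proof (rule total_least)
    fix n
    have "y \<le> k *\<^sub>R (V - (\<Sum>i<n. v i))"
      using assms[of n] scaleR_right_mono[OF k(2) rest_nonneg] by (rule order_trans)
    then have "inverse k *\<^sub>R y \<le> inverse k *\<^sub>R k *\<^sub>R (V - (\<Sum>i<n. v i))"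
      by (rule scaleR_left_mono) (use k in simp)
    then have "inverse k *\<^sub>R y \<le> V - (\<Sum>i<n. v i)" using k by simp
    then show "(\<Sum>i<n. v i) \<le> V - inverse k *\<^sub>R y" by (simp only: le_diff_eq add.commute)
  qed
  then have "inverse k *\<^sub>R y \<le> 0" by simp
  then have "k *\<^sub>R inverse k *\<^sub>R y \<le> k *\<^sub>R 0" by (rule scaleR_left_mono) (use k in simp)
  then show ?thesis using k by simp
qed

lemma order_sum_unique:
  assumes "order_sum a s" "order_sum a t"
  shows "s = t"
proof -
  obtain c where c: "\<And>n. \<bar>s - (\<Sum>i<n. a i *\<^sub>R v i)\<bar> \<le> c *\<^sub>R (V - (\<Sum>i<n. v i))"
    using assms(1) by (auto simp: order_sum_def)
  obtain d where d: "\<And>n. \<bar>t - (\<Sum>i<n. a i *\<^sub>R v i)\<bar> \<le> d *\<^sub>R (V - (\<Sum>i<n. v i))"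
    using assms(2) by (auto simp: order_sum_def)
  have "\<bar>s - t\<bar> \<le> (c + d) *\<^sub>R (V - (\<Sum>i<n. v i))" for n
  proof -
    have "\<bar>s - t\<bar> = \<bar>(s - (\<Sum>i<n. a i *\<^sub>R v i)) - (t - (\<Sum>i<n. a i *\<^sub>R v i))\<bar>" by simp
    also have "\<dots> \<le> \<bar>s - (\<Sum>i<n. a i *\<^sub>R v i)\<bar> + \<bar>t - (\<Sum>i<n. a i *\<^sub>R v i)\<bar>" by (rule abs_triangle_ineq4)
    also have "\<dots> \<le> (c + d) *\<^sub>R (V - (\<Sum>i<n. v i))"
      unfolding scaleR_left_distrib by (rule add_mono[OF c d])
    finally show ?thesis .
  qed
  then have "\<bar>s - t\<bar> \<le> 0" by (rule rest_inf_zero)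
  then have "\<bar>s - t\<bar> = 0" using abs_ge_zero by (rule order.antisym)
  then show ?thesis by simp
qed

lemma order_sum_add:
  assumes "order_sum a s" "order_sum b t"
  shows "order_sum (\<lambda>i. a i + b i) (s + t)"
proof -
  obtain c where c: "\<And>n. \<bar>s - (\<Sum>i<n. a i *\<^sub>R v i)\<bar> \<le> c *\<^sub>R (V - (\<Sum>i<n. v i))"
    using assms(1) by (auto simp: order_sum_def)
  obtain d where d: "\<And>n. \<bar>t - (\<Sum>i<n. b i *\<^sub>R v i)\<bar> \<le> d *\<^sub>R (V - (\<Sum>i<n. v i))"
    using assms(2) by (auto simp: order_sum_def)
  have "\<bar>s + t - (\<Sum>i<n. (a i + b i) *\<^sub>R v i)\<bar> \<le> (c + d) *\<^sub>R (V - (\<Sum>i<n. v i))" for n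
  proof -
    have "s + t - (\<Sum>i<n. (a i + b i) *\<^sub>R v i) = (s - (\<Sum>i<n. a i *\<^sub>R v i)) + (t - (\<Sum>i<n. b i *\<^sub>R v i))"
      by (simp only: scaleR_left_distrib sum.distrib add_diff_add)
    also have "\<bar>\<dots>\<bar> \<le> \<bar>s - (\<Sum>i<n. a i *\<^sub>R v i)\<bar> + \<bar>t - (\<Sum>i<n. b i *\<^sub>R v i)\<bar>" by (rule abs_triangle_ineq)
    also have "\<dots> \<le> (c + d) *\<^sub>R (V - (\<Sum>i<n. v i))"
      unfolding scaleR_left_distrib by (rule add_mono[OF c d])
    finally show ?thesis .
  qed
  then show ?thesis unfolding order_sum_def by blast
qed

lemma order_sum_scale:
  assumes "order_sum a s"
  shows "order_sum (\<lambda>i. k * a i) (k *\<^sub>R s)"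
proof -
  obtain c where c: "\<And>n. \<bar>s - (\<Sum>i<n. a i *\<^sub>R v i)\<bar> \<le> c *\<^sub>R (V - (\<Sum>i<n. v i))"
    using assms by (auto simp: order_sum_def)
  have "\<bar>k *\<^sub>R s - (\<Sum>i<n. (k * a i) *\<^sub>R v i)\<bar> \<le> (\<bar>k\<bar> * c) *\<^sub>R (V - (\<Sum>i<n. v i))" for n
  proof -
    have "k *\<^sub>R s - (\<Sum>i<n. (k * a i) *\<^sub>R v i) = k *\<^sub>R (s - (\<Sum>i<n. a i *\<^sub>R v i))"
      by (simp only: scaleR_scaleR[symmetric] scaleR_sum_right scaleR_diff_right)
    then show ?thesis
      using scaleR_left_mono[OF c[of n], of "\<bar>k\<bar>"] by (simp only: lattice_abs_scaleR scaleR_scaleR[symmetric] abs_ge_zero)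
  qed
  then show ?thesis unfolding order_sum_def by blast
qed

text \<open>Let \<open>t\<close> be the infimum. Then \<open>V - t\<close> still bounds all partial
  sums: the first \<open>n\<close> terms because \<open>t\<close> is below the remainder, a later
  \<open>v k\<close> because \<open>v k + t \<le> v k + v i \<le> V\<close>. Leastness of
  \<open>V\<close> gives \<open>t \<le> 0\<close>.\<close>

lemma rest_disjoint:
  assumes "i < n"
  shows "inf (v i) (V - (\<Sum>j<n. v j)) = 0"
proof -
  define t where "t = inf (v i) (V - (\<Sum>j<n. v j))"
  have ti: "t \<le> v i" and tr: "t \<le> V - (\<Sum>j<n. v j)" by (simp_all add: t_def)
  have n: "(\<Sum>j<n. v j) \<le> V - t" using tr by (simp only: le_diff_eq add.commute)
  have "(\<Sum>j<m. v j) \<le> V - t" for m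
  proof (cases "n \<le> m")
    case True
    show ?thesis
    proof (rule sum_disjoint_le[OF dis v n _ True])
      fix k assume "n \<le> k"
      then have ik: "i \<noteq> k" "{i, k} \<subseteq> {..<Suc k}" using assms by auto
      have "v k + t \<le> v k + v i" by (rule add_left_mono[OF ti])
      also have "\<dots> = sum v {i, k}" using ik(1) by (simp add: add.commute)
      also have "\<dots> \<le> sum v {..<Suc k}" by (rule sum_mono2[OF _ ik(2)]) (simp_all add: v)
      also have "\<dots> \<le> V" by (rule partial_sum_le)
      finally show "v k \<le> V - t" by (simp only: le_diff_eq)
    qed
  next
    case False
    then have "(\<Sum>j<m. v j) \<le> (\<Sum>j<n. v j)" by (intro sum_mono2) (auto simp: v)
    then show ?thesis using n by (rule order_trans)
  qed
  then have "V \<le> V - t" by (rule total_least)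
  then have "t \<le> 0" by simp
  moreover have "0 \<le> t" unfolding t_def by (rule inf_greatest[OF v rest_nonneg])
  ultimately show ?thesis unfolding t_def by (rule order.antisym)
qed

text \<open>The difference of \<open>s\<close> and its summand with index \<open>i\<close> is
  dominated by a remainder of \<open>V\<close> and the earlier terms, all disjoint from
  \<open>v i\<close>; a disjoint summand cannot decrease the modulus. This recovers the coordinates
  and makes the embedding bounded below.\<close>

lemma order_sum_coeff_le:
  assumes "order_sum a s"
  shows "\<bar>a i\<bar> *\<^sub>R v i \<le> \<bar>s\<bar>"
proof -
  obtain c where c: "\<And>n. \<bar>s - (\<Sum>i<n. a i *\<^sub>R v i)\<bar> \<le> c *\<^sub>R (V - (\<Sum>i<n. v i))"
    using assms by (auto simp: order_sum_def)
  define r where "r = s - a i *\<^sub>R v i"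
  define b where "b = \<bar>c\<bar> *\<^sub>R (V - (\<Sum>j<Suc i. v j)) + (\<Sum>j<i. \<bar>a j\<bar> *\<^sub>R v j)"
  have "r = (s - (\<Sum>j<Suc i. a j *\<^sub>R v j)) + (\<Sum>j<i. a j *\<^sub>R v j)" by (simp add: r_def)
  then have "\<bar>r\<bar> \<le> \<bar>s - (\<Sum>j<Suc i. a j *\<^sub>R v j)\<bar> + \<bar>\<Sum>j<i. a j *\<^sub>R v j\<bar>" by (simp only: abs_triangle_ineq)
  also have "\<dots> \<le> b"
    unfolding b_def
  proof (rule add_mono)
    show "\<bar>s - (\<Sum>j<Suc i. a j *\<^sub>R v j)\<bar> \<le> \<bar>c\<bar> *\<^sub>R (V - (\<Sum>j<Suc i. v j))"
      by (rule order_trans[OF c scaleR_right_mono[OF abs_ge_self rest_nonneg]])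
    have "\<bar>\<Sum>j<i. a j *\<^sub>R v j\<bar> \<le> (\<Sum>j<i. \<bar>a j *\<^sub>R v j\<bar>)" by (rule sum_abs)
    then show "\<bar>\<Sum>j<i. a j *\<^sub>R v j\<bar> \<le> (\<Sum>j<i. \<bar>a j\<bar> *\<^sub>R v j)"
      by (simp only: lattice_abs_scaleR abs_of_nonneg[OF v])
  qed
  finally have rb: "\<bar>r\<bar> \<le> b" .
  have "inf (v i) b = 0"
    unfolding b_def
  proof (rule disjoint_add)
    show "inf (v i) (\<bar>c\<bar> *\<^sub>R (V - (\<Sum>j<Suc i. v j))) = 0"
      by (rule disjoint_scaleR[OF rest_disjoint v rest_nonneg abs_ge_zero]) simp
    show "inf (v i) (\<Sum>j<i. \<bar>a j\<bar> *\<^sub>R v j) = 0"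
    proof (rule disjoint_sum)
      fix j assume "j \<in> {..<i}"
      then have "inf (v i) (v j) = 0"
        using dis unfolding disjoint_seq_def by (metis abs_of_nonneg lessThan_iff nat_less_le v)
      then show "0 \<le> \<bar>a j\<bar> *\<^sub>R v j \<and> inf (v i) (\<bar>a j\<bar> *\<^sub>R v j) = 0"
        by (intro conjI disjoint_scaleR scaleR_nonneg_nonneg v abs_ge_zero)
    qed (simp_all add: v)
  qed (intro v scaleR_nonneg_nonneg sum_nonneg rest_nonneg abs_ge_zero)+
  then have "inf b (v i) = 0" by (simp only: inf_commute)
  then have "inf b (\<bar>a i\<bar> *\<^sub>R v i) = 0"
    by (rule disjoint_scaleR) (use order_trans[OF abs_ge_zero rb] v in simp_all)
  then have "inf (\<bar>a i\<bar> *\<^sub>R v i) \<bar>r\<bar> = 0"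
    using disjoint_mono[of b "\<bar>a i\<bar> *\<^sub>R v i" "\<bar>r\<bar>" "\<bar>a i\<bar> *\<^sub>R v i"] rb
    by (simp only: inf_commute abs_ge_zero order_refl scaleR_nonneg_nonneg v)
  then have "inf \<bar>a i *\<^sub>R v i\<bar> \<bar>r\<bar> = 0" by (simp only: lattice_abs_scaleR abs_of_nonneg[OF v])
  from abs_le_abs_add_disjoint[OF this] show ?thesis
    by (simp add: r_def lattice_abs_scaleR abs_of_nonneg[OF v])
qed

text \<open>Adding \<open>c\<close> to the coefficients makes them nonnegative, so the partial sums
  increase and have a supremum; subtracting \<open>c *\<^sub>R V\<close> afterwards undoes the
  shift.\<close>

lemma order_sum_exists:
  assumes sdc: "sigma_dedekind_complete TYPE('a)" and a: "\<And>i. \<bar>a i\<bar> \<le> c"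
  obtains s where "order_sum a s" "\<bar>s\<bar> \<le> c *\<^sub>R V"
proof -
  define A where "A n = (\<Sum>i<n. a i *\<^sub>R v i)" for n
  define W where "W n = (\<Sum>i<n. v i)" for n
  have inc: "0 \<le> (\<Sum>i\<in>I. (a i + c) *\<^sub>R v i)" and dec: "(\<Sum>i\<in>I. (a i + c) *\<^sub>R v i) \<le> (2 * c) *\<^sub>R (\<Sum>i\<in>I. v i)" for I
  proof -
    have ac: "0 \<le> a i + c" "a i + c \<le> 2 * c" for i using a[of i] by (simp_all add: abs_le_iff)
    show "0 \<le> (\<Sum>i\<in>I. (a i + c) *\<^sub>R v i)" by (intro sum_nonneg scaleR_nonneg_nonneg v ac)
    show "(\<Sum>i\<in>I. (a i + c) *\<^sub>R v i) \<le> (2 * c) *\<^sub>R (\<Sum>i\<in>I. v i)"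
      unfolding scaleR_sum_right by (intro sum_mono scaleR_right_mono v ac)
  qed
  have c0: "0 \<le> c" using a[of 0] by linarith
  define t where "t n = (\<Sum>i<n. (a i + c) *\<^sub>R v i)" for n
  have tAW: "t n = A n + c *\<^sub>R W n" for n
    by (simp only: t_def A_def W_def scaleR_left_distrib sum.distrib scaleR_sum_right)
  have split: "(\<Sum>i<m. f i) = (\<Sum>i<n. f i) + (\<Sum>i\<in>{n..<m}. f i)" if "n \<le> m" for f :: "nat \<Rightarrow> 'a" and n m
    using sum.atLeastLessThan_concat[of 0 n m f] that by (simp add: atLeast0LessThan)
  have t_le: "t m \<le> t n + (2 * c) *\<^sub>R (V - W n)" for m n
  proof (cases "n \<le> m")
    case True
    have "t m = t n + (\<Sum>i\<in>{n..<m}. (a i + c) *\<^sub>R v i)" unfolding t_def by (rule split[OF True])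
    also have "\<dots> \<le> t n + (2 * c) *\<^sub>R (\<Sum>i\<in>{n..<m}. v i)" by (rule add_left_mono[OF dec])
    also have "\<dots> \<le> t n + (2 * c) *\<^sub>R (V - W n)"
    proof (intro add_left_mono scaleR_left_mono)
      have "W n + (\<Sum>i\<in>{n..<m}. v i) \<le> V" using partial_sum_le[of m] unfolding W_def split[OF True] .
      then show "(\<Sum>i\<in>{n..<m}. v i) \<le> V - W n" by (simp only: le_diff_eq add.commute)
    qed (use c0 in simp)
    finally show ?thesis .
  next
    case False
    then have "t n = t m + (\<Sum>i\<in>{m..<n}. (a i + c) *\<^sub>R v i)" unfolding t_def by (intro split) simp
    then have "t m \<le> t n" using inc[of "{m..<n}"] by simp
    moreover have "0 \<le> (2 * c) *\<^sub>R (V - W n)" unfolding W_def by (intro scaleR_nonneg_nonneg rest_nonneg) (use c0 in simp)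
    ultimately show ?thesis by (simp add: add_increasing2)
  qed
  have "bdd_above (range t)" using t_le[of _ 0] by (intro bdd_aboveI[of _ "t 0 + (2 * c) *\<^sub>R (V - W 0)"]) auto
  then obtain T where T: "isLub UNIV (range t) T"
    using sdc unfolding sigma_dedekind_complete_def by (metis countableI_type countable_image empty_is_image UNIV_not_empty)
  have T1: "t n \<le> T" for n using isLubD2[OF T] by blast
  have T2: "T \<le> b" if "\<And>n. t n \<le> b" for b
    using isLub_le_isUb[OF T, of b] that by (auto simp: isUb_def setle_def)
  define s where "s = T - c *\<^sub>R V"
  have close: "\<bar>s - A n\<bar> \<le> c *\<^sub>R (V - W n)" for n
  proof -
    have eq: "s - A n = (T - t n) - c *\<^sub>R (V - W n)"
      by (simp add: s_def tAW scaleR_diff_right)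
    have "T - t n \<le> (2 * c) *\<^sub>R (V - W n)" using T2[OF t_le[of _ n]] by (simp only: diff_le_eq add.commute)
    also have "(2 * c) *\<^sub>R (V - W n) = c *\<^sub>R (V - W n) + c *\<^sub>R (V - W n)"
      by (simp only: mult_2 scaleR_left_distrib)
    finally have 1: "s - A n \<le> c *\<^sub>R (V - W n)" unfolding eq by (simp only: diff_le_eq)
    have "0 \<le> T - t n" using T1[of n] by simp
    then have "- (s - A n) \<le> c *\<^sub>R (V - W n)" unfolding eq minus_diff_eq by (simp only: diff_le_eq le_add_same_cancel1)
    with 1 show ?thesis by (simp only: lattice_abs_le_iff)
  qed
  have "order_sum a s" unfolding order_sum_def using close unfolding A_def W_def by blast
  moreover have "\<bar>s\<bar> \<le> c *\<^sub>R V" using close[of 0] by (simp add: A_def W_def)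
  ultimately show ?thesis by (rule that)
qed

end

section \<open>Norming sequences and the operator that is not weakly precompact\<close>

text \<open>Norming functionals of the rational combinations of \<open>x\<close> suffice, since
  these combinations are countable and dense in the span.\<close>

lemma countable_norming_family:
  fixes x :: "nat \<Rightarrow> 'a::real_normed_vector"
  obtains f :: "nat \<Rightarrow> 'a \<Rightarrow> real" where "\<And>i. bounded_linear (f i)" "\<And>i z. \<bar>f i z\<bar> \<le> norm z"
    "\<And>z b. z \<in> span (range x) \<Longrightarrow> (\<And>i. \<bar>f i z\<bar> \<le> b) \<Longrightarrow> norm z \<le> b"
proof -
  define D where "D = range (\<lambda>l :: (rat \<times> nat) list. sum_list (map (\<lambda>(q, n). of_rat q *\<^sub>R x n) l))"
  have Dc: "countable D" unfolding D_def by (rule countable_image) simp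
  have D0: "0 \<in> D" unfolding D_def by (rule range_eqI[of _ _ "[]"]) simp
  have Dcons: "of_rat q *\<^sub>R x n + d \<in> D" if d: "d \<in> D" for q n d
  proof -
    obtain l where "d = sum_list (map (\<lambda>(q, n). of_rat q *\<^sub>R x n) l)"
      using d unfolding D_def by (rule rangeE)
    then show ?thesis unfolding D_def by (intro range_eqI[of _ _ "(q, n) # l"]) simp
  qed
  have dense: "\<exists>d\<in>D. norm (z - d) < \<epsilon>" if z: "z \<in> span (range x)" and e: "0 < \<epsilon>" for z \<epsilon>
    using z e
  proof (induction arbitrary: \<epsilon> rule: span_induct_alt)
    case base
    then show ?case using D0 by (intro bexI[of _ 0]) simp_all
  next
    case (step c y z)
    then obtain n where y: "y = x n" by auto
    obtain d where d: "d \<in> D" "norm (z - d) < \<epsilon> / 2" using step.IH[of "\<epsilon> / 2"] step.prems by auto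
    define \<eta> where "\<eta> = \<epsilon> / (2 * (norm y + 1))"
    have "0 < \<eta>" using step.prems norm_ge_zero[of y] by (simp add: \<eta>_def add_nonneg_pos)
    then obtain q where q: "c < of_rat q" "of_rat q < c + \<eta>" using of_rat_dense[of c "c + \<eta>"] by auto
    have "norm ((c *\<^sub>R y + z) - (of_rat q *\<^sub>R y + d)) = norm ((c - of_rat q) *\<^sub>R y + (z - d))"
      by (simp add: scaleR_left_diff_distrib add_diff_add)
    also have "\<dots> \<le> \<bar>c - of_rat q\<bar> * norm y + norm (z - d)"
      using norm_triangle_ineq[of "(c - of_rat q) *\<^sub>R y" "z - d"] by simp
    also have "\<bar>c - of_rat q\<bar> * norm y \<le> \<eta> * (norm y + 1)" using q by (intro mult_mono) auto
    also have "\<eta> * (norm y + 1) = \<epsilon> / 2"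
      using norm_ge_zero[of y] by (simp add: \<eta>_def field_simps add_nonneg_eq_0_iff)
    finally show ?case using d Dcons[OF d(1), of q n] unfolding y by (intro bexI[of _ "of_rat q *\<^sub>R x n + d"]) auto
  qed
  have "\<exists>g :: 'a \<Rightarrow> real. bounded_linear g \<and> (\<forall>z. \<bar>g z\<bar> \<le> norm z) \<and> g w = norm w" for w
    by (rule norming_functional[of w]) blast
  then obtain G :: "'a \<Rightarrow> 'a \<Rightarrow> real" where G: "\<And>w. bounded_linear (G w)" "\<And>w z. \<bar>G w z\<bar> \<le> norm z" "\<And>w. G w w = norm w"
    by metis
  define f where "f i = G (from_nat_into D i)" for i
  show ?thesis
  proof (rule that[of f])
    show "bounded_linear (f i)" "\<bar>f i z\<bar> \<le> norm z" for i z by (simp_all add: f_def G)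
    fix z b assume z: "z \<in> span (range x)" and b: "\<And>i. \<bar>f i z\<bar> \<le> b"
    show "norm z \<le> b"
    proof (rule field_le_epsilon)
      fix \<epsilon> :: real assume "0 < \<epsilon>"
      then obtain d where d: "d \<in> D" "norm (z - d) < \<epsilon> / 2" using dense[OF z, of "\<epsilon> / 2"] by auto
      obtain i where i: "from_nat_into D i = d" using from_nat_into_surj[OF Dc d(1)] by blast
      have "norm d = f i d" by (simp add: f_def i G(3))
      also have "\<dots> = f i z - f i (z - d)" by (simp add: f_def linear_diff[OF bounded_linear.linear[OF G(1)]])
      also have "\<dots> \<le> b + norm (z - d)" using b[of i] G(2)[of d "z - d"] by (simp add: f_def i abs_le_iff)
      finally have "norm d \<le> b + norm (z - d)" .
      moreover have "norm z \<le> norm (z - d) + norm d" using norm_triangle_ineq[of "z - d" d] by simp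
      ultimately show "norm z \<le> b + \<epsilon>" using d(2) by linarith
    qed
  qed
qed

text \<open>Disjointness keeps all partial sums of \<open>\<bar>y i\<bar>\<close> below
  \<open>u\<close>, so the series of the values \<open>G \<bar>y i\<bar>\<close> is bounded by
  \<open>G u\<close> and converges.\<close>

lemma order_bounded_disjoint_weakly_null:
  fixes y :: "nat \<Rightarrow> 'a::banach_lattice"
  assumes dis: "disjoint_seq y" and bd: "\<And>n. \<bar>y n\<bar> \<le> u"
  shows "weakly_converges y 0"
  unfolding weakly_converges_def
proof (intro allI impI)
  fix g :: "'a \<Rightarrow> real" assume g: "bounded_linear g"
  obtain G where G: "positive_functional G" "\<And>z. \<bar>g z\<bar> \<le> G \<bar>z\<bar>"
    by (rule positive_functional_dominating[OF g]) blast
  have lG: "linear G" using G(1) by (rule positive_functional_linear)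
  have G0: "0 \<le> G \<bar>y n\<bar>" for n using G(1) by (simp add: positive_functional_def)
  have dis': "disjoint_seq (\<lambda>n. \<bar>y n\<bar>)" using dis by (simp add: disjoint_seq_def)
  have u0: "0 \<le> u" using abs_ge_zero bd by (rule order_trans)
  have "(\<Sum>i<n. \<bar>y i\<bar>) \<le> u" for n
    using sum_disjoint_le[OF dis', of 0 u n] u0 bd by simp
  from positive_functional_mono[OF G(1) this] have "(\<Sum>i<n. G \<bar>y i\<bar>) \<le> G u" for n
    by (simp add: linear_sum[OF lG])
  then have "summable (\<lambda>i. G \<bar>y i\<bar>)" using G0 by (intro summableI_nonneg_bounded[of _ "G u"])
  then have "(\<lambda>i. G \<bar>y i\<bar>) \<longlonglongrightarrow> 0" by (rule summable_LIMSEQ_zero)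
  then have "(\<lambda>i. g (y i)) \<longlonglongrightarrow> 0" by (rule Lim_null_comparison[rotated]) (simp add: G(2))
  then show "(\<lambda>i. g (y i)) \<longlonglongrightarrow> g 0" by (simp add: linear_0[OF bounded_linear.linear[OF g]])
qed

text \<open>
  \<open>S\<close> is the composition of \<open>z \<mapsto> (f i z)\<close>, which maps into the bounded sequences isometrically on
  the span of \<open>x\<close>, with a lattice embedding of the bounded sequences into the target space.
\<close>

lemma order_bounded_embedding:
  fixes x :: "nat \<Rightarrow> 'e::real_normed_vector"
  assumes sdc: "sigma_dedekind_complete TYPE('f::banach_lattice)" and noc: "\<not> order_continuous_norm TYPE('f)"
  obtains S :: "'e \<Rightarrow> 'f::banach_lattice" and V \<delta> where "bounded_linear S" "\<And>z. \<bar>S z\<bar> \<le> norm z *\<^sub>R V"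
    "0 < \<delta>" "\<And>z. z \<in> span (range x) \<Longrightarrow> \<delta> * norm z \<le> norm (S z)"
proof -
  obtain v and u :: 'f and \<delta> where dis: "disjoint_seq v" and v: "\<And>n. 0 \<le> v n" and vu: "\<And>n. v n \<le> u"
    and \<delta>: "0 < \<delta>" "\<And>n. \<delta> \<le> norm (v n)"
    by (rule not_order_continuous_disjoint_seq[OF noc]) blast
  have u0: "0 \<le> u" using v vu by (rule order_trans)
  have "(\<Sum>i<n. v i) \<le> u" for n by (rule sum_disjoint_le[OF dis v, of 0]) (simp_all add: u0 vu)
  then have "bdd_above (range (\<lambda>n. \<Sum>i<n. v i))" by (intro bdd_aboveI[of _ u]) auto
  then obtain V where V: "isLub UNIV (range (\<lambda>n. \<Sum>i<n. v i)) V"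
    using sdc unfolding sigma_dedekind_complete_def by (metis countableI_type countable_image empty_is_image UNIV_not_empty)
  obtain f :: "nat \<Rightarrow> 'e \<Rightarrow> real" where f: "\<And>i. bounded_linear (f i)" "\<And>i z. \<bar>f i z\<bar> \<le> norm z"
    "\<And>z b. z \<in> span (range x) \<Longrightarrow> (\<And>i. \<bar>f i z\<bar> \<le> b) \<Longrightarrow> norm z \<le> b"
    by (rule countable_norming_family[of x]) blast
  have "\<exists>s. order_sum v V (\<lambda>i. f i z) s \<and> \<bar>s\<bar> \<le> norm z *\<^sub>R V" for z
    by (rule order_sum_exists[OF dis v V sdc, of "\<lambda>i. f i z" "norm z"]) (use f(2) in blast)+
  then obtain S where S: "\<And>z. order_sum v V (\<lambda>i. f i z) (S z)" "\<And>z. \<bar>S z\<bar> \<le> norm z *\<^sub>R V" by metis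
  note uniq = order_sum_unique[OF dis v V]
  have "bounded_linear S"
  proof (rule bounded_linear_intro[where K = "norm V"])
    show "S (y + z) = S y + S z" for y z
    proof (rule uniq[OF S(1)])
      show "order_sum v V (\<lambda>i. f i (y + z)) (S y + S z)"
        using order_sum_add[OF dis v V S(1) S(1), of y z]
        by (simp add: linear_add[OF bounded_linear.linear[OF f(1)]])
    qed
    show "S (k *\<^sub>R z) = k *\<^sub>R S z" for k z
    proof (rule uniq[OF S(1)])
      show "order_sum v V (\<lambda>i. f i (k *\<^sub>R z)) (k *\<^sub>R S z)"
        using order_sum_scale[OF dis v V S(1), of k z]
        by (simp add: linear_scale[OF bounded_linear.linear[OF f(1)]])
    qed
    show "norm (S z) \<le> norm z * norm V" for z
      using norm_le_of_abs_le[OF S(2)[of z]] by simp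
  qed
  moreover have "\<delta> * norm z \<le> norm (S z)" if z: "z \<in> span (range x)" for z
  proof -
    have "\<bar>f i z\<bar> \<le> norm (S z) / \<delta>" for i
    proof -
      have "\<bar>f i z\<bar> * \<delta> \<le> \<bar>f i z\<bar> * norm (v i)" by (rule mult_left_mono[OF \<delta>(2)]) simp
      also have "\<dots> = norm (\<bar>f i z\<bar> *\<^sub>R v i)" by simp
      also have "\<dots> \<le> norm \<bar>S z\<bar>"
        by (rule norm_mono_nonneg[OF scaleR_nonneg_nonneg[OF abs_ge_zero v] order_sum_coeff_le[OF dis v V S(1)]])
      finally show ?thesis using \<delta>(1) by (simp add: field_simps)
    qed
    from f(3)[OF z this] show ?thesis using \<delta>(1) by (simp add: field_simps)
  qed
  ultimately show ?thesis using that S(2) \<delta>(1) by blast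
qed

text \<open>\<open>S\<close> maps the unit ball into an order interval, which makes it disjointly
  weakly compact. It is bounded below on the span of \<open>x\<close>, so every functional there
  factors through \<open>S\<close>, and a weakly Cauchy image subsequence would make the original
  subsequence weakly Cauchy.\<close>

lemma dwc_not_weakly_precompact_operator:
  assumes sdc: "sigma_dedekind_complete TYPE('f::banach_lattice)" and noc: "\<not> order_continuous_norm TYPE('f)"
    and nwp: "\<not> weakly_precompact (cball (0::'e::real_normed_vector) 1)"
  obtains T :: "'e::real_normed_vector \<Rightarrow> 'f::banach_lattice" where "dwc_operator T" "\<not> weakly_precompact_operator T"
proof -
  obtain x :: "nat \<Rightarrow> 'e" where x: "\<And>n. x n \<in> cball 0 1"
    and no: "\<And>r. strict_mono r \<Longrightarrow> \<not> weakly_Cauchy (x \<circ> r)"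
    using nwp unfolding weakly_precompact_def by (metis bounded_cball)
  obtain S :: "'e \<Rightarrow> 'f" and V \<delta> where S: "bounded_linear S" and SV: "\<And>z. \<bar>S z\<bar> \<le> norm z *\<^sub>R V"
    and \<delta>: "0 < \<delta>" "\<And>z. z \<in> span (range x) \<Longrightarrow> \<delta> * norm z \<le> norm (S z)"
    by (rule order_bounded_embedding[OF sdc noc, of x]) blast
  \<comment> \<open>\<open>V\<close> is known only through the estimate \<open>SV\<close>. A nonzero
    \<open>x n\<close> exists because the zero sequence is weakly Cauchy.\<close>
  have V0: "0 \<le> V"
  proof -
    obtain n where "x n \<noteq> 0"
    proof (rule ccontr)
      assume "\<not> thesis"
      then have "x n = 0" for n using that by blast
      then have "weakly_Cauchy (x \<circ> id)" by (simp add: weakly_Cauchy_def Cauchy_def)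
      then show False using no[of id] strict_mono_id by simp
    qed
    then have "0 < norm (x n)" by simp
    moreover have "0 \<le> norm (x n) *\<^sub>R V" using abs_ge_zero SV by (rule order_trans)
    ultimately have "inverse (norm (x n)) *\<^sub>R 0 \<le> inverse (norm (x n)) *\<^sub>R norm (x n) *\<^sub>R V"
      by (intro scaleR_left_mono) simp_all
    then show ?thesis using \<open>0 < norm (x n)\<close> by simp
  qed
  have "dwc_operator S"
    unfolding dwc_operator_def disjointly_weakly_compact_def
  proof (intro conjI allI impI S)
    show "bounded (S ` cball 0 1)" by (rule bounded_linear_image[OF bounded_cball S])
    fix y assume y: "(\<forall>n. y n \<in> solid_hull (S ` cball 0 1)) \<and> disjoint_seq y"
    show "weakly_converges y 0"
    proof (rule order_bounded_disjoint_weakly_null)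
      show "disjoint_seq y" using y by blast
      fix n
      have "y n \<in> solid_hull (S ` cball 0 1)" using y by blast
      then obtain z where "z \<in> cball 0 1" and z: "\<bar>y n\<bar> \<le> \<bar>S z\<bar>"
        unfolding solid_hull_def by blast
      then have "norm z \<le> 1" by simp
      then have "norm z *\<^sub>R V \<le> 1 *\<^sub>R V" by (rule scaleR_right_mono[OF _ V0])
      with order_trans[OF z SV] show "\<bar>y n\<bar> \<le> 1 *\<^sub>R V" by (rule order_trans)
    qed
  qed
  moreover have "\<not> weakly_precompact_operator S"
  proof
    assume "weakly_precompact_operator S"
    then have "weakly_precompact (S ` cball 0 1)"
      by (simp add: weakly_precompact_operator_def)
    moreover have "(S \<circ> x) n \<in> S ` cball 0 1" for n using x by simp
    ultimately obtain r where r: "strict_mono r" "weakly_Cauchy (S \<circ> x \<circ> r)"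
      unfolding weakly_precompact_def by blast
    have "weakly_Cauchy (x \<circ> r)"
      unfolding weakly_Cauchy_def
    proof (intro allI impI)
      fix h :: "'e \<Rightarrow> real" assume h: "bounded_linear h"
      obtain K where K: "0 < K" "\<And>z. norm (h z) \<le> norm z * K" using bounded_linear.pos_bounded[OF h] by blast
      have K\<delta>: "0 \<le> K / \<delta>" using K \<delta> by simp
      have bound: "h z \<le> K / \<delta> * norm (S z)" if "z \<in> span (range x)" for z
      proof -
        have "h z \<le> K * norm z" using K(2)[of z] by (simp add: mult.commute)
        also have "\<dots> \<le> K * (norm (S z) / \<delta>)" using \<delta> that K by (intro mult_left_mono) (simp_all add: field_simps)
        finally show ?thesis by simp
      qed
      have lh: "linear_on_set (span (range x)) h"
        by (simp add: linear_on_set_def linear_add[OF bounded_linear.linear[OF h]] linear_scale[OF bounded_linear.linear[OF h]])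
      obtain g :: "'f \<Rightarrow> real" where g: "linear g" "\<And>z. g z \<le> K / \<delta> * norm z" "\<And>z. z \<in> span (range x) \<Longrightarrow> g (S z) = h z"
        by (rule hahn_banach_pullback[OF sublinear_norm[OF K\<delta>] bounded_linear.linear[OF S] subspace_span lh bound])
          (assumption, rule that)
      have "bounded_linear g" by (rule bounded_linear_of_le_norm(1)[OF g(1,2)])
      then have "Cauchy (\<lambda>n. g ((S \<circ> x \<circ> r) n))" using r(2) by (simp add: weakly_Cauchy_def)
      moreover have "g ((S \<circ> x \<circ> r) n) = h ((x \<circ> r) n)" for n by (simp add: g(3) span_base)
      ultimately show "Cauchy (\<lambda>n. h ((x \<circ> r) n))" by simp
    qed
    with no[OF r(1)] show False by blast
  qed
  ultimately show ?thesis by (rule that)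
qed

theorem theorem3p13:
  assumes "sigma_dedekind_complete TYPE('e::banach_lattice)"
    and "sigma_dedekind_complete TYPE('f::banach_lattice)"
  shows "(\<forall>T::'e \<Rightarrow> 'f. dwc_operator T \<longrightarrow> weakly_precompact_operator T) \<longleftrightarrow>
    weakly_precompact (cball (0::'e) 1) \<or> order_continuous_norm TYPE('f)"
proof
  assume "\<forall>T::'e \<Rightarrow> 'f. dwc_operator T \<longrightarrow> weakly_precompact_operator T"
  then show "weakly_precompact (cball (0::'e) 1) \<or> order_continuous_norm TYPE('f)"
    using dwc_not_weakly_precompact_operator[OF assms(2)] by metis
next
  assume *: "weakly_precompact (cball (0::'e) 1) \<or> order_continuous_norm TYPE('f)"
  show "\<forall>T::'e \<Rightarrow> 'f. dwc_operator T \<longrightarrow> weakly_precompact_operator T"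
  proof (intro allI impI)
    fix T :: "'e \<Rightarrow> 'f" assume "dwc_operator T"
    then have T: "bounded_linear T" "disjointly_weakly_compact (T ` cball 0 1)"
      by (simp_all add: dwc_operator_def)
    from * have "weakly_precompact (T ` cball 0 1)"
      using weakly_precompact_image[OF T(1)] disjointly_weakly_compact_imp_weakly_precompact[OF _ T(2)] by blast
    then show "weakly_precompact_operator T" by (rule weakly_precompact_operator_of_cball[OF T(1)])
  qed
qed

end
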